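(* Let $d\mu$ be a nontrivial probability measure on $\partial\mathbb{D}$ with Verblunsky coefficients $\{\alpha_j\}_{j=0}^\infty$ and $d\mu = w(\theta)\frac{d\theta}{2\pi}+d\mu_{\mathrm{s}}$. Let $d\mu_1 = w_1(\theta)\frac{d\theta}{2\pi}+d\mu_{1,\mathrm{s}}$ be the measure with Verblunsky coefficients $\alpha_j(d\mu_1)=\alpha_{j+1}$, $j\ge 0$. Let $f$ and $f_1$ be the Schur functions of $d\mu$ and $d\mu_1$, let $\rho_0=(1-|\alpha_0|^2)^{1/2}$, and define $$(\delta_0 D)(z)=\frac{1-\bar\alpha_0 f(z)}{\rho_0}\,\frac{1-zf_1(z)}{1-zf(z)},\qquad z\in\mathbb{D}.$$ Then: (i) $\delta_0 D$ is analytic and nonvanishing on $\mathbb{D}$. (ii) $\log(\delta_0 D)\in\bigcap_{1\le p<\infty} H^p(\mathbb{D})$. (iii) For $\frac{d\theta}{2\pi}$-a.e. $e^{i\theta}\in\partial\mathbb{D}$ with $w(\theta)\neq 0$, $$\frac{w(\theta)}{w_1(\theta)}=|\delta_0 D(e^{i\theta})|^2,$$ and, in particular, $\int_{w_1(\theta)\ne 0}\bigl|\log\bigl(\frac{w(\theta)}{w_1(\theta)}\bigr)\bigr|^p\frac{d\theta}{2\pi}<\infty$ for all $p\in[1,\infty)$. (iv) If $\sum_{j=0}^\infty|\alpha_j|^2<\infty$, then $(\delta_0 D)(z)=\dfrac{D(z;d\mu)}{D(z;d\mu_1)}$, where $D$ is the Szegő function. (v) If $\varphi_j(z;d\mu_1)$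 are the orthonormal polynomials for $d\mu_1$ and $\varphi_j(z;d\mu)$ those for $d\mu$, then for $z\in\mathbb{D}$, $$\lim_{n\to\infty}\frac{\varphi_{n-1}^*(z;d\mu_1)}{\varphi_n^*(z;d\mu)}=(\delta_0D)(z).$$
   Context: $\mathbb{D}=\{|z|<1\}$. A probability measure on $\partial\mathbb{D}$ is nontrivial if it is not a finite combination of delta functions. $\Phi_n$ is the monic orthogonal polynomial of degree $n$ in $L^2(\partial\mathbb{D},d\mu)$, $\varphi_n=\Phi_n/\|\Phi_n\|_{L^2}$, and for a polynomial $P_n$ of degree $n$, $P_n^*(z)=z^n\overline{P_n(1/\bar z)}$. The Verblunsky coefficients are $\alpha_n=-\overline{\Phi_{n+1}(0)}\in\mathbb{D}$; they determine the measure, and every sequence in $\mathbb{D}$ occurs (Verblunsky's theorem). The parts $d\mu_{\mathrm{s}}$, $d\mu_{1,\mathrm{s}}$ are singular with respect to $d\theta$. The Carathéodory function is $F(z)=\int\frac{e^{i\theta}+z}{e^{i\theta}-z}\,d\mu(\theta)$, and the Schur function $f$ of $d\mu$ is the analytic function on $\mathbb{D}$ defined by $F(z)=\frac{1+zf(z)}{1-zf(z)}$. Boundary values are $\lim_{r\uparrow1}(\delta_0D)(re^{i\theta})$. The Szegő function, defined when $\sum_j|\alpha_j|^2<\infty$, is $D(z;d\mu)=\exp\bigl(\int_0^{2\pi}\frac{e^{i\theta}+z}{e^{i\theta}-z}\log(w(\theta))\frac{d\theta}{4\pi}\bigr)$, and similarly for $d\mu_1$ with $w_1$. *)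

theory Defs
  imports "HOL-Probability.Probability" "HOL-Complex_Analysis.Complex_Analysis"
begin

definition circle_borel :: "complex measure" where
  "circle_borel = restrict_space borel (sphere 0 1)"

text \<open>The probability measure $d\theta/2\pi$, in the angle coordinate.\<close>

definition dtheta :: "real measure" where
  "dtheta = uniform_measure lborel {0..<2*pi}"

definition finite_delta_combination :: "complex measure \<Rightarrow> bool" where
  "finite_delta_combination \<mu> \<longleftrightarrow>
     (\<exists>S (c :: complex \<Rightarrow> real). finite S \<and> S \<subseteq> sphere 0 1 \<and>
        (\<forall>A\<in>sets \<mu>. measure \<mu> A = (\<Sum>x\<in>S. c x * indicator A x)))"

definition nontrivial_circle_prob :: "complex measure \<Rightarrow> bool" where
  "nontrivial_circle_prob \<mu> \<longleftrightarrow>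
     prob_space \<mu> \<and> sets \<mu> = sets circle_borel \<and> \<not> finite_delta_combination \<mu>"

definition singular_dtheta :: "complex measure \<Rightarrow> bool" where
  "singular_dtheta \<nu> \<longleftrightarrow>
     (\<exists>N\<in>sets circle_borel.
        emeasure \<nu> (sphere 0 1 - N) = 0 \<and> emeasure (distr dtheta circle_borel cis) N = 0)"

text \<open>$d\mu = w(\theta)\,\frac{d\theta}{2\pi} + d\nu$ with $d\nu$ singular. Only the values
  of $w$ on $[0,2\pi)$ matter.\<close>

definition lebesgue_decomposition ::
    "complex measure \<Rightarrow> (real \<Rightarrow> real) \<Rightarrow> complex measure \<Rightarrow> bool" where
  "lebesgue_decomposition \<mu> w \<nu> \<longleftrightarrow>
     w \<in> borel_measurable dtheta \<and> (AE \<theta> in dtheta. 0 \<le> w \<theta>) \<and>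
     sets \<nu> = sets circle_borel \<and> singular_dtheta \<nu> \<and>
     (\<forall>A\<in>sets circle_borel.
        emeasure \<mu> A =
          (\<integral>\<^sup>+\<theta>. ennreal (w \<theta>) * indicator A (cis \<theta>) \<partial>dtheta) + emeasure \<nu> A)"

definition monic_opuc :: "complex measure \<Rightarrow> nat \<Rightarrow> complex poly" where
  "monic_opuc \<mu> n =
     (THE P. degree P = n \<and> lead_coeff P = 1 \<and>
        (\<forall>Q. degree Q < n \<longrightarrow> (LINT \<zeta>|\<mu>. cnj (poly Q \<zeta>) * poly P \<zeta>) = 0))"

definition orthonormal_opuc :: "complex measure \<Rightarrow> nat \<Rightarrow> complex poly" where
  "orthonormal_opuc \<mu> n =
     smult (complex_of_real (1 / sqrt (LINT \<zeta>|\<mu>. (cmod (poly (monic_opuc \<mu> n) \<zeta>))\<^sup>2)))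
       (monic_opuc \<mu> n)"

text \<open>The polynomial $P^*(z) = z^n\,\overline{P(1/\bar z)}$ for $n = \deg P$; taking it as a
  polynomial gives it the right value at $z = 0$ too.\<close>

definition reversed_poly :: "complex poly \<Rightarrow> complex poly" where
  "reversed_poly P = reflect_poly (map_poly cnj P)"

lemma poly_reversed_poly:
  assumes "z \<noteq> 0"
  shows "poly (reversed_poly P) z = z ^ degree P * cnj (poly P (1 / cnj z))"
proof -
  have "degree (map_poly cnj P) = degree P"
    by (rule degree_map_poly) simp
  then show ?thesis
    using assms poly_cnj[of P "1 / cnj z"]
    by (simp add: reversed_poly_def poly_reflect_poly_nz inverse_eq_divide)
qed

definition verblunsky :: "complex measure \<Rightarrow> nat \<Rightarrow> complex" where
  "verblunsky \<mu> n = - cnj (poly (monic_opuc \<mu> (Suc n)) 0)"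

definition caratheodory_fun :: "complex measure \<Rightarrow> complex \<Rightarrow> complex" where
  "caratheodory_fun \<mu> z = (LINT \<zeta>|\<mu>. (\<zeta> + z) / (\<zeta> - z))"

text \<open>The value 0 outside the disk only serves to make the description unique.\<close>

definition schur_fun :: "complex measure \<Rightarrow> complex \<Rightarrow> complex" where
  "schur_fun \<mu> =
     (THE f. f holomorphic_on ball 0 1 \<and>
        (\<forall>z\<in>ball 0 1. 1 - z * f z \<noteq> 0 \<and>
           caratheodory_fun \<mu> z = (1 + z * f z) / (1 - z * f z)) \<and>
        (\<forall>z. z \<notin> ball 0 1 \<longrightarrow> f z = 0))"

definition szego_fun :: "(real \<Rightarrow> real) \<Rightarrow> complex \<Rightarrow> complex" where
  "szego_fun w z =
     exp (LINT \<theta>:{0..2*pi}|lborel.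
            (cis \<theta> + z) / (cis \<theta> - z) * complex_of_real (ln (w \<theta>) / (4 * pi)))"

text \<open>$\delta_0 D$ for the measure $\mu$ and its once-stripped measure $\mu_1$.\<close>

definition relative_szego :: "complex measure \<Rightarrow> complex measure \<Rightarrow> complex \<Rightarrow> complex" where
  "relative_szego \<mu> \<mu>\<^sub>1 z =
     (let \<alpha>\<^sub>0 = verblunsky \<mu> 0;
          \<rho>\<^sub>0 = sqrt (1 - (cmod \<alpha>\<^sub>0)\<^sup>2);
          f = schur_fun \<mu>;
          f\<^sub>1 = schur_fun \<mu>\<^sub>1
      in (1 - cnj \<alpha>\<^sub>0 * f z) / complex_of_real \<rho>\<^sub>0 * ((1 - z * f\<^sub>1 z) / (1 - z * f z)))"

definition hardy_space :: "real \<Rightarrow> (complex \<Rightarrow> complex) set" where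
  "hardy_space p =
     {g. g holomorphic_on ball 0 1 \<and>
         (SUP r\<in>{0<..<1}. \<integral>\<^sup>+\<theta>. ennreal (cmod (g (of_real r * cis \<theta>)) powr p) \<partial>dtheta) < \<infinity>}"

definition holomorphic_log_branch :: "(complex \<Rightarrow> complex) \<Rightarrow> (complex \<Rightarrow> complex) \<Rightarrow> bool" where
  "holomorphic_log_branch g L \<longleftrightarrow>
     L holomorphic_on ball 0 1 \<and> (\<forall>z\<in>ball 0 1. exp (L z) = g z)"

end

theory Submission
  imports Defs
begin

text \<open>The Szeg\H{o} recursion applied to $\int \frac{\zeta+z}{\zeta-z}\Phi_n\,d\mu$ and its reversed
  companion is the Schur algorithm in disguise (Geronimus), so $f_1$ is the first Schur iterate of
  $f$, and $\Phi_n^*$ factors through the Schur approximants $S_n$, which converge to $f$ because a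
  Schur step contracts the pseudohyperbolic distance. This gives the limit of the ratio of the
  reversed polynomials.

  The function $\delta_0D$ is a constant times $(1-\bar\alpha_0f)(1-zf_1)/(1-zf)$. Each factor is
  $1-g$ with $|g|<1$, hence has a logarithm with bounded imaginary part; bounding the means of
  $|1-g|^{\pm1/2}$ puts this logarithm into every $H^p$ and makes it the Schwarz integral of its
  boundary values. By Fatou's theorem $w=(1-|f|^2)/|1-zf|^2$ almost everywhere, and the Schur
  algorithm on the circle turns the quotient $w/w_1$ into $|\delta_0D|^2$. If
  $\sum|\alpha_j|^2<\infty$, then the means of $-\log(1-|S_n|^2)$ stay below
  $-\sum\log(1-|\alpha_j|^2)$, so $\log w$ is integrable and the Schwarz integrals of $\log w$ and
  $\log w_1$ may be subtracted.\<close>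

subsection \<open>Orthogonal polynomials and the Szeg\H{o} recursion\<close>

text \<open>Only a shift of coefficients relates \<open>\<mu>\<close> and \<open>\<mu>1\<close>, so
  the link between f and f_1 has to be found through the coefficients alone: the approximants depend
  on nothing else, and uniqueness of their limit identifies f_1. The almost-everywhere statements on
  the circle all rest on one weak-type inequality for balls in the plane. It bounds Poisson
  integrals along whole radii, which gives Fatou's theorem for measures, by splitting off a compact
  set carrying almost all the mass, and for bounded analytic functions, whose Taylor tails are small
  in L^2. The obstacle for the Schwarz integrals is that 1-g may vanish on the circle. Half powers
  confine the argument to at most pi/4, which bounds exponential moments of both signs and hence all
  H^p norms at once; passing from g to tg with t < 1 and using |1-tx| >= |1-x|/2 for |x| <= 1
  supplies the dominating function. For the comparison of Szego functions each log weight has to be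
  integrable by itself, and this is what square summability of the coefficients provides.\<close>

lemma degree_map_poly_cnj [simp]: "degree (map_poly cnj P) = degree P"
  by (rule degree_map_poly) simp

lemma degree_reversed_poly_le: "degree (reversed_poly P) \<le> degree P"
  unfolding reversed_poly_def by (rule order.trans[OF degree_reflect_poly_le]) simp

lemma poly_reversed_poly_0: "poly (reversed_poly P) 0 = cnj (lead_coeff P)"
  by (simp add: reversed_poly_def poly_0_coeff_0 coeff_map_poly)

lemma circle_mult_cnj: "cmod \<zeta> = 1 \<Longrightarrow> \<zeta> * cnj \<zeta> = 1"
  using complex_norm_square[of \<zeta>] by simp

lemma poly_reversed_poly_circle:
  assumes "cmod \<zeta> = 1"
  shows "poly (reversed_poly P) \<zeta> = \<zeta> ^ degree P * cnj (poly P \<zeta>)"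
proof -
  have "1 / cnj \<zeta> = \<zeta>"
    using circle_mult_cnj[OF assms] assms by (subst divide_eq_eq) auto
  then show ?thesis
    using poly_reversed_poly[of \<zeta> P] assms by force
qed

lemma space_circle_borel [simp]: "space circle_borel = sphere 0 1"
  by (simp add: circle_borel_def space_restrict_space)

locale nontrivial_circle =
  fixes \<mu> :: "complex measure"
  assumes nontrivial: "nontrivial_circle_prob \<mu>"
begin

sublocale prob_space \<mu>
  using nontrivial by (simp add: nontrivial_circle_prob_def)

lemma sets_mu [simp, measurable_cong]: "sets \<mu> = sets circle_borel"
  using nontrivial by (simp add: nontrivial_circle_prob_def)

lemma space_mu [simp]: "space \<mu> = sphere 0 1"
  using sets_eq_imp_space_eq[OF sets_mu] by simp

lemma measurable_cont:
  fixes g :: "complex \<Rightarrow> 'b::{second_countable_topology,banach}"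
  assumes "continuous_on (sphere 0 1) g"
  shows "g \<in> borel_measurable \<mu>"
  using borel_measurable_continuous_on_restrict[OF assms]
  by (simp add: measurable_cong_sets[OF sets_mu refl] circle_borel_def)

lemma integrable_cont:
  fixes g :: "complex \<Rightarrow> 'b::{second_countable_topology,banach}"
  assumes "continuous_on (sphere 0 1) g"
  shows "integrable \<mu> g"
proof -
  have "compact (g ` sphere 0 1)"
    using assms by (intro compact_continuous_image) auto
  then obtain B where B: "\<And>x. x \<in> sphere 0 1 \<Longrightarrow> norm (g x) \<le> B"
    by (meson bounded_iff compact_imp_bounded image_eqI)
  show ?thesis
    by (rule integrable_const_bound[where B = B]) (use B assms in \<open>auto intro: measurable_cont\<close>)
qed

definition poly_inner :: "complex poly \<Rightarrow> complex poly \<Rightarrow> complex" where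
  "poly_inner Q P = (LINT \<zeta>|\<mu>. cnj (poly Q \<zeta>) * poly P \<zeta>)"

text \<open>As \<open>cnj \<zeta>\<close> inverts \<open>\<zeta>\<close> on the circle, this is the
  inner product of \<open>\<zeta>^k\<close> with \<open>P\<close>. With moments in place of general
  inner products, multiplication by z becomes an index shift and reversal an index flip.\<close>

definition moment :: "nat \<Rightarrow> complex poly \<Rightarrow> complex" where
  "moment k P = (LINT \<zeta>|\<mu>. cnj \<zeta> ^ k * poly P \<zeta>)"

definition sqnorm :: "complex poly \<Rightarrow> real" where
  "sqnorm P = (LINT \<zeta>|\<mu>. (cmod (poly P \<zeta>))\<^sup>2)"

lemma poly_inner_self: "poly_inner P P = complex_of_real (sqnorm P)"
proof -
  have "poly_inner P P = (LINT \<zeta>|\<mu>. complex_of_real ((cmod (poly P \<zeta>))\<^sup>2))"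
    unfolding poly_inner_def by (rule Bochner_Integration.integral_cong) (simp_all only: complex_norm_square mult.commute)
  then show ?thesis
    by (simp only: sqnorm_def integral_complex_of_real)
qed

lemma poly_inner_moment: "poly_inner Q P = (\<Sum>i\<le>degree Q. cnj (coeff Q i) * moment i P)"
proof -
  have "poly_inner Q P = (LINT \<zeta>|\<mu>. (\<Sum>i\<le>degree Q. cnj (coeff Q i) * (cnj \<zeta> ^ i * poly P \<zeta>)))"
    unfolding poly_inner_def
    by (rule Bochner_Integration.integral_cong)
       (simp_all add: poly_altdef[of Q] sum_distrib_left sum_distrib_right mult_ac)
  also have "\<dots> = (\<Sum>i\<le>degree Q. (LINT \<zeta>|\<mu>. cnj (coeff Q i) * (cnj \<zeta> ^ i * poly P \<zeta>)))"
    by (rule Bochner_Integration.integral_sum) (intro integrable_cont continuous_intros)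
  also have "\<dots> = (\<Sum>i\<le>degree Q. cnj (coeff Q i) * moment i P)"
    unfolding moment_def by (intro sum.cong refl integral_mult_right_zero)
  finally show ?thesis .
qed

lemma moment_diff: "moment k (P - Q) = moment k P - moment k Q"
  unfolding moment_def
  by (simp add: right_diff_distrib, rule Bochner_Integration.integral_diff)
     (intro integrable_cont continuous_intros)+

lemma moment_smult: "moment k (smult c P) = c * moment k P"
  unfolding moment_def by (simp add: mult.left_commute)

lemma moment_pCons_Suc: "moment (Suc k) (pCons 0 P) = moment k P"
  unfolding moment_def
proof (rule Bochner_Integration.integral_cong[OF refl])
  fix \<zeta> assume "\<zeta> \<in> space \<mu>"
  then have "\<zeta> * cnj \<zeta> = 1"
    by (simp add: circle_mult_cnj)
  then show "cnj \<zeta> ^ Suc k * poly (pCons 0 P) \<zeta> = cnj \<zeta> ^ k * poly P \<zeta>"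
    by (simp add: mult.assoc) (metis mult.assoc mult.commute mult_1)
qed

text \<open>On the circle the reversed polynomial is \<open>\<zeta>^n\<close> times the conjugate of
  \<open>P\<close>, so reversal conjugates the moments and flips their order. The bound on
  \<open>k\<close> keeps the flipped index from being truncated.\<close>

lemma moment_reversed:
  assumes "k \<le> degree P"
  shows "moment k (reversed_poly P) = cnj (moment (degree P - k) P)"
proof -
  have "moment k (reversed_poly P) = (LINT \<zeta>|\<mu>. cnj (cnj \<zeta> ^ (degree P - k) * poly P \<zeta>))"
    unfolding moment_def
  proof (rule Bochner_Integration.integral_cong[OF refl])
    fix \<zeta> assume "\<zeta> \<in> space \<mu>"
    then have *: "cmod \<zeta> = 1" "cnj \<zeta> * \<zeta> = 1"
      by (simp_all add: circle_mult_cnj mult.commute[of "cnj \<zeta>"])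
    have "cnj \<zeta> ^ k * \<zeta> ^ degree P = cnj \<zeta> ^ k * (\<zeta> ^ k * \<zeta> ^ (degree P - k))"
      using assms by (simp flip: power_add)
    also have "\<dots> = (cnj \<zeta> * \<zeta>) ^ k * \<zeta> ^ (degree P - k)"
      by (simp only: power_mult_distrib mult.assoc)
    finally have "cnj \<zeta> ^ k * \<zeta> ^ degree P = \<zeta> ^ (degree P - k)"
      using * by simp
    then show "cnj \<zeta> ^ k * poly (reversed_poly P) \<zeta> = cnj (cnj \<zeta> ^ (degree P - k) * poly P \<zeta>)"
      by (simp add: poly_reversed_poly_circle[OF *(1)] mult.assoc[symmetric])
  qed
  also have "\<dots> = cnj (moment (degree P - k) P)"
    unfolding moment_def by (rule Bochner_Integration.integral_cnj)
  finally show ?thesis .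
qed

lemma sqnorm_nonneg: "0 \<le> sqnorm P"
  unfolding sqnorm_def by (rule integral_nonneg_AE) simp

text \<open>The only place where the measure's not being a finite combination of point masses
  enters: a polynomial of norm zero vanishes almost everywhere, so otherwise the finitely many zeros
  on the circle would carry the measure.\<close>

lemma sqnorm_eq_0:
  assumes "sqnorm P = 0"
  shows "P = 0"
proof (rule ccontr)
  assume "P \<noteq> 0"
  define S where "S = {x \<in> sphere 0 1. poly P x = 0}"
  have finS: "finite S"
    using poly_roots_finite[OF \<open>P \<noteq> 0\<close>] by (rule finite_subset[rotated]) (auto simp: S_def)
  have "AE x in \<mu>. (cmod (poly P x))\<^sup>2 = 0"
    using assms unfolding sqnorm_def
    by (subst (asm) integral_nonneg_eq_0_iff_AE) (auto intro!: integrable_cont continuous_intros)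
  then have AES: "AE x in \<mu>. x \<in> S"
    using AE_space[of \<mu>] by eventually_elim (auto simp: S_def)
  have sing: "{x} \<in> sets \<mu>" if "x \<in> S" for x
    using that by (auto simp: S_def circle_borel_def sets_restrict_space intro!: image_eqI[of _ _ "{x}"])
  have "measure \<mu> A = (\<Sum>x\<in>S. measure \<mu> {x} * indicator A x)" if A: "A \<in> sets \<mu>" for A
  proof -
    have "measure \<mu> A = measure \<mu> (A \<inter> S)"
    proof (rule measure_eq_AE)
      show "AE x in \<mu>. (x \<in> A) = (x \<in> A \<inter> S)" using AES by eventually_elim auto
      have "S = (\<Union>x\<in>S. {x})" by auto
      also have "\<dots> \<in> sets \<mu>" using finS sing by (intro sets.finite_UN) auto
      finally show "A \<inter> S \<in> sets \<mu>" using A by auto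
    qed (use A in auto)
    also have "\<dots> = (\<Sum>x\<in>A \<inter> S. measure \<mu> {x})"
      using finS sing by (intro finite_measure_eq_sum_singleton) auto
    also have "\<dots> = (\<Sum>x\<in>S. measure \<mu> {x} * indicator A x)"
      using finS sum.inter_restrict[of S "\<lambda>x. measure \<mu> {x}" A]
      by (simp add: Int_commute indicator_def if_distrib cong: if_cong)
    finally show ?thesis .
  qed
  then have "finite_delta_combination \<mu>"
    unfolding finite_delta_combination_def
    by (intro exI[of _ S] exI[of _ "\<lambda>x. measure \<mu> {x}"]) (use finS in \<open>auto simp: S_def\<close>)
  then show False
    using nontrivial by (simp add: nontrivial_circle_prob_def)
qed

definition is_monic_orth :: "nat \<Rightarrow> complex poly \<Rightarrow> bool" where
  "is_monic_orth n P \<longleftrightarrow> degree P = n \<and> lead_coeff P = 1 \<and> (\<forall>k<n. moment k P = 0)"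

lemma is_monic_orth_iff:
  "is_monic_orth n P \<longleftrightarrow> degree P = n \<and> lead_coeff P = 1 \<and> (\<forall>Q. degree Q < n \<longrightarrow> poly_inner Q P = 0)"
proof -
  have "(\<forall>k<n. moment k P = 0) \<longleftrightarrow> (\<forall>Q. degree Q < n \<longrightarrow> poly_inner Q P = 0)"
  proof safe
    fix k assume *: "\<forall>Q. degree Q < n \<longrightarrow> poly_inner Q P = 0" "k < n"
    have "poly_inner (monom 1 k) P = 0"
      using * by (simp add: degree_monom_eq)
    then show "moment k P = 0"
      by (simp add: poly_inner_def moment_def poly_monom)
  next
    fix Q :: "complex poly" assume "\<forall>k<n. moment k P = 0" "degree Q < n"
    then show "poly_inner Q P = 0" by (auto simp: poly_inner_moment intro!: sum.neutral)
  qed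
  then show ?thesis by (simp add: is_monic_orth_def)
qed

text \<open>The leading terms of two candidates cancel, so their difference has degree below n and
  is orthogonal to itself. Degree 0 is treated apart, as no smaller degree exists there.\<close>

lemma is_monic_orth_unique:
  assumes "is_monic_orth n P" "is_monic_orth n Q"
  shows "P = Q"
proof (cases "n = 0")
  case True
  then obtain a b where "P = [:a:]" "Q = [:b:]"
    using assms by (auto simp: is_monic_orth_def elim!: degree_eq_zeroE)
  then show ?thesis using assms by (simp add: is_monic_orth_def)
next
  case False
  have "coeff (P - Q) n = 0" and "degree (P - Q) \<le> n"
    using assms degree_diff_le[of P n Q] by (auto simp: is_monic_orth_def)
  then have deg: "degree (P - Q) < n"
    using False by (metis degree_0 leading_coeff_0_iff le_neq_implies_less neq0_conv)
  have "poly_inner (P - Q) (P - Q) = 0"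
    unfolding poly_inner_moment moment_diff using assms deg by (auto simp: is_monic_orth_def intro!: sum.neutral)
  then show ?thesis
    using sqnorm_eq_0[of "P - Q"] by (simp add: poly_inner_self)
qed

text \<open>In the pairing of \<open>P\<close> with itself only the term of the leading coefficient
  survives, and that coefficient is 1.\<close>

lemma is_monic_orth_top_moment:
  assumes "is_monic_orth n P"
  shows "moment n P = complex_of_real (sqnorm P)"
proof -
  have deg: "degree P = n" and lc: "coeff P n = 1" and m: "\<And>k. k < n \<Longrightarrow> moment k P = 0"
    using assms by (auto simp: is_monic_orth_def)
  have "poly_inner P P = (\<Sum>i\<le>n. cnj (coeff P i) * moment i P)"
    by (simp add: poly_inner_moment deg)
  also have "\<dots> = (\<Sum>i\<in>{n}. cnj (coeff P i) * moment i P)"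
    by (rule sum.mono_neutral_right) (auto intro: m)
  finally show ?thesis by (simp add: poly_inner_self lc)
qed

lemma is_monic_orth_sqnorm_pos:
  assumes "is_monic_orth n P"
  shows "sqnorm P > 0"
proof -
  have "P \<noteq> 0" using assms by (auto simp: is_monic_orth_def)
  then show ?thesis using sqnorm_eq_0[of P] sqnorm_nonneg[of P] by fastforce
qed

text \<open>Both \<open>z P\<close> and the reversed polynomial have vanishing moments 1 to n, hence
  so has every combination; \<open>c\<close> removes the remaining moment 0, which for the reversed
  polynomial is the squared norm.\<close>

lemma is_monic_orth_Suc:
  assumes P: "is_monic_orth n P"
  defines "c \<equiv> moment 0 (pCons 0 P) / sqnorm P"
  shows "is_monic_orth (Suc n) (pCons 0 P - smult c (reversed_poly P))"
proof -
  have deg: "degree P = n" and lc: "coeff P n = 1" and m: "\<And>k. k < n \<Longrightarrow> moment k P = 0"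
    and "P \<noteq> 0"
    using P by (auto simp: is_monic_orth_def)
  have pos: "sqnorm P > 0" using is_monic_orth_sqnorm_pos[OF P] .
  let ?R = "pCons 0 P - smult c (reversed_poly P)"
  have degr: "degree (smult c (reversed_poly P)) < Suc n"
    using degree_reversed_poly_le[of P] degree_smult_le[of c "reversed_poly P"] deg by linarith
  have "degree (pCons 0 P) = Suc n"
    using \<open>P \<noteq> 0\<close> deg by simp
  then have dR: "degree ?R = Suc n"
    using degr degree_add_eq_left[of "- smult c (reversed_poly P)" "pCons 0 P"] by simp
  have "coeff (smult c (reversed_poly P)) (Suc n) = 0"
    using degr by (rule coeff_eq_0)
  then have lR: "lead_coeff ?R = 1"
    using dR lc by (simp add: coeff_diff del: coeff_smult)
  have "moment k ?R = 0" if "k < Suc n" for k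
  proof (cases k)
    case 0
    have "moment 0 (reversed_poly P) = complex_of_real (sqnorm P)"
      using moment_reversed[of 0 P] is_monic_orth_top_moment[OF P] deg by simp
    then show ?thesis using 0 pos by (simp add: moment_diff moment_smult c_def)
  next
    case (Suc j)
    have "moment k (reversed_poly P) = 0"
      using moment_reversed[of k P] Suc that deg by (simp add: m)
    then show ?thesis using Suc that by (simp add: moment_diff moment_smult moment_pCons_Suc m)
  qed
  then show ?thesis using dR lR by (simp add: is_monic_orth_def)
qed

lemma is_monic_orth_exists: "\<exists>P. is_monic_orth n P"
proof (induction n)
  case 0
  have "is_monic_orth 0 1" by (simp add: is_monic_orth_def)
  then show ?case by blast
next
  case (Suc n)
  then show ?case using is_monic_orth_Suc by blast
qed

abbreviation "\<Phi> \<equiv> monic_opuc \<mu>"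
abbreviation "\<Phi>s n \<equiv> reversed_poly (\<Phi> n)"
abbreviation "\<alpha> \<equiv> verblunsky \<mu>"

lemma is_monic_orth_monic_opuc: "is_monic_orth n (\<Phi> n)"
proof -
  have "\<Phi> n = (THE P. is_monic_orth n P)"
    by (simp add: monic_opuc_def is_monic_orth_iff poly_inner_def)
  also have "is_monic_orth n \<dots>"
    using is_monic_orth_exists[of n] is_monic_orth_unique by (metis theI)
  finally show ?thesis .
qed

lemma degree_monic_opuc [simp]: "degree (\<Phi> n) = n"
  and coeff_monic_opuc [simp]: "coeff (\<Phi> n) n = 1"
  using is_monic_orth_monic_opuc[of n] by (auto simp: is_monic_orth_def)

lemma monic_opuc_0 [simp]: "\<Phi> 0 = 1"
  by (rule is_monic_orth_unique[OF is_monic_orth_monic_opuc]) (simp add: is_monic_orth_def)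

lemma moment_monic_opuc: "k < n \<Longrightarrow> moment k (\<Phi> n) = 0"
  using is_monic_orth_monic_opuc[of n] by (simp add: is_monic_orth_def)

lemma verblunsky_moment: "moment 0 (pCons 0 (\<Phi> n)) = cnj (\<alpha> n) * sqnorm (\<Phi> n)"
  and szego_recursion: "\<Phi> (Suc n) = pCons 0 (\<Phi> n) - smult (cnj (\<alpha> n)) (\<Phi>s n)"
proof -
  define c where "c = moment 0 (pCons 0 (\<Phi> n)) / sqnorm (\<Phi> n)"
  have eq: "\<Phi> (Suc n) = pCons 0 (\<Phi> n) - smult c (\<Phi>s n)"
    unfolding c_def
    by (rule is_monic_orth_unique[OF is_monic_orth_monic_opuc is_monic_orth_Suc[OF is_monic_orth_monic_opuc]])
  \<comment> \<open>At z = 0 the shifted term vanishes and the reversed polynomial has value 1, so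
    \<open>c\<close> can be read off.\<close>
  have "\<alpha> n = cnj c"
    unfolding verblunsky_def eq by (simp add: poly_reversed_poly_0)
  then have c: "c = cnj (\<alpha> n)" by simp
  show "\<Phi> (Suc n) = pCons 0 (\<Phi> n) - smult (cnj (\<alpha> n)) (\<Phi>s n)"
    using eq c by simp
  show "moment 0 (pCons 0 (\<Phi> n)) = cnj (\<alpha> n) * sqnorm (\<Phi> n)"
    using is_monic_orth_sqnorm_pos[OF is_monic_orth_monic_opuc, of n] c[symmetric] by (simp add: c_def)
qed

lemma poly_monic_opuc_Suc:
  "poly (\<Phi> (Suc n)) z = z * poly (\<Phi> n) z - cnj (\<alpha> n) * poly (\<Phi>s n) z"
  by (simp add: szego_recursion)

lemma poly_reversed_opuc_Suc:
  "poly (\<Phi>s (Suc n)) z = poly (\<Phi>s n) z - \<alpha> n * z * poly (\<Phi> n) z"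
proof (cases "z = 0")
  case True
  then show ?thesis by (simp add: poly_reversed_poly_0)
next
  case False
  \<comment> \<open>The recursion for \<open>\<Phi>\<close> at the reflected point \<open>w\<close>,
    conjugated and multiplied by \<open>z^(n+1)\<close>, becomes the recursion for the reversed
    polynomials.\<close>
  define w where "w = 1 / cnj z"
  have "poly (\<Phi>s n) w = w ^ n * cnj (poly (\<Phi> n) z)"
    using poly_reversed_poly[of w "\<Phi> n"] False by (simp add: w_def)
  then have "z ^ Suc n * cnj (poly (\<Phi>s n) w) = z * poly (\<Phi> n) z"
    using False by (simp add: w_def power_divide)
  moreover have "z ^ Suc n * cnj (w * poly (\<Phi> n) w) = poly (\<Phi>s n) z"
    using poly_reversed_poly[of z "\<Phi> n"] False by (simp add: w_def)
  moreover have "poly (\<Phi>s (Suc n)) z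
     = z ^ Suc n * cnj (w * poly (\<Phi> n) w) - \<alpha> n * (z ^ Suc n * cnj (poly (\<Phi>s n) w))"
    using poly_reversed_poly[of z "\<Phi> (Suc n)"] False
    by (simp add: w_def[symmetric] poly_monic_opuc_Suc ring_distribs mult_ac del: power_Suc)
  ultimately show ?thesis by (simp add: mult.assoc)
qed

lemma moment_reversed_opuc:
  "moment 0 (\<Phi>s n) = complex_of_real (sqnorm (\<Phi> n))"
  "1 \<le> k \<Longrightarrow> k \<le> n \<Longrightarrow> moment k (\<Phi>s n) = 0"
  using moment_reversed[of 0 "\<Phi> n"] is_monic_orth_top_moment[OF is_monic_orth_monic_opuc, of n]
    moment_reversed[of k "\<Phi> n"] moment_monic_opuc[of "n - k" n] by auto

lemma sqnorm_opuc_Suc: "sqnorm (\<Phi> (Suc n)) = (1 - (cmod (\<alpha> n))\<^sup>2) * sqnorm (\<Phi> n)"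
proof -
  \<comment> \<open>This index lies one beyond the range of \<open>moment_reversed\<close>, hence
    the direct computation. The value is \<open>\<alpha> n\<close> times the squared norm.\<close>
  have "moment (Suc n) (\<Phi>s n) = cnj (moment 0 (pCons 0 (\<Phi> n)))"
    unfolding moment_def
  proof (subst Bochner_Integration.integral_cnj[symmetric], rule Bochner_Integration.integral_cong[OF refl])
    fix \<zeta> assume "\<zeta> \<in> space \<mu>"
    then have *: "cmod \<zeta> = 1" "cnj \<zeta> * \<zeta> = 1"
      by (simp_all add: circle_mult_cnj mult.commute[of "cnj \<zeta>"])
    have "cnj \<zeta> ^ Suc n * \<zeta> ^ n = cnj \<zeta> * (cnj \<zeta> * \<zeta>) ^ n"
      by (simp add: power_mult_distrib)
    then have "cnj \<zeta> ^ Suc n * \<zeta> ^ n = cnj \<zeta>" using * by simp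
    then show "cnj \<zeta> ^ Suc n * poly (\<Phi>s n) \<zeta> = cnj (cnj \<zeta> ^ 0 * poly (pCons 0 (\<Phi> n)) \<zeta>)"
      by (simp add: poly_reversed_poly_circle[OF *(1)] mult.assoc[symmetric])
  qed
  then have "complex_of_real (sqnorm (\<Phi> (Suc n)))
      = sqnorm (\<Phi> n) - cnj (\<alpha> n) * (\<alpha> n * sqnorm (\<Phi> n))"
    using is_monic_orth_top_moment[OF is_monic_orth_monic_opuc, of "Suc n"] is_monic_orth_top_moment[OF is_monic_orth_monic_opuc, of n]
      verblunsky_moment[of n]
    by (simp add: szego_recursion moment_diff moment_smult moment_pCons_Suc)
  also have "\<dots> = complex_of_real ((1 - (cmod (\<alpha> n))\<^sup>2) * sqnorm (\<Phi> n))"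
    by (simp add: algebra_simps complex_norm_square flip: of_real_power)
  finally show ?thesis
    using of_real_eq_iff by blast
qed

text \<open>Squared norms of consecutive monic polynomials are positive, hence so is their ratio,
  which is 1 minus the squared modulus of the coefficient.\<close>

lemma cmod_verblunsky: "cmod (\<alpha> n) < 1"
proof -
  have "(1 - (cmod (\<alpha> n))\<^sup>2) * sqnorm (\<Phi> n) > 0"
    using is_monic_orth_sqnorm_pos[OF is_monic_orth_monic_opuc, of "Suc n"] by (simp add: sqnorm_opuc_Suc)
  then have "(cmod (\<alpha> n))\<^sup>2 < 1\<^sup>2"
    using is_monic_orth_sqnorm_pos[OF is_monic_orth_monic_opuc, of n] by (simp add: zero_less_mult_iff)
  then show ?thesis
    by (rule power_less_imp_less_base) simp
qed

lemma sqnorm_opuc: "sqnorm (\<Phi> n) = (\<Prod>j<n. 1 - (cmod (\<alpha> j))\<^sup>2)"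
proof (induction n)
  case 0
  show ?case using prob_space by (simp add: sqnorm_def)
next
  case (Suc n)
  then show ?case by (simp add: sqnorm_opuc_Suc)
qed

end

subsection \<open>The Schur algorithm\<close>

text \<open>The bound is not strict because division by z can produce a unimodular constant;
  \<open>schur_class_strict\<close> restores strictness once the value at 0 is known to lie inside
  the disk.\<close>

definition schur_class :: "(complex \<Rightarrow> complex) \<Rightarrow> bool" where
  "schur_class f \<longleftrightarrow> f holomorphic_on ball 0 1 \<and> (\<forall>z\<in>ball 0 1. cmod (f z) \<le> 1)"

lemma schur_class_strict:
  assumes f: "schur_class f" and 0: "cmod (f 0) < 1" and z: "cmod z < 1"
  shows "cmod (f z) < 1"
proof (rule ccontr)
  assume "\<not> cmod (f z) < 1"
  then have fz: "cmod (f z) \<ge> 1" by simp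
  have "f constant_on ball 0 1"
  proof (rule maximum_modulus_principle[where U = "ball 0 1" and \<xi> = z])
    show "f holomorphic_on ball 0 1" using f by (simp add: schur_class_def)
    show "\<And>w. w \<in> ball 0 1 \<Longrightarrow> cmod (f w) \<le> cmod (f z)"
      using f fz unfolding schur_class_def by force
  qed (use z in auto)
  then have "f z = f 0"
    using z unfolding constant_on_def by force
  then show False using fz 0 by simp
qed

text \<open>Schwarz's lemma bounds the quotient off the origin by its first part and at the origin,
  where the quotient is the derivative of \<open>g\<close>, by its second.\<close>

lemma divide_by_z:
  assumes g: "g holomorphic_on ball 0 1" "g 0 = 0" and lt: "\<And>z. cmod z < 1 \<Longrightarrow> cmod (g z) < 1"
  obtains h where "schur_class h" "\<And>z. cmod z < 1 \<Longrightarrow> g z = z * h z"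
proof -
  obtain h where h: "h holomorphic_on ball 0 1" "\<And>z. cmod z < 1 \<Longrightarrow> g z = z * h z" "deriv g 0 = h 0"
    using Schwarz3[OF g] by blast
  have "cmod (h z) \<le> 1" if "cmod z < 1" for z
  proof (cases "z = 0")
    case True
    then show ?thesis using Schwarz_Lemma(2)[OF g lt, of 0] h(3) by simp
  next
    case False
    have "cmod z * cmod (h z) \<le> cmod z"
      using Schwarz_Lemma(1)[OF g lt that] h(2)[OF that] by (simp add: norm_mult)
    then show ?thesis using False by simp
  qed
  then show ?thesis using that[of h] h by (simp add: schur_class_def)
qed

lemma norm_cnj_mult_less:
  assumes "cmod a < 1" "cmod w \<le> 1"
  shows "cmod (cnj a * w) < 1"
proof -
  have "cmod a * cmod w \<le> cmod a * 1"
    using assms by (intro mult_left_mono) auto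
  then show ?thesis using assms by (simp add: norm_mult)
qed

lemma one_minus_nonzero: "cmod x < 1 \<Longrightarrow> 1 - x \<noteq> 0"
  by auto

lemma one_plus_nonzero: "cmod x < 1 \<Longrightarrow> 1 + x \<noteq> 0"
  using one_minus_nonzero[of "- x"] by simp

text \<open>A polynomial identity with \<open>a\<close> and \<open>w\<close> arbitrary, so it serves
  inside the disk as well as for boundary values, where the modulus may be 1.\<close>

lemma mobius_defect:
  "(cmod (1 - cnj a * w))\<^sup>2 - (cmod (w - a))\<^sup>2 = (1 - (cmod a)\<^sup>2) * (1 - (cmod w)\<^sup>2)"
proof -
  have "complex_of_real ((cmod (1 - cnj a * w))\<^sup>2 - (cmod (w - a))\<^sup>2)
      = complex_of_real ((1 - (cmod a)\<^sup>2) * (1 - (cmod w)\<^sup>2))"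
    unfolding of_real_diff of_real_mult complex_norm_square by (simp add: algebra_simps)
  then show ?thesis using of_real_eq_iff by blast
qed

lemma mobius_less:
  assumes "cmod a < 1" "cmod w < 1"
  shows "cmod ((w - a) / (1 - cnj a * w)) < 1"
proof -
  have "(1 - (cmod a)\<^sup>2) * (1 - (cmod w)\<^sup>2) > 0"
    using assms by (simp add: abs_square_less_1)
  then have "(cmod (w - a))\<^sup>2 < (cmod (1 - cnj a * w))\<^sup>2"
    using mobius_defect[of a w] by linarith
  then have "cmod (w - a) < cmod (1 - cnj a * w)"
    by (rule power_less_imp_less_base) simp
  moreover have "0 < cmod (1 - cnj a * w)"
    using calculation norm_ge_zero[of "w - a"] by linarith
  ultimately show ?thesis
    by (simp add: norm_divide)
qed

section \<open>Pseudohyperbolic distance and convergence of the Schur approximants\<close>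

definition pseudohyp_dist :: "complex \<Rightarrow> complex \<Rightarrow> real" where
  "pseudohyp_dist a b = cmod (a - b) / cmod (1 - cnj a * b)"

lemma pseudohyp_dist_nonneg: "0 \<le> pseudohyp_dist a b"
  by (simp add: pseudohyp_dist_def)

lemma pseudohyp_dist_le_1:
  assumes "cmod a < 1" "cmod b < 1"
  shows "pseudohyp_dist a b \<le> 1"
  using mobius_less[OF assms] by (simp add: pseudohyp_dist_def norm_divide norm_minus_commute)

lemma pseudohyp_dist_mobius:
  assumes a: "cmod a < 1" and u: "cmod u < 1" and v: "cmod v < 1"
  shows "pseudohyp_dist ((a + u) / (1 + cnj a * u)) ((a + v) / (1 + cnj a * v)) = pseudohyp_dist u v"
proof -
  define p q where "p = 1 + cnj a * u" and "q = 1 + cnj a * v"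
  have nz: "p \<noteq> 0" "q \<noteq> 0"
    unfolding p_def q_def using norm_cnj_mult_less a u v by (intro one_plus_nonzero; simp)+
  \<comment> \<open>The factor \<open>k\<close> occurs in the numerator and in the denominator of
    the transformed distance and cancels; \<open>p\<close> and \<open>cnj p\<close> have equal
    modulus.\<close>
  define k where "k = 1 - a * cnj a"
  have "(cmod a)\<^sup>2 \<noteq> 1" using a by (metis abs_norm_cancel abs_square_eq_1 less_irrefl)
  then have k: "k \<noteq> 0"
    using complex_norm_square[of a] by (metis k_def eq_iff_diff_eq_0 of_real_1 of_real_eq_iff)
  have 1: "(a + u) / p - (a + v) / q = k * (u - v) / (p * q)"
    using nz by (simp add: field_simps) (simp add: p_def q_def k_def algebra_simps)
  have "cnj p \<noteq> 0" using nz by simp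
  then have 2: "1 - cnj ((a + u) / p) * ((a + v) / q) = k * (1 - cnj u * v) / (cnj p * q)"
    using nz by (simp add: field_simps) (simp add: p_def q_def k_def algebra_simps)
  show ?thesis
    unfolding pseudohyp_dist_def p_def[symmetric] q_def[symmetric] 1 2
    using nz k by (simp add: norm_divide norm_mult)
qed

text \<open>The factor is the pseudohyperbolic distance between z and -z. It does not depend on u
  and v, so the contraction is uniform however close the iterates come to the circle.\<close>

lemma pseudohyp_dist_contract:
  assumes z: "cmod z < 1" and u: "cmod u < 1" and v: "cmod v < 1"
  shows "pseudohyp_dist (z * u) (z * v) \<le> 2 * cmod z / (1 + (cmod z)\<^sup>2) * pseudohyp_dist u v"
proof -
  define t where "t = cnj u * v"
  define s where "s = (cmod z)\<^sup>2"
  have t1: "cmod t < 1" unfolding t_def using norm_cnj_mult_less u v by simp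
  have s: "0 \<le> s" "s < 1" using z by (simp_all add: s_def abs_square_less_1)
  have "cmod (1 - t) * (1 + s) \<le> 2 * cmod (1 - s * t)"
  proof (rule power2_le_imp_le)
    \<comment> \<open>The difference of the squares is rewritten as a sum of terms that are
      nonnegative because s < 1 and |t| < 1.\<close>
    have "(2 * cmod (1 - s * t))\<^sup>2 - (cmod (1 - t) * (1 + s))\<^sup>2
       = (1 - s)\<^sup>2 * (cmod (1 + t))\<^sup>2 + 2 * (1 - s) * (1 + s) * (1 - (cmod t)\<^sup>2)"
      unfolding power_mult_distrib cmod_power2 by (simp add: power2_eq_square algebra_simps)
    also have "\<dots> \<ge> 0"
      using s t1 by (intro add_nonneg_nonneg mult_nonneg_nonneg) (auto simp: abs_square_le_1)
    finally show "(cmod (1 - t) * (1 + s))\<^sup>2 \<le> (2 * cmod (1 - s * t))\<^sup>2" by simp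
  qed auto
  moreover have st: "cnj (z * u) * (z * v) = s * t"
    by (simp add: s_def t_def complex_norm_square mult_ac flip: of_real_power)
  moreover have "cmod (1 - t) > 0"
    using one_minus_nonzero[OF t1] by simp
  moreover have "cmod (of_real s * t) < 1"
  proof -
    have "s * cmod t \<le> 1 * cmod t" using s by (intro mult_right_mono) auto
    then show ?thesis using s t1 by (simp add: norm_mult)
  qed
  then have "cmod (1 - s * t) > 0"
    using one_minus_nonzero by simp
  moreover have "1 + s > 0" using s by simp
  moreover have "1 / B \<le> 2 / ((1 + s) * A)" if "A * (1 + s) \<le> 2 * B" "0 < A" "0 < B" "0 < 1 + s" for A B :: real
  proof -
    have "0 < (1 + s) * A" using that by simp
    then show ?thesis using that by (simp add: divide_simps mult.commute)
  qed
  ultimately have "1 / cmod (1 - s * t) \<le> 2 / ((1 + s) * cmod (1 - t))"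
    by blast
  then have "cmod z * cmod (u - v) * (1 / cmod (1 - s * t))
     \<le> cmod z * cmod (u - v) * (2 / ((1 + s) * cmod (1 - t)))"
    by (intro mult_left_mono) auto
  moreover have "z * u - z * v = z * (u - v)" by (simp add: algebra_simps)
  ultimately show ?thesis
    unfolding pseudohyp_dist_def st t_def[symmetric] s_def[symmetric] by (simp add: norm_mult mult_ac)
qed

text \<open>The Schur function with parameters $a_0,\dots,a_{n-1},0,0,\dots$.\<close>

fun schur_approx :: "nat \<Rightarrow> (nat \<Rightarrow> complex) \<Rightarrow> complex \<Rightarrow> complex" where
  "schur_approx 0 a z = 0"
| "schur_approx (Suc n) a z =
     (a 0 + z * schur_approx n (\<lambda>j. a (Suc j)) z) / (1 + cnj (a 0) * (z * schur_approx n (\<lambda>j. a (Suc j)) z))"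

lemma norm_mult_less_1: "cmod z < 1 \<Longrightarrow> cmod w \<le> 1 \<Longrightarrow> cmod (z * w) < 1"
  using norm_cnj_mult_less[of "cnj z" w] by simp

lemma schur_approx_less:
  assumes "\<And>j. cmod (a j) < 1" "cmod z < 1"
  shows "cmod (schur_approx n a z) < 1"
  using assms(1)
proof (induction n arbitrary: a)
  case (Suc n)
  have "cmod (z * schur_approx n (\<lambda>j. a (Suc j)) z) < 1"
    using Suc assms(2) by (intro norm_mult_less_1 less_imp_le) auto
  then show ?case
    using mobius_less[of "- a 0" "z * schur_approx n (\<lambda>j. a (Suc j)) z"] Suc.prems by (simp add: add.commute)
qed auto

lemma schur_approx_holomorphic:
  assumes "\<And>j. cmod (a j) < 1"
  shows "schur_approx n a holomorphic_on ball 0 1"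
  using assms
proof (induction n arbitrary: a)
  case 0
  have "schur_approx 0 a = (\<lambda>z. 0)" by (simp add: fun_eq_iff)
  then show ?case by simp
next
  case (Suc n)
  define s where "s = schur_approx n (\<lambda>j. a (Suc j))"
  have s: "s holomorphic_on ball 0 1" using Suc unfolding s_def by simp
  have nz: "1 + cnj (a 0) * (z * s z) \<noteq> 0" if "z \<in> ball 0 1" for z
    using that Suc.prems schur_approx_less[of "\<lambda>j. a (Suc j)" z n] unfolding s_def
    by (intro one_plus_nonzero norm_cnj_mult_less less_imp_le[OF norm_mult_less_1] less_imp_le) auto
  have eq: "schur_approx (Suc n) a = (\<lambda>z. (a 0 + z * s z) / (1 + cnj (a 0) * (z * s z)))"
    by (simp add: s_def fun_eq_iff)
  show ?case unfolding eq by (intro holomorphic_intros s nz)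
qed

text \<open>At the fixed point z, \<open>b\<close> lists the values of the successive Schur
  iterates. Both quantities undergo the same first step: a multiplication by z, which contracts,
  followed by a disk automorphism, which is an isometry. The induction starts from the trivial bound
  1.\<close>

lemma schur_approx_pseudohyp_dist:
  assumes z: "cmod z < 1" and "\<And>j. cmod (a j) < 1" "\<And>j. cmod (b j) < 1"
    and "\<And>j. b j = (a j + z * b (Suc j)) / (1 + cnj (a j) * (z * b (Suc j)))"
  shows "pseudohyp_dist (b 0) (schur_approx n a z) \<le> (2 * cmod z / (1 + (cmod z)\<^sup>2)) ^ n"
  using assms(2-)
proof (induction n arbitrary: a b)
  case 0
  show ?case using pseudohyp_dist_le_1[of "b 0" 0] 0(2) by simp
next
  case (Suc n)
  define s where "s = schur_approx n (\<lambda>j. a (Suc j)) z"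
  have s: "cmod s < 1" unfolding s_def using Suc.prems(1) z by (intro schur_approx_less) auto
  have "pseudohyp_dist (b 0) (schur_approx (Suc n) a z) = pseudohyp_dist (z * b 1) (z * s)"
  proof -
    have "b 0 = (a 0 + z * b 1) / (1 + cnj (a 0) * (z * b 1))"
      unfolding One_nat_def by (rule Suc.prems(3))
    moreover have "schur_approx (Suc n) a z = (a 0 + z * s) / (1 + cnj (a 0) * (z * s))"
      by (simp add: s_def)
    ultimately show ?thesis
      using pseudohyp_dist_mobius[of "a 0" "z * b 1" "z * s"] Suc.prems(1)[of 0]
        norm_mult_less_1[OF z less_imp_le[OF s]] norm_mult_less_1[OF z less_imp_le[OF Suc.prems(2)[of 1]]]
      by metis
  qed
  also have "\<dots> \<le> 2 * cmod z / (1 + (cmod z)\<^sup>2) * pseudohyp_dist (b 1) s"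
    using Suc.prems(2) s z by (intro pseudohyp_dist_contract) auto
  also have "\<dots> \<le> 2 * cmod z / (1 + (cmod z)\<^sup>2) * (2 * cmod z / (1 + (cmod z)\<^sup>2)) ^ n"
    using Suc.IH[of "\<lambda>j. a (Suc j)" "\<lambda>j. b (Suc j)", OF Suc.prems(1,2) Suc.prems(3)]
    by (intro mult_left_mono) (auto simp: s_def add_pos_nonneg intro!: divide_nonneg_nonneg)
  finally show ?case by simp
qed

text \<open>A sequence of disk values obeying the recursion has its first term determined by the
  coefficients; this is how Schur functions of different origin get identified.\<close>

lemma schur_approx_tendsto:
  assumes z: "cmod z < 1" and a: "\<And>j. cmod (a j) < 1" and b: "\<And>j. cmod (b j) < 1"
    and eq: "\<And>j. b j = (a j + z * b (Suc j)) / (1 + cnj (a j) * (z * b (Suc j)))"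
  shows "(\<lambda>n. schur_approx n a z) \<longlonglongrightarrow> b 0"
proof -
  define \<kappa> where "\<kappa> = 2 * cmod z / (1 + (cmod z)\<^sup>2)"
  have "0 < (1 - cmod z)\<^sup>2" using z by simp
  then have "0 \<le> \<kappa>" "\<kappa> < 1"
    by (auto simp: \<kappa>_def power2_eq_square algebra_simps add_pos_nonneg intro!: divide_nonneg_nonneg add_nonneg_nonneg)
  then have lim: "(\<lambda>n. 2 * \<kappa> ^ n) \<longlonglongrightarrow> 0"
    by (auto intro!: tendsto_eq_intros LIMSEQ_power_zero)
  have "cmod (schur_approx n a z - b 0) \<le> 2 * \<kappa> ^ n" for n
  proof -
    define s where "s = schur_approx n a z"
    have s: "cmod s < 1" unfolding s_def using a z by (rule schur_approx_less)
    have c: "cmod (cnj (b 0) * s) < 1" using b s by (intro norm_cnj_mult_less) auto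
    then have "cmod (1 - cnj (b 0) * s) > 0" using one_minus_nonzero by simp
    \<comment> \<open>Return to the Euclidean distance: the denominator of the pseudohyperbolic one
      is at most 2.\<close>
    then have "cmod (b 0 - s) = pseudohyp_dist (b 0) s * cmod (1 - cnj (b 0) * s)"
      by (simp add: pseudohyp_dist_def)
    also have "\<dots> \<le> \<kappa> ^ n * 2"
      using schur_approx_pseudohyp_dist[where n = n and a = a and b = b, OF z a b eq] c norm_triangle_ineq4[of 1 "cnj (b 0) * s"]
      by (intro mult_mono) (auto simp: \<kappa>_def s_def pseudohyp_dist_nonneg intro!: zero_le_power divide_nonneg_nonneg)
    finally show ?thesis by (simp add: s_def norm_minus_commute mult.commute)
  qed
  then have "(\<lambda>n. schur_approx n a z - b 0) \<longlonglongrightarrow> 0"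
    by (intro Lim_null_comparison[OF _ lim] always_eventually allI)
  then show ?thesis by (simp add: LIM_zero_iff)
qed

subsection \<open>Carath\'{e}odory and Schur functions of a measure\<close>

context nontrivial_circle
begin

section \<open>Herglotz and Cauchy integrals of the orthogonal polynomials\<close>

definition herglotz_int :: "(complex \<Rightarrow> complex) \<Rightarrow> complex \<Rightarrow> complex" where
  "herglotz_int g z = (LINT \<zeta>|\<mu>. (\<zeta> + z) / (\<zeta> - z) * g \<zeta>)"

text \<open>Since \<open>\<zeta> / (\<zeta> - z)\<close> is a geometric series in
  \<open>cnj \<zeta> * z\<close>, the integral with index m is the Taylor tail from order m of the
  integral with index 0, divided by \<open>z^m\<close>.\<close>

definition cauchy_int :: "nat \<Rightarrow> (complex \<Rightarrow> complex) \<Rightarrow> complex \<Rightarrow> complex" where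
  "cauchy_int m g z = (LINT \<zeta>|\<mu>. cnj \<zeta> ^ m * g \<zeta> * (\<zeta> / (\<zeta> - z)))"

lemma circle_diff_nonzero: "cmod z < 1 \<Longrightarrow> \<zeta> \<in> sphere 0 1 \<Longrightarrow> \<zeta> - z \<noteq> 0"
  by auto

lemma caratheodory_herglotz_int: "caratheodory_fun \<mu> z = herglotz_int (\<lambda>_. 1) z"
  by (simp add: caratheodory_fun_def herglotz_int_def)

lemma herglotz_int_cauchy_int:
  assumes z: "cmod z < 1" and g: "continuous_on (sphere 0 1) g"
  shows "herglotz_int g z = 2 * cauchy_int 0 g z - (LINT \<zeta>|\<mu>. g \<zeta>)"
proof -
  have "herglotz_int g z = (LINT \<zeta>|\<mu>. 2 * (cnj \<zeta> ^ 0 * g \<zeta> * (\<zeta> / (\<zeta> - z))) - g \<zeta>)"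
    unfolding herglotz_int_def
  proof (rule Bochner_Integration.integral_cong[OF refl])
    fix \<zeta> assume "\<zeta> \<in> space \<mu>"
    then have "\<zeta> - z \<noteq> 0" using circle_diff_nonzero[OF z] by simp
    then show "(\<zeta> + z) / (\<zeta> - z) * g \<zeta> = 2 * (cnj \<zeta> ^ 0 * g \<zeta> * (\<zeta> / (\<zeta> - z))) - g \<zeta>"
      by (simp add: field_simps)
  qed
  also have "\<dots> = (LINT \<zeta>|\<mu>. 2 * (cnj \<zeta> ^ 0 * g \<zeta> * (\<zeta> / (\<zeta> - z)))) - (LINT \<zeta>|\<mu>. g \<zeta>)"
    using circle_diff_nonzero[OF z]
    by (intro Bochner_Integration.integral_diff integrable_cont continuous_intros g) auto
  finally show ?thesis unfolding cauchy_int_def by (simp only: integral_mult_right_zero)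
qed

lemma cauchy_int_Suc:
  assumes z: "cmod z < 1" and g: "continuous_on (sphere 0 1) g"
  shows "cauchy_int m g z = (LINT \<zeta>|\<mu>. cnj \<zeta> ^ m * g \<zeta>) + z * cauchy_int (Suc m) g z"
proof -
  have "cauchy_int m g z = (LINT \<zeta>|\<mu>. cnj \<zeta> ^ m * g \<zeta> + z * (cnj \<zeta> ^ Suc m * g \<zeta> * (\<zeta> / (\<zeta> - z))))"
    unfolding cauchy_int_def
  proof (rule Bochner_Integration.integral_cong[OF refl])
    fix \<zeta> assume \<zeta>: "\<zeta> \<in> space \<mu>"
    then have nz: "\<zeta> - z \<noteq> 0" using circle_diff_nonzero[OF z] by simp
    have "\<zeta> * cnj \<zeta> = 1" using \<zeta> by (simp add: circle_mult_cnj)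
    then have "z * (cnj \<zeta> ^ Suc m * g \<zeta> * (\<zeta> / (\<zeta> - z))) = cnj \<zeta> ^ m * g \<zeta> * (z / (\<zeta> - z))"
      by (simp add: mult_ac)
    moreover have "\<zeta> / (\<zeta> - z) = 1 + z / (\<zeta> - z)" using nz by (simp add: field_simps)
    ultimately show "cnj \<zeta> ^ m * g \<zeta> * (\<zeta> / (\<zeta> - z))
      = cnj \<zeta> ^ m * g \<zeta> + z * (cnj \<zeta> ^ Suc m * g \<zeta> * (\<zeta> / (\<zeta> - z)))"
      by (simp only: distrib_left mult_1_right)
  qed
  also have "\<dots> = (LINT \<zeta>|\<mu>. cnj \<zeta> ^ m * g \<zeta>)
      + (LINT \<zeta>|\<mu>. z * (cnj \<zeta> ^ Suc m * g \<zeta> * (\<zeta> / (\<zeta> - z))))"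
    using circle_diff_nonzero[OF z]
    by (intro Bochner_Integration.integral_add integrable_cont continuous_intros g) auto
  finally show ?thesis unfolding cauchy_int_def by (simp only: integral_mult_right_zero)
qed

text \<open>From \<open>\<zeta> = z + (\<zeta> - z)\<close>: the first summand reproduces the
  kernel, the second cancels its denominator.\<close>

lemma herglotz_int_times:
  assumes z: "cmod z < 1" and g: "continuous_on (sphere 0 1) g"
  shows "herglotz_int (\<lambda>\<zeta>. \<zeta> * g \<zeta>) z = z * herglotz_int g z + (LINT \<zeta>|\<mu>. \<zeta> * g \<zeta>) + z * (LINT \<zeta>|\<mu>. g \<zeta>)"
proof -
  have "herglotz_int (\<lambda>\<zeta>. \<zeta> * g \<zeta>) z = (LINT \<zeta>|\<mu>. z * ((\<zeta> + z) / (\<zeta> - z) * g \<zeta>) + \<zeta> * g \<zeta> + z * g \<zeta>)"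
    unfolding herglotz_int_def
  proof (rule Bochner_Integration.integral_cong[OF refl])
    fix \<zeta> assume "\<zeta> \<in> space \<mu>"
    then have "\<zeta> - z \<noteq> 0" using circle_diff_nonzero[OF z] by simp
    then show "(\<zeta> + z) / (\<zeta> - z) * (\<zeta> * g \<zeta>) = z * ((\<zeta> + z) / (\<zeta> - z) * g \<zeta>) + \<zeta> * g \<zeta> + z * g \<zeta>"
      by (simp add: field_simps)
  qed
  also have "\<dots> = (LINT \<zeta>|\<mu>. z * ((\<zeta> + z) / (\<zeta> - z) * g \<zeta>)) + (LINT \<zeta>|\<mu>. \<zeta> * g \<zeta>) + (LINT \<zeta>|\<mu>. z * g \<zeta>)"
    using circle_diff_nonzero[OF z]
    by (subst Bochner_Integration.integral_add Bochner_Integration.integral_add,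
        (intro integrable_cont continuous_intros g; force)+)+ simp
  finally show ?thesis unfolding herglotz_int_def by (simp only: integral_mult_right_zero)
qed

lemma herglotz_int_lincomb:
  assumes z: "cmod z < 1" and g: "continuous_on (sphere 0 1) g" and h: "continuous_on (sphere 0 1) h"
  shows "herglotz_int (\<lambda>\<zeta>. g \<zeta> - c * h \<zeta>) z = herglotz_int g z - c * herglotz_int h z"
proof -
  have "herglotz_int (\<lambda>\<zeta>. g \<zeta> - c * h \<zeta>) z
     = (LINT \<zeta>|\<mu>. (\<zeta> + z) / (\<zeta> - z) * g \<zeta> - c * ((\<zeta> + z) / (\<zeta> - z) * h \<zeta>))"
    unfolding herglotz_int_def by (intro Bochner_Integration.integral_cong) (auto simp: right_diff_distrib mult.left_commute)
  also have "\<dots> = (LINT \<zeta>|\<mu>. (\<zeta> + z) / (\<zeta> - z) * g \<zeta>) - (LINT \<zeta>|\<mu>. c * ((\<zeta> + z) / (\<zeta> - z) * h \<zeta>))"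
    using circle_diff_nonzero[OF z]
    by (intro Bochner_Integration.integral_diff integrable_cont continuous_intros g h) auto
  finally show ?thesis unfolding herglotz_int_def by (simp only: integral_mult_right_zero)
qed

text \<open>The pair \<open>(opuc_u, opuc_v)\<close> obeys the same recursion as $(\Phi_n, \Phi_n^*)$; dividing it
  out turns the Szeg\H{o} recursion into the Schur algorithm.\<close>

definition opuc_u :: "nat \<Rightarrow> complex \<Rightarrow> complex" where
  "opuc_u n z = herglotz_int (poly (\<Phi> n)) z + (if n = 0 then 1 else 0)"

definition opuc_v :: "nat \<Rightarrow> complex \<Rightarrow> complex" where
  "opuc_v n z = herglotz_int (poly (\<Phi>s n)) z - sqnorm (\<Phi> n)"

lemma moment_0: "moment 0 P = (LINT \<zeta>|\<mu>. poly P \<zeta>)"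
  by (simp add: moment_def)

lemma moment_0_monic_opuc: "moment 0 (\<Phi> n) = (if n = 0 then 1 else 0)"
  using moment_monic_opuc[of 0 n] prob_space by (simp add: moment_0)

text \<open>The corrections in \<open>opuc_u\<close> and \<open>opuc_v\<close> originate here. The
  mean of \<open>\<Phi> n\<close> is 1 for n = 0 and 0 otherwise, and the mean of
  \<open>\<zeta>\<close> times \<open>\<Phi> n\<close> is a coefficient times the squared norm;
  absorbing these terms makes both recursions homogeneous.\<close>

lemma herglotz_int_pCons:
  assumes z: "cmod z < 1"
  shows "herglotz_int (\<lambda>\<zeta>. \<zeta> * poly (\<Phi> n) \<zeta>) z
     = z * opuc_u n z + cnj (\<alpha> n) * sqnorm (\<Phi> n)"
  using herglotz_int_times[OF z, of "poly (\<Phi> n)"] verblunsky_moment[of n] moment_0_monic_opuc[of n]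
  by (auto simp: opuc_u_def moment_0 algebra_simps continuous_intros)

lemma opuc_u_Suc:
  assumes z: "cmod z < 1"
  shows "opuc_u (Suc n) z = z * opuc_u n z - cnj (\<alpha> n) * opuc_v n z"
proof -
  have "poly (\<Phi> (Suc n)) = (\<lambda>\<zeta>. \<zeta> * poly (\<Phi> n) \<zeta> - cnj (\<alpha> n) * poly (\<Phi>s n) \<zeta>)"
    by (simp add: poly_monic_opuc_Suc fun_eq_iff)
  then have "herglotz_int (poly (\<Phi> (Suc n))) z
     = herglotz_int (\<lambda>\<zeta>. \<zeta> * poly (\<Phi> n) \<zeta>) z - cnj (\<alpha> n) * herglotz_int (poly (\<Phi>s n)) z"
    by (simp add: herglotz_int_lincomb[OF z] continuous_intros)
  then show ?thesis
    by (simp add: opuc_u_def[of "Suc n"] opuc_v_def herglotz_int_pCons[OF z] algebra_simps)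
qed

lemma opuc_v_Suc:
  assumes z: "cmod z < 1"
  shows "opuc_v (Suc n) z = opuc_v n z - \<alpha> n * z * opuc_u n z"
proof -
  have "poly (\<Phi>s (Suc n)) = (\<lambda>\<zeta>. poly (\<Phi>s n) \<zeta> - \<alpha> n * (\<zeta> * poly (\<Phi> n) \<zeta>))"
    by (simp add: poly_reversed_opuc_Suc fun_eq_iff)
  then have "herglotz_int (poly (\<Phi>s (Suc n))) z
     = herglotz_int (poly (\<Phi>s n)) z - \<alpha> n * herglotz_int (\<lambda>\<zeta>. \<zeta> * poly (\<Phi> n) \<zeta>) z"
    by (simp add: herglotz_int_lincomb[OF z] continuous_intros)
  moreover have "complex_of_real ((cmod (\<alpha> n))\<^sup>2) = \<alpha> n * cnj (\<alpha> n)"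
    by (rule complex_norm_square)
  ultimately show ?thesis
    by (simp add: opuc_v_def sqnorm_opuc_Suc herglotz_int_pCons[OF z] algebra_simps)
qed

text \<open>By orthogonality of \<open>\<Phi>s n\<close> to the powers 1 to n of
  \<open>\<zeta>\<close>, the Taylor coefficients of these orders vanish in its Cauchy integral, and
  the subtracted norm removes order 0. Hence \<open>opuc_v n\<close> vanishes at the origin to order
  n+1.\<close>

lemma opuc_v_cauchy_int:
  assumes z: "cmod z < 1"
  shows "opuc_v n z = 2 * z ^ Suc n * cauchy_int (Suc n) (poly (\<Phi>s n)) z"
proof -
  have c: "continuous_on (sphere 0 1) (poly (\<Phi>s n))" by (intro continuous_intros)
  have "m \<le> n \<Longrightarrow> cauchy_int 1 (poly (\<Phi>s n)) z = z ^ m * cauchy_int (Suc m) (poly (\<Phi>s n)) z" for m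
  proof (induction m)
    case (Suc m)
    then show ?case
      using cauchy_int_Suc[OF z c, of "Suc m"] moment_reversed_opuc(2)[of "Suc m" n] by (simp add: moment_def)
  qed simp
  from this[of n] show ?thesis
    using cauchy_int_Suc[OF z c, of 0] moment_reversed_opuc(1)[of n]
    by (simp add: opuc_v_def herglotz_int_cauchy_int[OF z c] moment_def algebra_simps)
qed

text \<open>Only the order of vanishing at 0 matters later; the radius 1/2 merely keeps the kernel
  below 2.\<close>

lemma opuc_v_bound:
  obtains C where "\<And>z. cmod z \<le> 1 / 2 \<Longrightarrow> cmod (opuc_v n z) \<le> C * cmod z ^ Suc n"
proof -
  define C where "C = (LINT \<zeta>|\<mu>. 2 * cmod (poly (\<Phi>s n) \<zeta>))"
  have "cmod (opuc_v n z) \<le> (2 * C) * cmod z ^ Suc n" if z: "cmod z \<le> 1 / 2" for z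
  proof -
    have z1: "cmod z < 1" using z by simp
    have "cmod (cauchy_int (Suc n) (poly (\<Phi>s n)) z) \<le> C"
      unfolding cauchy_int_def C_def
    proof (rule Bochner_Integration.integral_norm_bound_integral)
      show "integrable \<mu> (\<lambda>\<zeta>. cnj \<zeta> ^ Suc n * poly (\<Phi>s n) \<zeta> * (\<zeta> / (\<zeta> - z)))"
        using circle_diff_nonzero[OF z1] by (intro integrable_cont continuous_intros) auto
      show "integrable \<mu> (\<lambda>\<zeta>. 2 * cmod (poly (\<Phi>s n) \<zeta>))"
        by (intro integrable_cont continuous_intros)
      fix \<zeta> assume "\<zeta> \<in> space \<mu>"
      then have 1: "cmod \<zeta> = 1" by simp
      then have "cmod (\<zeta> - z) \<ge> 1 / 2" using z norm_triangle_ineq2[of \<zeta> z] by linarith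
      then have "1 / cmod (\<zeta> - z) \<le> 2" by (subst divide_le_eq) auto
      then show "cmod (cnj \<zeta> ^ Suc n * poly (\<Phi>s n) \<zeta> * (\<zeta> / (\<zeta> - z))) \<le> 2 * cmod (poly (\<Phi>s n) \<zeta>)"
        using 1 mult_right_mono[of "1 / cmod (\<zeta> - z)" 2 "cmod (poly (\<Phi>s n) \<zeta>)"]
        by (simp add: norm_mult norm_divide norm_power)
    qed
    then have "2 * cmod z ^ Suc n * cmod (cauchy_int (Suc n) (poly (\<Phi>s n)) z) \<le> 2 * cmod z ^ Suc n * C"
      by (intro mult_left_mono) auto
    then show ?thesis by (simp add: opuc_v_cauchy_int[OF z1] norm_mult norm_power mult_ac)
  qed
  then show ?thesis using that by blast
qed

section \<open>The Caratheodory function and the Schur function attached to it\<close>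

lemma caratheodory_holomorphic: "caratheodory_fun \<mu> holomorphic_on ball 0 1"
proof -
  have "cauchy_int 0 (\<lambda>_. 1) holomorphic_on ball 0 1"
  proof (rule power_series_holomorphic)
    fix z :: complex assume "z \<in> ball 0 1"
    then have z: "cmod z < 1" by simp
    \<comment> \<open>Termwise integration of the geometric series for the kernel exhibits the
      moments of the measure as Taylor coefficients.\<close>
    have "(\<lambda>n. LINT \<zeta>|\<mu>. cnj \<zeta> ^ n * z ^ n) sums (LINT \<zeta>|\<mu>. (\<Sum>n. cnj \<zeta> ^ n * z ^ n))"
    proof (rule sums_integral)
      have "(LINT \<zeta>|\<mu>. cmod (cnj \<zeta> ^ n * z ^ n)) = (LINT \<zeta>|\<mu>. cmod z ^ n)" for n
        by (intro Bochner_Integration.integral_cong) (auto simp: norm_mult norm_power)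
      also have "\<dots> n = cmod z ^ n" for n using prob_space by simp
      finally show "summable (\<lambda>n. LINT \<zeta>|\<mu>. cmod (cnj \<zeta> ^ n * z ^ n))"
        using z by (simp add: summable_geometric)
      show "AE \<zeta> in \<mu>. summable (\<lambda>n. cmod (cnj \<zeta> ^ n * z ^ n))"
        using AE_space[of \<mu>] by eventually_elim (use z in \<open>auto simp: norm_mult norm_power summable_geometric\<close>)
    qed (intro integrable_cont continuous_intros)
    also have "(LINT \<zeta>|\<mu>. (\<Sum>n. cnj \<zeta> ^ n * z ^ n)) = cauchy_int 0 (\<lambda>_. 1) z"
      unfolding cauchy_int_def
    proof (rule Bochner_Integration.integral_cong[OF refl])
      fix \<zeta> assume \<zeta>: "\<zeta> \<in> space \<mu>"
      have "cmod (cnj \<zeta> * z) < 1" using \<zeta> z by (simp add: norm_mult)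
      then have "(\<Sum>n. (cnj \<zeta> * z) ^ n) = 1 / (1 - cnj \<zeta> * z)" by (rule suminf_geometric)
      moreover have "\<zeta> - z = \<zeta> * (1 - cnj \<zeta> * z)"
        using \<zeta> circle_mult_cnj[of \<zeta>] by (simp add: right_diff_distrib flip: mult.assoc)
      ultimately show "(\<Sum>n. cnj \<zeta> ^ n * z ^ n) = cnj \<zeta> ^ 0 * 1 * (\<zeta> / (\<zeta> - z))"
        using \<zeta> by (auto simp: power_mult_distrib)
    qed
    finally show "(\<lambda>n. (LINT \<zeta>|\<mu>. cnj \<zeta> ^ n) * (z - 0) ^ n) sums cauchy_int 0 (\<lambda>_. 1) z"
      by simp
  qed
  then have "(\<lambda>z. 2 * cauchy_int 0 (\<lambda>_. 1) z - 1) holomorphic_on ball 0 1"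
    by (intro holomorphic_intros)
  then show ?thesis
    by (rule holomorphic_transform) (use herglotz_int_cauchy_int[of _ "\<lambda>_. 1"] prob_space in \<open>auto simp: caratheodory_herglotz_int\<close>)
qed

lemma caratheodory_0: "caratheodory_fun \<mu> 0 = 1"
proof -
  have "caratheodory_fun \<mu> 0 = (LINT \<zeta>|\<mu>. 1)"
    unfolding caratheodory_fun_def by (rule Bochner_Integration.integral_cong) auto
  then show ?thesis using prob_space by simp
qed

lemma Re_caratheodory:
  assumes z: "cmod z < 1"
  shows "Re (caratheodory_fun \<mu> z) = (LINT \<zeta>|\<mu>. (1 - (cmod z)\<^sup>2) / (cmod (\<zeta> - z))\<^sup>2)"
proof -
  have "Re (caratheodory_fun \<mu> z) = (LINT \<zeta>|\<mu>. Re ((\<zeta> + z) / (\<zeta> - z)))"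
    unfolding caratheodory_fun_def using circle_diff_nonzero[OF z]
    by (intro integral_Re[symmetric] integrable_cont continuous_intros) auto
  also have "\<dots> = (LINT \<zeta>|\<mu>. (1 - (cmod z)\<^sup>2) / (cmod (\<zeta> - z))\<^sup>2)"
  proof (rule Bochner_Integration.integral_cong[OF refl])
    fix \<zeta> assume "\<zeta> \<in> space \<mu>"
    then have "(Re \<zeta>)\<^sup>2 + (Im \<zeta>)\<^sup>2 = 1" using cmod_power2[of \<zeta>] by simp
    then have "Re ((\<zeta> + z) * cnj (\<zeta> - z)) = 1 - (cmod z)\<^sup>2"
      unfolding cmod_power2 by (simp add: power2_eq_square algebra_simps)
    then show "Re ((\<zeta> + z) / (\<zeta> - z)) = (1 - (cmod z)\<^sup>2) / (cmod (\<zeta> - z))\<^sup>2"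
      by (metis Re_divide_of_real complex_div_cnj)
  qed
  finally show ?thesis .
qed

lemma Re_caratheodory_pos:
  assumes z: "cmod z < 1"
  shows "Re (caratheodory_fun \<mu> z) > 0"
proof -
  have pos: "(1 - (cmod z)\<^sup>2) / (cmod (\<zeta> - z))\<^sup>2 > 0" if "\<zeta> \<in> sphere 0 1" for \<zeta>
    using circle_diff_nonzero[OF z that] z by (intro divide_pos_pos) (auto simp: abs_square_less_1)
  have int: "integrable \<mu> (\<lambda>\<zeta>. (1 - (cmod z)\<^sup>2) / (cmod (\<zeta> - z))\<^sup>2)"
    using circle_diff_nonzero[OF z] by (intro integrable_cont continuous_intros) auto
  have "(LINT \<zeta>|\<mu>. (1 - (cmod z)\<^sup>2) / (cmod (\<zeta> - z))\<^sup>2) \<ge> 0"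
    using pos by (intro Bochner_Integration.integral_nonneg) (auto intro: less_imp_le)
  moreover have "(LINT \<zeta>|\<mu>. (1 - (cmod z)\<^sup>2) / (cmod (\<zeta> - z))\<^sup>2) \<noteq> 0"
  proof
    assume "(LINT \<zeta>|\<mu>. (1 - (cmod z)\<^sup>2) / (cmod (\<zeta> - z))\<^sup>2) = 0"
    then have "AE \<zeta> in \<mu>. (1 - (cmod z)\<^sup>2) / (cmod (\<zeta> - z))\<^sup>2 = 0"
      using int pos AE_space[of \<mu>] by (subst (asm) integral_nonneg_eq_0_iff_AE) (auto intro: less_imp_le elim!: eventually_mono)
    then have "AE \<zeta> in \<mu>. False"
      using AE_space[of \<mu>] by eventually_elim (use pos in fastforce)
    then show False by simp
  qed
  ultimately show ?thesis using Re_caratheodory[OF z] by simp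
qed

abbreviation "sf \<equiv> schur_fun \<mu>"

text \<open>The Cayley transform of F maps into the disk because Re F > 0 and vanishes at 0 because
  F(0) = 1, so Schwarz's lemma permits division by z. Extension by 0 meets the normalisation made in
  \<open>schur_fun\<close>.\<close>

lemma schur_fun_exists:
  "\<exists>f. schur_class f \<and> (\<forall>z\<in>ball 0 1. 1 - z * f z \<noteq> 0 \<and>
           caratheodory_fun \<mu> z = (1 + z * f z) / (1 - z * f z)) \<and>
        (\<forall>z. z \<notin> ball 0 1 \<longrightarrow> f z = 0)"
proof -
  let ?F = "caratheodory_fun \<mu>"
  define g where "g z = (?F z - 1) / (?F z + 1)" for z
  have nz: "?F z + 1 \<noteq> 0" if "cmod z < 1" for z
    using Re_caratheodory_pos[OF that] by (auto simp: complex_eq_iff)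
  have lt: "cmod (g z) < 1" if "cmod z < 1" for z
  proof -
    have "(cmod (?F z + 1))\<^sup>2 - (cmod (?F z - 1))\<^sup>2 = 4 * Re (?F z)"
      unfolding cmod_power2 by (simp add: power2_eq_square algebra_simps)
    then have "(cmod (?F z - 1))\<^sup>2 < (cmod (?F z + 1))\<^sup>2"
      using Re_caratheodory_pos[OF that] by linarith
    then have "cmod (?F z - 1) < cmod (?F z + 1)" by (rule power_less_imp_less_base) simp
    then show ?thesis using nz[OF that] by (simp add: g_def norm_divide)
  qed
  have "g holomorphic_on ball 0 1"
    unfolding g_def using nz by (intro holomorphic_intros caratheodory_holomorphic) auto
  moreover have "g 0 = 0" by (simp add: g_def caratheodory_0)
  ultimately obtain h where h: "schur_class h" "\<And>z. cmod z < 1 \<Longrightarrow> g z = z * h z"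
    using divide_by_z lt by blast
  define f where "f z = (if z \<in> ball 0 1 then h z else 0)" for z
  have f: "schur_class f"
    using h(1) holomorphic_transform[of h "ball 0 1" f] unfolding schur_class_def by (auto simp: f_def)
  have "1 - z * f z \<noteq> 0 \<and> ?F z = (1 + z * f z) / (1 - z * f z)" if "z \<in> ball 0 1" for z
  proof -
    have z: "cmod z < 1" using that by simp
    have gz: "z * f z = g z" using h(2)[OF z] z by (simp add: f_def)
    have 1: "1 - g z = 2 / (?F z + 1)" "1 + g z = 2 * ?F z / (?F z + 1)"
      using nz[OF z] by (simp_all add: g_def field_simps)
    show ?thesis unfolding gz 1 using nz[OF z] by simp
  qed
  then show ?thesis
    by (intro exI[of _ f]) (use f in \<open>auto simp: f_def\<close>)
qed

text \<open>The equation says nothing at the origin, where the function is multiplied by 0;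
  continuity fills in that value.\<close>

lemma schur_fun_unique:
  assumes f: "f holomorphic_on ball 0 1" and g: "g holomorphic_on ball 0 1"
    and eqf: "\<And>z. z \<in> ball 0 1 \<Longrightarrow> 1 - z * f z \<noteq> 0 \<and> F z = (1 + z * f z) / (1 - z * f z)"
    and eqg: "\<And>z. z \<in> ball 0 1 \<Longrightarrow> 1 - z * g z \<noteq> 0 \<and> F z = (1 + z * g z) / (1 - z * g z)"
    and z: "z \<in> ball 0 (1::real)"
  shows "f z = (g z :: complex)"
proof -
  have ne: "f w = g w" if "w \<in> ball 0 1" "w \<noteq> 0" for w
  proof -
    have "(1 + w * f w) / (1 - w * f w) = (1 + w * g w) / (1 - w * g w)"
      using eqf[OF that(1)] eqg[OF that(1)] by metis
    then have "(1 + w * f w) * (1 - w * g w) = (1 + w * g w) * (1 - w * f w)"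
      using eqf[OF that(1)] eqg[OF that(1)] by (subst (asm) frac_eq_eq) auto
    then have "w * (f w - g w) = 0" by (simp add: algebra_simps)
    then show ?thesis using that by simp
  qed
  have lim: "((\<lambda>w. f w - g w) \<longlongrightarrow> f 0 - g 0) (at 0)"
    using f g by (intro tendsto_diff continuous_on_interior[THEN isContD] holomorphic_on_imp_continuous_on) auto
  have "eventually (\<lambda>w. f w - g w = 0) (at 0)"
    using ne by (auto simp: eventually_at intro!: exI[of _ 1])
  then have "((\<lambda>w. f w - g w) \<longlongrightarrow> 0) (at 0)" by (rule tendsto_eventually)
  then have "f 0 - g 0 = 0" using lim LIM_unique by blast
  then show ?thesis using ne z by (cases "z = 0") auto
qed

lemma schur_fun_props:
  shows schur_class_sf: "schur_class sf"
    and sf_nonzero: "cmod z < 1 \<Longrightarrow> 1 - z * sf z \<noteq> 0"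
    and caratheodory_sf: "cmod z < 1 \<Longrightarrow> caratheodory_fun \<mu> z = (1 + z * sf z) / (1 - z * sf z)"
proof -
  let ?P = "\<lambda>f. f holomorphic_on ball 0 1 \<and> (\<forall>z\<in>ball 0 1. 1 - z * f z \<noteq> 0 \<and>
           caratheodory_fun \<mu> z = (1 + z * f z) / (1 - z * f z)) \<and>
        (\<forall>z. z \<notin> ball 0 1 \<longrightarrow> f z = 0)"
  obtain f where f: "schur_class f" "?P f" using schur_fun_exists unfolding schur_class_def by blast
  have "sf = f"
    unfolding schur_fun_def
  proof (rule the_equality[where P = ?P])
    show "?P f" by (rule f(2))
    fix g assume g: "?P g"
    show "g = f"
    proof
      fix z show "g z = f z"
        using g f(2) schur_fun_unique[of g f "caratheodory_fun \<mu>" z] by (cases "z \<in> ball 0 1") auto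
    qed
  qed
  then show "schur_class sf" "cmod z < 1 \<Longrightarrow> 1 - z * sf z \<noteq> 0"
    "cmod z < 1 \<Longrightarrow> caratheodory_fun \<mu> z = (1 + z * sf z) / (1 - z * sf z)"
    using f by auto
qed

end

section \<open>Geronimus' theorem: the Schur parameters are the Verblunsky coefficients\<close>

context nontrivial_circle
begin

text \<open>\<open>opuc_u n\<close> vanishes at $0$ to order exactly $n$, but \<open>opuc_v (Suc n)\<close> to order $n+2$; this
  forces the next Schur parameter.\<close>

lemma schur_first_parameter:
  assumes f: "schur_class f" and u: "continuous_on (ball 0 1) u" "u 0 \<noteq> 0"
    and U: "\<And>z. z \<in> ball 0 1 \<Longrightarrow> opuc_u n z = z ^ n * u z"
    and V: "\<And>z. z \<in> ball 0 1 \<Longrightarrow> opuc_v n z = z * f z * opuc_u n z"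
  shows "f 0 = \<alpha> n"
proof -
  obtain C where C: "\<And>z. cmod z \<le> 1 / 2 \<Longrightarrow> cmod (opuc_v (Suc n) z) \<le> C * cmod z ^ Suc (Suc n)"
    using opuc_v_bound by blast
  have bd: "cmod (u z * (f z - \<alpha> n)) \<le> C * cmod z" if z: "cmod z \<le> 1 / 2" "z \<noteq> 0" for z
  proof -
    have z1: "cmod z < 1" "z \<in> ball 0 1" using z by simp_all
    have "opuc_v (Suc n) z = z ^ Suc n * (u z * (f z - \<alpha> n))"
      using opuc_v_Suc[OF z1(1), of n] V[OF z1(2)] U[OF z1(2)] by (simp add: algebra_simps)
    then have "cmod z ^ Suc n * cmod (u z * (f z - \<alpha> n)) \<le> cmod z ^ Suc n * (C * cmod z)"
      using C[OF z(1)] by (simp add: norm_mult norm_power mult_ac)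
    then show ?thesis using z(2) by (simp del: power_Suc)
  qed
  have cf: "continuous_on (ball 0 1) f"
    using f by (simp add: schur_class_def holomorphic_on_imp_continuous_on)
  have "isCont (\<lambda>z. u z * (f z - \<alpha> n)) 0"
    by (rule continuous_on_interior[of "ball 0 1"]) (auto intro!: continuous_on_mult continuous_on_diff cf u(1))
  then have "((\<lambda>z. u z * (f z - \<alpha> n)) \<longlongrightarrow> u 0 * (f 0 - \<alpha> n)) (at 0)"
    by (rule isContD)
  moreover have "((\<lambda>z. u z * (f z - \<alpha> n)) \<longlongrightarrow> 0) (at 0)"
  proof (rule Lim_null_comparison)
    show "eventually (\<lambda>z. norm (u z * (f z - \<alpha> n)) \<le> C * cmod z) (at 0)"
      using bd by (auto simp: eventually_at intro!: exI[of _ "1/2"])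
    show "((\<lambda>z. C * cmod z) \<longlongrightarrow> 0) (at (0::complex))"
      by (auto intro!: tendsto_eq_intros)
  qed
  ultimately have "u 0 * (f 0 - \<alpha> n) = 0" using LIM_unique by blast
  then show ?thesis using u(2) by simp
qed

lemma opuc_uv_0:
  assumes "cmod z < 1"
  shows "opuc_u 0 z = caratheodory_fun \<mu> z + 1" "opuc_v 0 z = z * sf z * opuc_u 0 z"
proof -
  have eq: "poly (1 :: complex poly) = (\<lambda>_. 1)" by (simp add: fun_eq_iff)
  have rev1: "reversed_poly 1 = 1" by (simp add: reversed_poly_def)
  show u: "opuc_u 0 z = caratheodory_fun \<mu> z + 1"
    by (simp add: opuc_u_def caratheodory_herglotz_int eq)
  have "opuc_v 0 z = caratheodory_fun \<mu> z - 1"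
    using sqnorm_opuc[of 0] by (simp add: opuc_v_def caratheodory_herglotz_int eq rev1)
  then show "opuc_v 0 z = z * sf z * opuc_u 0 z"
    unfolding u caratheodory_sf[OF assms] using sf_nonzero[OF assms] by (simp add: field_simps)
qed

text \<open>The iterates are built by dependent choice together with the invariant \<open>P\<close>:
  \<open>opuc_u n\<close> is \<open>z^n\<close> times a function nonzero at 0, and
  \<open>opuc_v n\<close> is \<open>z * f z\<close> times \<open>opuc_u n\<close>. The latter is
  kept as a product because \<open>opuc_u n\<close> vanishes at 0 for n > 0. \<open>Q\<close> links
  consecutive iterates.\<close>

lemma geronimus:
  obtains fs where "fs 0 = sf" "\<And>n. schur_class (fs n)" "\<And>n. fs n 0 = \<alpha> n"
    "\<And>n z. cmod z < 1 \<Longrightarrow> fs n z - \<alpha> n = z * fs (Suc n) z * (1 - cnj (\<alpha> n) * fs n z)"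
proof -
  define P where "P n f \<longleftrightarrow> (n = 0 \<longrightarrow> f = sf) \<and> schur_class f \<and>
      (\<exists>u. continuous_on (ball 0 1) u \<and> u 0 \<noteq> 0 \<and>
        (\<forall>z\<in>ball 0 1. opuc_u n z = z ^ n * u z \<and> opuc_v n z = z * f z * opuc_u n z))" for n f
  define Q where "Q n f g \<longleftrightarrow> f 0 = \<alpha> n \<and>
      (\<forall>z\<in>ball 0 1. f z - \<alpha> n = z * g z * (1 - cnj (\<alpha> n) * f z))" for n f and g :: "complex \<Rightarrow> complex"
  have "\<exists>fs. \<forall>n. P n (fs n) \<and> Q n (fs n) (fs (Suc n))"
  proof (rule dependent_nat_choice)
    have "P 0 sf"
      unfolding P_def
    proof (intro conjI impI refl schur_class_sf exI[of _ "\<lambda>z. caratheodory_fun \<mu> z + 1"] ballI)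
      show "continuous_on (ball 0 1) (\<lambda>z. caratheodory_fun \<mu> z + 1)"
        by (intro continuous_intros holomorphic_on_imp_continuous_on caratheodory_holomorphic)
    qed (use opuc_uv_0 caratheodory_0 in auto)
    then show "\<exists>f. P 0 f" by blast
  next
    fix f n assume "P n f"
    then obtain u where f: "schur_class f" and u: "continuous_on (ball 0 1) u" "u 0 \<noteq> 0"
      and U: "\<And>z. z \<in> ball 0 1 \<Longrightarrow> opuc_u n z = z ^ n * u z"
      and V: "\<And>z. z \<in> ball 0 1 \<Longrightarrow> opuc_v n z = z * f z * opuc_u n z"
      unfolding P_def by blast
    have f0: "f 0 = \<alpha> n" by (rule schur_first_parameter[OF f u U V])
    have lt: "cmod (f z) < 1" if "cmod z < 1" for z
      using schur_class_strict[OF f _ that] f0 cmod_verblunsky[of n] by simp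
    define g where "g z = (f z - \<alpha> n) / (1 - cnj (\<alpha> n) * f z)" for z
    have nz: "1 - cnj (\<alpha> n) * f z \<noteq> 0" if "cmod z < 1" for z
      by (intro one_minus_nonzero norm_cnj_mult_less cmod_verblunsky less_imp_le[OF lt[OF that]])
    have "g holomorphic_on ball 0 1"
      unfolding g_def using f nz unfolding schur_class_def by (intro holomorphic_intros) auto
    moreover have "g 0 = 0" using f0 by (simp add: g_def)
    moreover have "cmod (g z) < 1" if "cmod z < 1" for z
      unfolding g_def by (rule mobius_less[OF cmod_verblunsky lt[OF that]])
    ultimately obtain h where h: "schur_class h" "\<And>z. cmod z < 1 \<Longrightarrow> g z = z * h z"
      using divide_by_z by blast
    have rel: "f z - \<alpha> n = z * h z * (1 - cnj (\<alpha> n) * f z)" if "cmod z < 1" for z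
      using h(2)[OF that] nz[OF that] by (simp add: g_def field_simps)
    have cu: "continuous_on (ball 0 1) (\<lambda>z. u z * (1 - cnj (\<alpha> n) * f z))"
      using f unfolding schur_class_def
      by (intro continuous_intros u(1) holomorphic_on_imp_continuous_on[of f]) auto
    \<comment> \<open>The factor for the next index is \<open>u\<close> times the denominator of the
      Schur step; at the origin that denominator is 1 minus the squared modulus of
      \<open>\<alpha> n\<close>, hence nonzero.\<close>
    have "P (Suc n) h"
      unfolding P_def
    proof (intro conjI h(1) exI[of _ "\<lambda>z. u z * (1 - cnj (\<alpha> n) * f z)"] cu ballI)
      fix z :: complex assume zb: "z \<in> ball 0 1"
      then have z: "cmod z < 1" by simp
      show U': "opuc_u (Suc n) z = z ^ Suc n * (u z * (1 - cnj (\<alpha> n) * f z))"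
        using opuc_u_Suc[OF z, of n] V[OF zb] U[OF zb] by (simp add: algebra_simps)
      have "opuc_v (Suc n) z = z ^ Suc n * u z * (f z - \<alpha> n)"
        using opuc_v_Suc[OF z, of n] V[OF zb] U[OF zb] by (simp add: algebra_simps)
      then show "opuc_v (Suc n) z = z * h z * opuc_u (Suc n) z"
        unfolding U' rel[OF z] by (simp add: mult_ac)
    qed (use u nz[of 0] in auto)
    moreover have "Q n f h" using f0 rel by (simp add: Q_def)
    ultimately show "\<exists>g. P (Suc n) g \<and> Q n f g" by blast
  qed
  then obtain fs where fs: "\<And>n. P n (fs n)" "\<And>n. Q n (fs n) (fs (Suc n))" by blast
  show ?thesis
    by (rule that[of fs]) (use fs in \<open>auto simp: P_def Q_def\<close>)
qed

text \<open>The step is recorded in two forms: as a product, which survives passage to boundary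
  values, and as a quotient, which is the shape expected by
  \<open>schur_approx_tendsto\<close>.\<close>

lemma schur_iterates:
  obtains fs where "fs 0 = sf" "\<And>n. schur_class (fs n)" "\<And>n z. cmod z < 1 \<Longrightarrow> cmod (fs n z) < 1"
    "\<And>n z. cmod z < 1 \<Longrightarrow> fs n z - \<alpha> n = z * fs (Suc n) z * (1 - cnj (\<alpha> n) * fs n z)"
    "\<And>n z. cmod z < 1 \<Longrightarrow> fs n z = (\<alpha> n + z * fs (Suc n) z) / (1 + cnj (\<alpha> n) * (z * fs (Suc n) z))"
proof -
  obtain fs where fs: "fs 0 = sf" "\<And>n. schur_class (fs n)" "\<And>n. fs n 0 = \<alpha> n"
    "\<And>n z. cmod z < 1 \<Longrightarrow> fs n z - \<alpha> n = z * fs (Suc n) z * (1 - cnj (\<alpha> n) * fs n z)"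
    using geronimus by metis
  have lt: "cmod (fs n z) < 1" if "cmod z < 1" for n z
    using schur_class_strict[OF fs(2) _ that] fs(3) cmod_verblunsky by simp
  have "fs n z = (\<alpha> n + z * fs (Suc n) z) / (1 + cnj (\<alpha> n) * (z * fs (Suc n) z))" if z: "cmod z < 1" for n z
  proof -
    have "1 + cnj (\<alpha> n) * (z * fs (Suc n) z) \<noteq> 0"
      by (intro one_plus_nonzero norm_cnj_mult_less cmod_verblunsky less_imp_le norm_mult_less_1 z lt)
    moreover have "fs n z * (1 + cnj (\<alpha> n) * (z * fs (Suc n) z)) = \<alpha> n + z * fs (Suc n) z"
      using fs(4)[OF z, of n] by (simp add: algebra_simps)
    ultimately show ?thesis by (simp add: eq_divide_eq)
  qed
  then show ?thesis using that fs lt by blast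
qed

lemma sf_less: "cmod z < 1 \<Longrightarrow> cmod (sf z) < 1"
  using schur_iterates by metis

lemma schur_approx_tendsto_sf:
  assumes z: "cmod z < 1"
  shows "(\<lambda>n. schur_approx n \<alpha> z) \<longlonglongrightarrow> sf z"
proof -
  obtain fs where fs: "fs 0 = sf" "\<And>n. schur_class (fs n)" "\<And>n z. cmod z < 1 \<Longrightarrow> cmod (fs n z) < 1"
    "\<And>n z. cmod z < 1 \<Longrightarrow> fs n z = (\<alpha> n + z * fs (Suc n) z) / (1 + cnj (\<alpha> n) * (z * fs (Suc n) z))"
    using schur_iterates by metis
  show ?thesis
    using schur_approx_tendsto[where b = "\<lambda>n. fs n z", OF z cmod_verblunsky fs(3)[OF z] fs(4)[OF z]]
      fs(1) by simp
qed

end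

section \<open>A measure and its once-stripped companion\<close>

locale stripped_pair = nontrivial_circle \<mu> + one: nontrivial_circle \<mu>1
  for \<mu> \<mu>1 :: "complex measure" +
  assumes shift: "\<And>j. verblunsky \<mu>1 j = verblunsky \<mu> (Suc j)"
begin

text \<open>The first iterate of the Schur function of \<open>\<mu>\<close> and the Schur function
  of \<open>\<mu>1\<close> are limits of the same approximants, those of the shifted
  coefficients.\<close>

lemma sf_step:
  assumes z: "cmod z < 1"
  shows "sf z - \<alpha> 0 = z * one.sf z * (1 - cnj (\<alpha> 0) * sf z)"
proof -
  obtain fs where fs: "fs 0 = sf" "\<And>n. schur_class (fs n)" "\<And>n z. cmod z < 1 \<Longrightarrow> cmod (fs n z) < 1"
    "\<And>n z. cmod z < 1 \<Longrightarrow> fs n z - \<alpha> n = z * fs (Suc n) z * (1 - cnj (\<alpha> n) * fs n z)"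
    "\<And>n z. cmod z < 1 \<Longrightarrow> fs n z = (\<alpha> n + z * fs (Suc n) z) / (1 + cnj (\<alpha> n) * (z * fs (Suc n) z))"
    using schur_iterates by metis
  have "(\<lambda>n. schur_approx n (\<lambda>j. \<alpha> (Suc j)) z) \<longlonglongrightarrow> fs (Suc 0) z"
    by (rule schur_approx_tendsto[where b = "\<lambda>n. fs (Suc n) z", OF z cmod_verblunsky fs(3)[OF z] fs(5)[OF z]])
  moreover have "one.\<alpha> = (\<lambda>j. \<alpha> (Suc j))" using shift by (simp add: fun_eq_iff)
  then have "(\<lambda>n. schur_approx n (\<lambda>j. \<alpha> (Suc j)) z) \<longlonglongrightarrow> one.sf z"
    using one.schur_approx_tendsto_sf[OF z] by simp
  ultimately have "fs (Suc 0) z = one.sf z" by (rule LIMSEQ_unique)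
  then show ?thesis using fs(4)[OF z, of 0] fs(1) by simp
qed

end

text \<open>The Szego transfer matrices applied to the vector (u, v). The recursion consumes the
  first coefficient, as \<open>schur_approx\<close> does, whereas the orthogonal polynomials grow by
  the last one; \<open>szego_transfer_last\<close> reconciles the two orders.\<close>

fun szego_transfer :: "nat \<Rightarrow> (nat \<Rightarrow> complex) \<Rightarrow> complex \<Rightarrow> complex \<Rightarrow> complex \<Rightarrow> complex \<times> complex" where
  "szego_transfer 0 a z u v = (u, v)"
| "szego_transfer (Suc n) a z u v =
     szego_transfer n (\<lambda>j. a (Suc j)) z (z * u - cnj (a 0) * v) (v - a 0 * z * u)"

lemma szego_transfer_last:
  "szego_transfer (Suc n) a z u v =
     (let (u', v') = szego_transfer n a z u v in (z * u' - cnj (a n) * v', v' - a n * z * u'))"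
proof (induction n arbitrary: a u v)
  case (Suc n)
  show ?case
    by (subst szego_transfer.simps(2), subst Suc.IH) simp
qed simp

text \<open>The product of the denominators met in the Schur steps. Stripping the first coefficient
  removes a single factor, so all others cancel in the ratio for the two measures.\<close>

fun szego_denom :: "nat \<Rightarrow> (nat \<Rightarrow> complex) \<Rightarrow> complex \<Rightarrow> complex" where
  "szego_denom 0 a z = 1"
| "szego_denom (Suc n) a z = szego_denom n (\<lambda>j. a (Suc j)) z *
     (1 + cnj (a 0) * (z * schur_approx n (\<lambda>j. a (Suc j)) z))"

lemma schur_approx_denom_nonzero:
  assumes "\<And>j. cmod (a j) < 1" "cmod z < 1"
  shows "1 + cnj (a 0) * (z * schur_approx n (\<lambda>j. a (Suc j)) z) \<noteq> 0"
  using assms schur_approx_less[of "\<lambda>j. a (Suc j)" z n]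
  by (intro one_plus_nonzero norm_cnj_mult_less less_imp_le[OF norm_mult_less_1] less_imp_le) auto

text \<open>The second component is linear in (u, v) and vanishes in the direction v = z s u, where
  s is the Schur approximant. The vector stays general because each step changes it; the polynomials
  correspond to u = v = 1.\<close>

lemma szego_transfer_snd:
  assumes "\<And>j. cmod (a j) < 1" and z: "cmod z < 1"
  shows "snd (szego_transfer n a z u v) = szego_denom n a z * (v - z * schur_approx n a z * u)"
  using assms(1)
proof (induction n arbitrary: a u v)
  case (Suc n)
  define s where "s = schur_approx n (\<lambda>j. a (Suc j)) z"
  have nz: "1 + cnj (a 0) * (z * s) \<noteq> 0"
    unfolding s_def by (rule schur_approx_denom_nonzero[where a = a, OF Suc.prems z])
  have "snd (szego_transfer (Suc n) a z u v)
     = szego_denom n (\<lambda>j. a (Suc j)) z * ((v - a 0 * z * u) - z * s * (z * u - cnj (a 0) * v))"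
    using Suc.prems by (simp add: Suc.IH s_def)
  also have "(v - a 0 * z * u) - z * s * (z * u - cnj (a 0) * v)
     = (1 + cnj (a 0) * (z * s)) * (v - z * ((a 0 + z * s) / (1 + cnj (a 0) * (z * s))) * u)"
    using nz by (simp add: field_simps)
  finally show ?case by (simp add: s_def mult.assoc)
qed simp

lemma szego_denom_nonzero:
  assumes "\<And>j. cmod (a j) < 1" and z: "cmod z < 1"
  shows "szego_denom n a z \<noteq> 0"
  using assms(1)
proof (induction n arbitrary: a)
  case (Suc n)
  then show ?case using schur_approx_denom_nonzero[where a = a, OF Suc.prems z] by simp
qed simp

context nontrivial_circle
begin

lemma opuc_transfer: "(poly (\<Phi> n) z, poly (\<Phi>s n) z) = szego_transfer n \<alpha> z 1 1"
proof (induction n)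
  case 0
  show ?case by (simp add: reversed_poly_def)
next
  case (Suc n)
  show ?case
    unfolding szego_transfer_last Suc[symmetric] by (simp add: poly_monic_opuc_Suc poly_reversed_opuc_Suc)
qed

lemma reversed_opuc_eq:
  assumes "cmod z < 1"
  shows "poly (\<Phi>s n) z = szego_denom n \<alpha> z * (1 - z * schur_approx n \<alpha> z)"
  using szego_transfer_snd[where a = \<alpha> and u = 1 and v = 1, OF cmod_verblunsky assms] opuc_transfer[of n z]
  by (metis mult_1_right snd_conv)

lemma reversed_poly_smult_real:
  "reversed_poly (smult (complex_of_real c) P) = smult (complex_of_real c) (reversed_poly P)"
proof (cases "c = 0")
  case False
  have "map_poly cnj (smult (complex_of_real c) P) = smult (complex_of_real c) (map_poly cnj P)"
    by (rule poly_eqI) (simp add: coeff_map_poly)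
  then show ?thesis by (simp add: reversed_poly_def reflect_poly_smult)
qed (simp add: reversed_poly_def)

lemma reversed_orthonormal:
  "poly (reversed_poly (orthonormal_opuc \<mu> n)) z
     = complex_of_real (1 / sqrt (sqnorm (\<Phi> n))) * poly (\<Phi>s n) z"
  unfolding orthonormal_opuc_def sqnorm_def[symmetric] reversed_poly_smult_real by simp

definition "\<rho> = sqrt (1 - (cmod (\<alpha> 0))\<^sup>2)"

lemma rho_pos: "\<rho> > 0"
  using cmod_verblunsky[of 0] by (simp add: \<rho>_def abs_square_less_1)

lemma rho_sq: "complex_of_real \<rho> * complex_of_real \<rho> = 1 - \<alpha> 0 * cnj (\<alpha> 0)"
proof -
  have "\<rho> * \<rho> = 1 - (cmod (\<alpha> 0))\<^sup>2"
    using cmod_verblunsky[of 0] by (simp add: \<rho>_def abs_square_le_1)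
  then show ?thesis
    by (metis complex_norm_square of_real_1 of_real_diff of_real_mult)
qed

end

section \<open>The function \<open>relative_szego\<close> as a limit of ratios of reversed
  polynomials\<close>

context stripped_pair
begin

abbreviation "\<delta> \<equiv> relative_szego \<mu> \<mu>1"

lemma relative_szego_eq:
  "\<delta> z = (1 - cnj (\<alpha> 0) * sf z) / \<rho> * ((1 - z * one.sf z) / (1 - z * sf z))"
  by (simp add: relative_szego_def Let_def \<rho>_def)

lemma factors_nonzero:
  assumes "cmod z < 1"
  shows "1 - cnj (\<alpha> 0) * sf z \<noteq> 0" "1 - z * sf z \<noteq> 0" "1 - z * one.sf z \<noteq> 0"
  by (intro one_minus_nonzero norm_cnj_mult_less cmod_verblunsky norm_mult_less_1 less_imp_le
      assms sf_less one.sf_less)+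

lemma sf_holomorphic: "sf holomorphic_on ball 0 1" "one.sf holomorphic_on ball 0 1"
  using schur_class_sf one.schur_class_sf by (auto simp: schur_class_def)

lemma relative_szego_holomorphic: "\<delta> holomorphic_on ball 0 1"
  unfolding relative_szego_eq[abs_def] using factors_nonzero rho_pos
  by (intro holomorphic_intros sf_holomorphic) auto

lemma relative_szego_nonzero: "cmod z < 1 \<Longrightarrow> \<delta> z \<noteq> 0"
  using factors_nonzero[of z] rho_pos by (simp add: relative_szego_eq)

text \<open>Degree n for \<open>\<mu>1\<close> against degree n+1 for \<open>\<mu>\<close> makes
  both sides use the same coefficients after stripping: \<open>q\<close> cancels, and the norms
  differ by the factor \<open>\<rho>\<close>.\<close>

lemma ratio_eq:
  fixes z s t :: complex and n :: nat
  assumes z: "cmod z < 1"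
  defines "s \<equiv> schur_approx n one.\<alpha> z" and "t \<equiv> schur_approx (Suc n) \<alpha> z"
  shows "poly (reversed_poly (orthonormal_opuc \<mu>1 n)) z / poly (reversed_poly (orthonormal_opuc \<mu> (Suc n))) z
     = \<rho> * (1 - z * s) / ((1 + cnj (\<alpha> 0) * (z * s)) * (1 - z * t))"
proof -
  have al: "one.\<alpha> = (\<lambda>j. \<alpha> (Suc j))" using shift by (simp add: fun_eq_iff)
  define N where "N = one.sqnorm (one.\<Phi> n)"
  have N: "N > 0" unfolding N_def by (rule one.is_monic_orth_sqnorm_pos[OF one.is_monic_orth_monic_opuc])
  have "sqnorm (\<Phi> (Suc n)) = \<rho>\<^sup>2 * N"
    unfolding N_def sqnorm_opuc one.sqnorm_opuc prod.lessThan_Suc_shift al \<rho>_def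
    using cmod_verblunsky[of 0] by (simp add: abs_square_le_1)
  then have 1: "sqrt (sqnorm (\<Phi> (Suc n))) = \<rho> * sqrt N"
    using rho_pos by (simp add: real_sqrt_mult)
  define q where "q = szego_denom n one.\<alpha> z"
  have q: "q \<noteq> 0" unfolding q_def by (rule szego_denom_nonzero[OF one.cmod_verblunsky z])
  have 2: "poly (one.\<Phi>s n) z = q * (1 - z * s)"
    unfolding q_def s_def by (rule one.reversed_opuc_eq[OF z])
  have 3: "poly (\<Phi>s (Suc n)) z = q * (1 + cnj (\<alpha> 0) * (z * s)) * (1 - z * t)"
    using reversed_opuc_eq[OF z, of "Suc n"]
    by (simp only: szego_denom.simps q_def s_def t_def al)
  show ?thesis
    unfolding reversed_orthonormal one.reversed_orthonormal 1 2 3 N_def[symmetric]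
    using N q rho_pos by simp
qed

lemma ratio_tendsto:
  assumes z: "cmod z < 1"
  shows "(\<lambda>n. poly (reversed_poly (orthonormal_opuc \<mu>1 (n - 1))) z /
             poly (reversed_poly (orthonormal_opuc \<mu> n)) z) \<longlonglongrightarrow> \<delta> z"
proof -
  have nz1: "1 + cnj (\<alpha> 0) * (z * one.sf z) \<noteq> 0"
    by (intro one_plus_nonzero norm_cnj_mult_less cmod_verblunsky less_imp_le norm_mult_less_1 z one.sf_less)
  \<comment> \<open>The Schur step trades the denominator left over in the limit for the factor
    \<open>1 - cnj (\<alpha> 0) * sf z\<close> of \<open>\<delta>\<close>, at the price of the
    square of \<open>\<rho>\<close>.\<close>
  have "(1 + cnj (\<alpha> 0) * (z * one.sf z)) * (1 - cnj (\<alpha> 0) * sf z)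
       = (1 - cnj (\<alpha> 0) * sf z) + cnj (\<alpha> 0) * (sf z - \<alpha> 0)"
    unfolding sf_step[OF z] by (simp add: algebra_simps)
  also have "\<dots> = \<rho> * \<rho>" using rho_sq by (simp add: algebra_simps)
  finally have rel: "(1 + cnj (\<alpha> 0) * (z * one.sf z)) * (1 - cnj (\<alpha> 0) * sf z) = \<rho> * \<rho>" .
  have "(\<lambda>n. schur_approx (Suc n) \<alpha> z) \<longlonglongrightarrow> sf z"
    using schur_approx_tendsto_sf[OF z] by (rule LIMSEQ_Suc)
  then have "(\<lambda>n. poly (reversed_poly (orthonormal_opuc \<mu>1 n)) z /
             poly (reversed_poly (orthonormal_opuc \<mu> (Suc n))) z)
     \<longlonglongrightarrow> \<rho> * (1 - z * one.sf z) / ((1 + cnj (\<alpha> 0) * (z * one.sf z)) * (1 - z * sf z))"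
    unfolding ratio_eq[OF z] using nz1 factors_nonzero[OF z]
    by (intro tendsto_intros one.schur_approx_tendsto_sf[OF z]) auto
  also have "\<rho> * (1 - z * one.sf z) / ((1 + cnj (\<alpha> 0) * (z * one.sf z)) * (1 - z * sf z)) = \<delta> z"
  proof -
    have "1 - cnj (\<alpha> 0) * sf z = \<rho> * \<rho> / (1 + cnj (\<alpha> 0) * (z * one.sf z))"
      using nz1 rel by (simp add: eq_divide_eq mult.commute)
    then show ?thesis
      using rho_pos by (simp add: relative_szego_eq)
  qed
  \<comment> \<open>The index shift disposes of n = 0, where \<open>n - 1\<close> is truncated to
    0.\<close>
  finally show ?thesis
    by (subst filterlim_sequentially_Suc[symmetric]) simp
qed

end

subsection \<open>The maximal function on the circle\<close>

lemma prob_space_dtheta: "prob_space dtheta"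
  unfolding dtheta_def by (rule prob_space_uniform_measure) auto

interpretation dtheta: prob_space dtheta
  by (rule prob_space_dtheta)

lemma sets_dtheta [simp, measurable_cong]: "sets dtheta = sets borel"
  by (simp add: dtheta_def)

lemma space_dtheta [simp]: "space dtheta = UNIV"
  by (simp add: dtheta_def)

lemma measurable_cis [measurable]: "cis \<in> borel_measurable borel"
  by (intro borel_measurable_continuous_onI continuous_intros)

lemma emeasure_dtheta:
  "A \<in> sets borel \<Longrightarrow> emeasure dtheta A = emeasure lborel ({0..<2*pi} \<inter> A) / ennreal (2*pi)"
  by (simp add: dtheta_def)

lemma AE_dtheta_range: "AE \<theta> in dtheta. \<theta> \<in> {0..<2*pi}"
  unfolding dtheta_def by (rule AE_uniform_measureI) auto

text \<open>Normalised arc length on the Borel sets of the plane rather than of the circle, so that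
  balls and open sets need not be cut down to the circle.\<close>

definition arc_measure :: "complex measure" where
  "arc_measure = distr dtheta borel cis"

lemma sets_arc_measure [simp, measurable_cong]: "sets arc_measure = sets borel"
  and space_arc_measure [simp]: "space arc_measure = UNIV"
  by (simp_all add: arc_measure_def)

interpretation arc: prob_space arc_measure
  unfolding arc_measure_def by (rule dtheta.prob_space_distr) simp

lemma AE_arc_sphere: "AE \<zeta> in arc_measure. cmod \<zeta> = 1"
  unfolding arc_measure_def by (subst AE_distr_iff) auto

lemma AE_arcD: "AE \<zeta> in arc_measure. P \<zeta> \<Longrightarrow> AE \<theta> in dtheta. P (cis \<theta>)"
  unfolding arc_measure_def by (rule AE_distrD) auto

text \<open>The cubic Taylor error is at most 4x/6 for x <= 2, and this range contains [0, pi/2].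
  Only the order of magnitude is wanted; the 3 reappears in the constants of the maximal
  inequality.\<close>

lemma sin_ge_third:
  fixes x :: real
  assumes "0 \<le> x" "x \<le> 2"
  shows "x / 3 \<le> sin x"
proof -
  have "\<bar>sin x - x\<bar> \<le> x ^ 3 / 6"
    using Maclaurin_sin_bound[of x 3] assms
    by (simp add: eval_nat_numeral sin_coeff_def fact_numeral field_simps)
  moreover have "x ^ 3 \<le> 4 * x"
    using mult_mono[of x 2 x 2] mult_right_mono[of "x * x" 4 x] assms by (simp add: power3_eq_cube)
  ultimately have "- (sin x - x) \<le> 4 * x / 6" by linarith
  then show ?thesis by simp
qed

lemma norm_cis_diff: "cmod (cis a - cis b) = 2 * \<bar>sin ((a - b) / 2)\<bar>"
proof -
  have "(cmod (cis a - cis b))\<^sup>2 = 2 - 2 * cos (a - b)"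
    unfolding cmod_power2 using sin_cos_squared_add[of a] sin_cos_squared_add[of b]
    by (simp add: cos_diff power2_eq_square algebra_simps)
  also have "\<dots> = (2 * \<bar>sin ((a - b) / 2)\<bar>)\<^sup>2"
  proof -
    have "2 * ((a - b) / 2) = a - b" by simp
    then show ?thesis using cos_double_sin[of "(a - b) / 2"] by (simp only: power_mult_distrib) simp
  qed
  finally show ?thesis by (rule power2_eq_imp_eq) auto
qed

text \<open>A short chord means nearby angles or, across the cut of the interval, angles that differ
  by almost 2 pi.\<close>

lemma cis_close:
  assumes a: "a \<in> {0..<2*pi}" and b: "b \<in> {0..<2*pi}" and d: "cmod (cis a - cis b) \<le> r"
  shows "\<bar>a - b\<bar> \<le> 3 * r \<or> \<bar>a - b\<bar> \<ge> 2 * pi - 3 * r"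
proof -
  define x where "x = \<bar>a - b\<bar> / 2"
  have x: "0 \<le> x" "x < pi" using a b by (auto simp: x_def)
  have "\<bar>sin ((a - b) / 2)\<bar> = \<bar>sin x\<bar>" using sin_minus[of "(a - b) / 2"] by (cases "a \<le> b") (simp_all add: x_def abs_if minus_divide_left)
  then have d': "2 * sin x \<le> r"
    using d x sin_ge_zero[of x] by (simp add: norm_cis_diff)
  show ?thesis
  proof (cases "x \<le> pi / 2")
    case True
    then have "x / 3 \<le> sin x" using x pi_less_4 by (intro sin_ge_third) auto
    then show ?thesis using d' by (simp add: x_def)
  next
    case False
    then have "(pi - x) / 3 \<le> sin (pi - x)" using x pi_less_4 by (intro sin_ge_third) auto
    then show ?thesis using d' by (simp add: x_def)
  qed
qed

lemma emeasure_arc_cball_le: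
  assumes "cmod \<zeta> = 1" and r: "0 \<le> r"
  shows "emeasure arc_measure (cball \<zeta> r) \<le> ennreal (3 * r)"
proof -
  obtain b where b: "b \<in> {0..<2*pi}" "\<zeta> = cis b"
  proof -
    have "(Re \<zeta>)\<^sup>2 + (Im \<zeta>)\<^sup>2 = 1" using assms(1) cmod_power2[of \<zeta>] by simp
    then obtain t where "0 \<le> t" "t < 2 * pi" "Re \<zeta> = cos t" "Im \<zeta> = sin t"
      using sincos_total_2pi by blast
    then show ?thesis using that[of t] by (simp add: complex_eq_iff)
  qed
  define A where "A = {0..<2*pi} \<inter> cis -` cball \<zeta> r"
  \<comment> \<open>Three intervals of length 6r suffice, the last two for wrapping around the cut.
    The total 18r divided by 2 pi is at most 3r because pi > 3.\<close>
  have A: "A \<subseteq> {b - 3*r..b + 3*r} \<union> {b + 2*pi - 3*r..b + 2*pi + 3*r} \<union> {b - 2*pi - 3*r..b - 2*pi + 3*r}"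
  proof
    fix a assume "a \<in> A"
    then have a: "a \<in> {0..<2*pi}" "cmod (cis a - cis b) \<le> r"
      by (auto simp: A_def b dist_norm norm_minus_commute)
    from cis_close[OF a(1) b(1) a(2)]
    consider "\<bar>a - b\<bar> \<le> 3 * r" | "a - b \<ge> 2 * pi - 3 * r" | "b - a \<ge> 2 * pi - 3 * r"
      by linarith
    then show "a \<in> {b - 3*r..b + 3*r} \<union> {b + 2*pi - 3*r..b + 2*pi + 3*r} \<union> {b - 2*pi - 3*r..b - 2*pi + 3*r}"
      by cases (use a(1) b(1) r in auto)
  qed
  have "emeasure lborel A \<le> emeasure lborel ({b - 3*r..b + 3*r} \<union> {b + 2*pi - 3*r..b + 2*pi + 3*r} \<union> {b - 2*pi - 3*r..b - 2*pi + 3*r})"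
    by (rule emeasure_mono[OF A]) auto
  also have "\<dots> \<le> emeasure lborel {b - 3*r..b + 3*r} + emeasure lborel {b + 2*pi - 3*r..b + 2*pi + 3*r}
      + emeasure lborel {b - 2*pi - 3*r..b - 2*pi + 3*r}"
    by (intro order.trans[OF emeasure_subadditive] add_mono) auto
  also have "\<dots> = ennreal (18 * r)"
    using r by (simp flip: ennreal_plus)
  finally have "emeasure lborel A \<le> ennreal (18 * r)" .
  then have "emeasure lborel A / ennreal (2*pi) \<le> ennreal (18 * r) / ennreal (2*pi)"
    by (rule divide_right_mono_ennreal)
  also have "\<dots> = ennreal (18 * r / (2*pi))"
    using r by (simp add: divide_ennreal)
  also have "\<dots> \<le> ennreal (3 * r)"
  proof (rule ennreal_leI)
    have "18 * r \<le> 3 * r * (2 * pi)"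
      using mult_left_mono[of 3 pi "6 * r"] pi_gt3 r by simp
    then show "18 * r / (2 * pi) \<le> 3 * r" by (subst pos_divide_le_eq) auto
  qed
  finally have "emeasure lborel A / ennreal (2*pi) \<le> ennreal (3 * r)" .
  moreover have "emeasure arc_measure (cball \<zeta> r) = emeasure lborel A / ennreal (2*pi)"
  proof -
    have "cis -` cball \<zeta> r \<in> sets borel" by (rule measurable_sets_borel[OF measurable_cis]) simp
    then show ?thesis
      unfolding arc_measure_def A_def by (subst emeasure_distr) (simp_all add: emeasure_dtheta)
  qed
  ultimately show ?thesis by simp
qed

text \<open>A Hardy--Littlewood maximal function with the radius of a ball in place of its arc length.\<close>

definition maximal_set :: "complex measure \<Rightarrow> real \<Rightarrow> complex set" where
  "maximal_set M c = {\<zeta>. \<exists>r>0. measure M (cball \<zeta> r) > c * r}"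

text \<open>A slightly larger radius keeps the strict inequality and leaves room to move the centre.
  Openness then yields measurability.\<close>

lemma open_maximal_set:
  assumes M: "finite_measure M" "sets M = sets borel" and c: "c > 0"
  shows "open (maximal_set M c)"
  unfolding open_dist
proof
  fix \<zeta> assume "\<zeta> \<in> maximal_set M c"
  then obtain r where r: "r > 0" "measure M (cball \<zeta> r) > c * r" by (auto simp: maximal_set_def)
  define e where "e = (measure M (cball \<zeta> r) / c - r) / 2"
  have "r < measure M (cball \<zeta> r) / c" using r(2) c by (simp add: pos_less_divide_eq mult.commute)
  then have e: "e > 0" "r + e < measure M (cball \<zeta> r) / c" by (auto simp: e_def field_simps)
  have "\<zeta>' \<in> maximal_set M c" if "dist \<zeta>' \<zeta> < e" for \<zeta>'
  proof -
    have "cball \<zeta> r \<subseteq> cball \<zeta>' (r + e)"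
    proof
      fix x assume "x \<in> cball \<zeta> r"
      then show "x \<in> cball \<zeta>' (r + e)" using dist_triangle[of \<zeta>' x \<zeta>] that by simp
    qed
    then have "measure M (cball \<zeta> r) \<le> measure M (cball \<zeta>' (r + e))"
      using M by (intro finite_measure.finite_measure_mono) auto
    moreover have "c * (r + e) < measure M (cball \<zeta> r)"
      using e(2) c by (simp add: pos_less_divide_eq mult.commute)
    ultimately show ?thesis
      unfolding maximal_set_def using r(1) e(1) by (auto intro!: exI[of _ "r + e"])
  qed
  then show "\<exists>e>0. \<forall>y. dist y \<zeta> < e \<longrightarrow> y \<in> maximal_set M c" using e(1) by blast
qed

lemma emeasure_UN_countable_le:
  assumes X: "\<And>i. i \<in> I \<Longrightarrow> X i \<in> sets M" and I: "countable I"
  shows "emeasure M (\<Union>i\<in>I. X i) \<le> (\<integral>\<^sup>+i. emeasure M (X i) \<partial>count_space I)"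
proof -
  have [measurable]: "(\<Union>i\<in>I. X i) \<in> sets M" using assms by (intro sets.countable_UN') auto
  have "emeasure M (\<Union>i\<in>I. X i) = (\<integral>\<^sup>+x. indicator (\<Union>i\<in>I. X i) x \<partial>M)" by simp
  also have "\<dots> \<le> (\<integral>\<^sup>+x. \<integral>\<^sup>+i. indicator (X i) x \<partial>count_space I \<partial>M)"
  proof (intro nn_integral_mono)
    fix x
    show "indicator (\<Union>i\<in>I. X i) x \<le> (\<integral>\<^sup>+i. indicator (X i) x \<partial>count_space I :: ennreal)"
    proof (cases "x \<in> (\<Union>i\<in>I. X i)")
      case True
      then obtain i where i: "i \<in> I" "x \<in> X i" by auto
      have "1 = (\<integral>\<^sup>+j. indicator {i} j \<partial>count_space I :: ennreal)"
        using i by (subst nn_integral_indicator) auto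
      also have "\<dots> \<le> (\<integral>\<^sup>+j. indicator (X j) x \<partial>count_space I)"
        using i by (intro nn_integral_mono) (auto simp: indicator_def)
      finally show ?thesis using True by simp
    qed auto
  qed
  also have "\<dots> = (\<integral>\<^sup>+i. \<integral>\<^sup>+x. indicator (X i) x \<partial>M \<partial>count_space I)"
    using assms by (intro nn_integral_count_space_nn_integral) auto
  also have "\<dots> = (\<integral>\<^sup>+i. emeasure M (X i) \<partial>count_space I)"
    using X by (intro nn_integral_cong) auto
  finally show ?thesis .
qed

text \<open>Vitali's covering lemma selects disjoint balls whose fivefold dilates cover the set. The
  constant 15 is this 5 times the 3 of \<open>emeasure_arc_cball_le\<close>.\<close>

lemma maximal_set_weak_type:
  assumes M: "finite_measure M" "sets M = sets borel" and c: "c > 0"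
  shows "emeasure arc_measure (maximal_set M c) \<le> ennreal (15 * measure M UNIV / c)"
proof -
  interpret finite_measure M by fact
  define S where "S = maximal_set M c \<inter> sphere 0 1"
  obtain r where r: "\<And>\<zeta>. \<zeta> \<in> S \<Longrightarrow> r \<zeta> > 0 \<and> measure M (cball \<zeta> (r \<zeta>)) > c * r \<zeta>"
  proof -
    have "\<forall>\<zeta>\<in>S. \<exists>r. r > 0 \<and> measure M (cball \<zeta> r) > c * r" by (auto simp: S_def maximal_set_def)
    then show ?thesis using that by (auto dest!: bchoice)
  qed
  have spM: "space M = UNIV" using sets_eq_imp_space_eq[OF M(2)] by simp
  \<comment> \<open>The covering lemma asks for bounded radii; the total mass supplies the
    bound.\<close>
  have rB: "0 < r \<zeta> \<and> r \<zeta> \<le> measure M UNIV / c" if "\<zeta> \<in> S" for \<zeta>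
  proof -
    have "c * r \<zeta> < measure M UNIV"
      using r[OF that] bounded_measure[of "cball \<zeta> (r \<zeta>)"] spM by simp
    then show ?thesis using r[OF that] c by (simp add: pos_le_divide_eq mult.commute)
  qed
  have cov: "S \<subseteq> (\<Union>i\<in>S. cball i (r i))" using rB by force
  obtain C where C: "countable C" "C \<subseteq> S"
     "pairwise (\<lambda>i j. disjnt (cball i (r i)) (cball j (r j))) C"
     "S \<subseteq> (\<Union>i\<in>C. cball i (5 * r i))"
    using Vitali_covering_lemma_cballs[OF cov rB] by blast
  have mS: "maximal_set M c \<in> sets borel" using open_maximal_set[OF M c] by simp
  then have "emeasure arc_measure (maximal_set M c) = emeasure arc_measure S"
    unfolding S_def using AE_arc_sphere by (intro emeasure_eq_AE) (auto elim!: eventually_mono)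
  also have "\<dots> \<le> emeasure arc_measure (\<Union>i\<in>C. cball i (5 * r i))"
    using C by (intro emeasure_mono) (auto intro!: sets.countable_UN')
  also have "\<dots> \<le> (\<integral>\<^sup>+i. emeasure arc_measure (cball i (5 * r i)) \<partial>count_space C)"
    using C by (intro emeasure_UN_countable_le) auto
  also have "\<dots> \<le> (\<integral>\<^sup>+i. ennreal (15 / c) * emeasure M (cball i (r i)) \<partial>count_space C)"
  proof (intro nn_integral_mono)
    fix i assume "i \<in> space (count_space C)"
    then have i: "i \<in> S" "cmod i = 1" using C by (auto simp: S_def)
    have "emeasure arc_measure (cball i (5 * r i)) \<le> ennreal (3 * (5 * r i))"
      using r[OF i(1)] i by (intro emeasure_arc_cball_le) auto
    also have "\<dots> \<le> ennreal (15 / c * measure M (cball i (r i)))"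
    proof (rule ennreal_leI)
      have "r i \<le> measure M (cball i (r i)) / c" using r[OF i(1)] c by (simp add: pos_le_divide_eq mult.commute less_imp_le)
      then show "3 * (5 * r i) \<le> 15 / c * measure M (cball i (r i))" by simp
    qed
    also have "\<dots> = ennreal (15 / c) * emeasure M (cball i (r i))"
      unfolding emeasure_eq_measure using c by (intro ennreal_mult) auto
    finally show "emeasure arc_measure (cball i (5 * r i)) \<le> ennreal (15 / c) * emeasure M (cball i (r i))" .
  qed
  also have "\<dots> = ennreal (15 / c) * (\<integral>\<^sup>+i. emeasure M (cball i (r i)) \<partial>count_space C)"
    by (rule nn_integral_cmult) simp
  also have "(\<integral>\<^sup>+i. emeasure M (cball i (r i)) \<partial>count_space C) = emeasure M (\<Union>i\<in>C. cball i (r i))"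
    using C M by (intro emeasure_UN_countable[symmetric]) (auto simp: disjoint_family_on_def pairwise_def disjnt_def)
  also have "ennreal (15 / c) * \<dots> \<le> ennreal (15 / c) * emeasure M UNIV"
    using emeasure_space[of M] spM by (intro mult_left_mono) auto
  also have "\<dots> = ennreal (15 * measure M UNIV / c)"
    unfolding emeasure_eq_measure using c by (subst ennreal_mult[symmetric]) auto
  finally show ?thesis .
qed

section \<open>The Poisson kernel and its control by the maximal function\<close>

definition poisson :: "complex \<Rightarrow> complex \<Rightarrow> real" where
  "poisson z \<xi> = (1 - (cmod z)\<^sup>2) / (cmod (\<xi> - z))\<^sup>2"

lemma poisson_nonneg: "cmod z < 1 \<Longrightarrow> 0 \<le> poisson z \<xi>"
  by (auto simp: poisson_def abs_square_le_1 intro!: divide_nonneg_nonneg)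

lemma measurable_poisson [measurable]: "poisson z \<in> borel_measurable borel"
  unfolding poisson_def[abs_def] by measurable

text \<open>Both bounds come from the distance of \<open>\<xi>\<close> to
  \<open>r * \<zeta>\<close>: it is at least 1-r, and it is at least half the distance of
  \<open>\<xi>\<close> to \<open>\<zeta>\<close>, because moving from \<open>\<zeta>\<close> to
  \<open>r * \<zeta>\<close> costs only 1-r.\<close>

lemma poisson_bounds:
  fixes r :: real and \<zeta> \<xi> :: complex
  assumes \<zeta>: "cmod \<zeta> = 1" and \<xi>: "cmod \<xi> = 1" and r: "0 \<le> r" "r < 1"
  shows "poisson (r * \<zeta>) \<xi> \<le> 2 / (1 - r)"
    and "\<xi> \<noteq> \<zeta> \<Longrightarrow> poisson (r * \<zeta>) \<xi> \<le> 8 * (1 - r) / (dist \<zeta> \<xi>)\<^sup>2"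
proof -
  have n: "cmod (r * \<zeta>) = r" using \<zeta> r by (simp add: norm_mult)
  have 1: "1 - r \<le> cmod (\<xi> - r * \<zeta>)" using norm_triangle_ineq2[of \<xi> "r * \<zeta>"] \<xi> n by simp
  have "\<zeta> - \<xi> = (1 - r) * \<zeta> - (\<xi> - r * \<zeta>)" by (simp add: algebra_simps)
  then have "dist \<zeta> \<xi> \<le> cmod ((1 - r) * \<zeta>) + cmod (\<xi> - r * \<zeta>)"
    unfolding dist_norm by (metis norm_triangle_ineq4)
  also have "cmod ((1 - r) * \<zeta>) = 1 - r"
    unfolding norm_mult norm_of_real using \<zeta> r by simp
  finally have 2: "dist \<zeta> \<xi> / 2 \<le> cmod (\<xi> - r * \<zeta>)" using 1 by simp
  have num: "1 - r\<^sup>2 \<le> 2 * (1 - r)" using r using zero_le_power2[of "1 - r"] by (simp add: power2_eq_square algebra_simps)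
  have p: "0 < 1 - r" using r by simp
  have "poisson (r * \<zeta>) \<xi> \<le> 2 * (1 - r) / (1 - r)\<^sup>2"
    unfolding poisson_def n using 1 num p by (intro frac_le power_mono) (auto simp: less_imp_le)
  also have "\<dots> = 2 / (1 - r)" using p unfolding power2_eq_square by (subst frac_eq_eq) auto
  finally show "poisson (r * \<zeta>) \<xi> \<le> 2 / (1 - r)" .
  assume "\<xi> \<noteq> \<zeta>"
  then have "poisson (r * \<zeta>) \<xi> \<le> 2 * (1 - r) / (dist \<zeta> \<xi> / 2)\<^sup>2"
    unfolding poisson_def n using 2 num p by (intro frac_le power_mono) (auto simp: less_imp_le)
  then show "poisson (r * \<zeta>) \<xi> \<le> 8 * (1 - r) / (dist \<zeta> \<xi>)\<^sup>2"
    by (simp add: power_divide)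
qed

lemma poisson_dyadic:
  fixes r :: real and \<zeta> \<xi> :: complex
  assumes \<zeta>: "cmod \<zeta> = 1" and \<xi>: "cmod \<xi> = 1" and r: "0 \<le> r" "r < 1"
  shows "\<exists>k. poisson (r * \<zeta>) \<xi> \<le> 32 / (4 ^ k * (1 - r)) * indicator (cball \<zeta> (2 ^ k * (1 - r))) \<xi>"
proof (cases "dist \<zeta> \<xi> \<le> 1 - r")
  case True
  have "2 / (1 - r) \<le> 32 / (1 - r)" using r by (intro divide_right_mono) auto
  then show ?thesis using poisson_bounds(1)[OF assms] True
    by (intro exI[of _ 0]) (auto simp: indicator_def)
next
  case False
  define t d where "t = 1 - r" and "d = dist \<zeta> \<xi>"
  have t: "t > 0" and td: "t < d" using False r by (auto simp: t_def d_def)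
  \<comment> \<open>The smallest dyadic ball about \<open>\<zeta>\<close> that contains
    \<open>\<xi>\<close>. By minimality the distance is at least half its radius, which turns the
    constant 8 into 8 * 4 = 32.\<close>
  define k where "k = (LEAST k. d \<le> 2 ^ k * t)"
  obtain n where "d / t < 2 ^ n" using real_arch_pow[of 2 "d / t"] by auto
  then have "d \<le> 2 ^ n * t" using t by (simp add: pos_divide_less_eq less_imp_le)
  then have k1: "d \<le> 2 ^ k * t" unfolding k_def by (rule LeastI)
  have "k \<noteq> 0" using k1 td by (metis mult_1 not_less power_0)
  then obtain j where j: "k = Suc j" using not0_implies_Suc by blast
  have "\<not> d \<le> 2 ^ j * t" using not_less_Least[of j "\<lambda>k. d \<le> 2 ^ k * t"] j unfolding k_def by simp
  then have k2: "2 ^ j * t \<le> d" by simp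
  have "\<xi> \<noteq> \<zeta>" using td t by (auto simp: d_def)
  then have "poisson (r * \<zeta>) \<xi> \<le> 8 * t / d\<^sup>2"
    using poisson_bounds(2)[OF assms] by (simp add: t_def d_def)
  also have "\<dots> \<le> 8 * t / (2 ^ j * t)\<^sup>2"
    using t k2 by (intro divide_left_mono power_mono mult_pos_pos) (use td in auto)
  also have "\<dots> = 32 / (4 ^ k * t)"
  proof -
    have "(4::real) ^ j = 2 ^ j * 2 ^ j" by (simp flip: power_mult_distrib)
    then show ?thesis using t by (simp add: j power2_eq_square)
  qed
  finally show ?thesis
    using k1 by (intro exI[of _ k]) (auto simp: indicator_def t_def d_def)
qed

text \<open>Off the maximal set a ball of radius \<open>2^k * (1 - r)\<close> has mass at most c
  times its radius, so the k-th dyadic piece contributes at most 32 c / 2^k. The sum is 64 c,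
  whatever r is.\<close>

lemma poisson_maximal:
  fixes r :: real and \<zeta> :: complex
  assumes M: "finite_measure M" "sets M = sets borel" and sph: "AE \<xi> in M. cmod \<xi> = 1"
    and c: "c > 0" and \<zeta>: "cmod \<zeta> = 1" "\<zeta> \<notin> maximal_set M c" and r: "0 \<le> r" "r < 1"
  shows "(\<integral>\<^sup>+\<xi>. ennreal (poisson (r * \<zeta>) \<xi>) \<partial>M) \<le> ennreal (64 * c)"
proof -
  interpret finite_measure M by fact
  note [measurable_cong] = M(2)
  define t where "t = 1 - r"
  have t: "t > 0" using r by (simp add: t_def)
  have term_le: "F k \<le> suminf F" for F :: "nat \<Rightarrow> ennreal" and k
    using sum_le_suminf[of F "{k}"] by simp
  have cb: "cball x a \<in> sets M" for x :: complex and a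
    using M(2) by simp
  have "(\<integral>\<^sup>+\<xi>. ennreal (poisson (r * \<zeta>) \<xi>) \<partial>M)
     \<le> (\<integral>\<^sup>+\<xi>. (\<Sum>k. ennreal (32 / (4 ^ k * t)) * indicator (cball \<zeta> (2 ^ k * t)) \<xi>) \<partial>M)"
  proof (rule nn_integral_mono_AE, use sph in eventually_elim)
    fix \<xi> :: complex assume \<xi>: "cmod \<xi> = 1"
    obtain k where k: "poisson (r * \<zeta>) \<xi> \<le> 32 / (4 ^ k * t) * indicator (cball \<zeta> (2 ^ k * t)) \<xi>"
      unfolding t_def by (metis poisson_dyadic[OF \<zeta>(1) \<xi> r])
    then have "ennreal (poisson (r * \<zeta>) \<xi>) \<le> ennreal (32 / (4 ^ k * t)) * indicator (cball \<zeta> (2 ^ k * t)) \<xi>"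
      by (cases "\<xi> \<in> cball \<zeta> (2 ^ k * t)") (auto simp: ennreal_neg simp del: mem_cball intro: ennreal_leI)
    also have "\<dots> \<le> (\<Sum>k. ennreal (32 / (4 ^ k * t)) * indicator (cball \<zeta> (2 ^ k * t)) \<xi>)"
      by (rule term_le)
    finally show "ennreal (poisson (r * \<zeta>) \<xi>) \<le> (\<Sum>k. ennreal (32 / (4 ^ k * t)) * indicator (cball \<zeta> (2 ^ k * t)) \<xi>)" .
  qed
  also have "\<dots> = (\<Sum>k. ennreal (32 / (4 ^ k * t)) * emeasure M (cball \<zeta> (2 ^ k * t)))"
  proof (subst nn_integral_suminf)
    show "(\<lambda>\<xi>. ennreal (32 / (4 ^ i * t)) * indicator (cball \<zeta> (2 ^ i * t)) \<xi>) \<in> borel_measurable M" for i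
      by (intro borel_measurable_times_ennreal borel_measurable_const borel_measurable_indicator cb)
  qed (simp add: nn_integral_cmult_indicator cb)
  also have "\<dots> \<le> (\<Sum>k. ennreal (32 * c * (1 / 2) ^ k))"
  proof (intro suminf_le allI)
    fix k
    have "measure M (cball \<zeta> (2 ^ k * t)) \<le> c * (2 ^ k * t)"
    proof -
      have "0 < 2 ^ k * t" using t by simp
      then show ?thesis using \<zeta>(2) unfolding maximal_set_def by (metis (mono_tags, lifting) mem_Collect_eq not_less)
    qed
    then have "32 / (4 ^ k * t) * measure M (cball \<zeta> (2 ^ k * t)) \<le> 32 / (4 ^ k * t) * (c * (2 ^ k * t))"
      using t by (intro mult_left_mono) auto
    also have "\<dots> = 32 * c * (1 / 2) ^ k"
    proof -
      have "(4::real) ^ k = 2 ^ k * 2 ^ k" by (simp flip: power_mult_distrib)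
      then show ?thesis using t by (simp add: power_one_over)
    qed
    finally show "ennreal (32 / (4 ^ k * t)) * emeasure M (cball \<zeta> (2 ^ k * t)) \<le> ennreal (32 * c * (1 / 2) ^ k)"
      unfolding emeasure_eq_measure using t by (subst ennreal_mult[symmetric]) (auto intro: ennreal_leI)
  qed auto
  also have "\<dots> = ennreal (\<Sum>k. 32 * c * (1 / 2) ^ k)"
    using c by (intro suminf_ennreal2 summable_mult summable_geometric) auto
  also have "(\<Sum>k. 32 * c * (1 / 2) ^ k) = 64 * c"
    using suminf_geometric[of "1/2 :: real"] by (subst suminf_mult) (auto intro: summable_geometric)
  finally show ?thesis .
qed

text \<open>The form in which weak-type bounds are consumed: exceptional sets of arbitrarily small
  measure have a null intersection.\<close>

lemma AE_small_exceptional: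
  assumes "\<And>e. e > 0 \<Longrightarrow> \<exists>A\<in>sets M. emeasure M A \<le> ennreal e \<and> (\<forall>x\<in>space M - A. P x)"
  shows "AE x in M. P x"
proof -
  obtain A where A: "\<And>n. A n \<in> sets M" "\<And>n. emeasure M (A n) \<le> ennreal (1 / Suc n)"
      "\<And>n x. x \<in> space M - A n \<Longrightarrow> P x"
    using assms[of "1 / Suc n" for n] by (metis of_nat_0_less_iff zero_less_Suc zero_less_divide_1_iff)
  have "emeasure M (\<Inter>n. A n) = 0"
  proof -
    have "emeasure M (\<Inter>n. A n) \<le> ennreal (1 / Suc n)" for n
      using emeasure_mono[of "\<Inter>n. A n" "A n" M] A(1,2) order.trans by blast
    moreover have "(\<lambda>n. ennreal (1 / Suc n)) \<longlonglongrightarrow> ennreal 0"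
      by (intro tendsto_ennrealI LIMSEQ_inverse_real_of_nat[unfolded inverse_eq_divide])
    ultimately have "emeasure M (\<Inter>n. A n) \<le> ennreal 0"
      by (intro LIMSEQ_le_const) auto
    then show ?thesis by simp
  qed
  then show ?thesis
    using A by (intro AE_I[of _ _ "\<Inter>n. A n"]) auto
qed

subsection \<open>The Poisson and Schwarz formulas\<close>

lemma measurable_dtheta_cont:
  fixes f :: "complex \<Rightarrow> 'b::{second_countable_topology,banach}"
  assumes "continuous_on (sphere 0 1) f"
  shows "(\<lambda>\<theta>. f (cis \<theta>)) \<in> borel_measurable dtheta"
proof -
  have "continuous_on UNIV (\<lambda>\<theta>. f (cis \<theta>))"
    by (rule continuous_on_compose2[OF assms]) (auto intro!: continuous_intros)
  then show ?thesis
    using borel_measurable_continuous_onI measurable_cong_sets[OF sets_dtheta refl] by blast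
qed

lemma sphere_bounded:
  fixes f :: "complex \<Rightarrow> 'b::real_normed_vector"
  assumes "continuous_on (sphere 0 1) f"
  obtains B where "\<And>\<theta>. norm (f (cis \<theta>)) \<le> B"
proof -
  have "compact (f ` sphere 0 1)"
    using assms by (intro compact_continuous_image) auto
  then obtain B where "\<And>x. x \<in> sphere 0 1 \<Longrightarrow> norm (f x) \<le> B"
    by (meson bounded_iff compact_imp_bounded image_eqI)
  then show ?thesis using that[of B] by simp
qed

lemma integrable_dtheta_cont:
  fixes f :: "complex \<Rightarrow> 'b::{second_countable_topology,banach}"
  assumes "continuous_on (sphere 0 1) f"
  shows "integrable dtheta (\<lambda>\<theta>. f (cis \<theta>))"
proof -
  obtain B where "\<And>\<theta>. norm (f (cis \<theta>)) \<le> B" using sphere_bounded[OF assms] by blast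
  then show ?thesis
    by (intro dtheta.integrable_const_bound[where B = B] measurable_dtheta_cont assms) auto
qed

lemma dtheta_density: "dtheta = density lborel (\<lambda>\<theta>. ennreal (indicator {0..<2*pi} \<theta> / (2*pi)))"
  unfolding dtheta_def uniform_measure_def
  by (intro arg_cong2[where f = density] ext refl)
     (auto simp: indicator_def divide_ennreal ennreal_1[symmetric] simp del: ennreal_1)

text \<open>\<open>dtheta\<close> lives on the half-open interval, contour integrals and
  \<open>szego_fun\<close> on the closed one; the right endpoint is a null set.\<close>

lemma integral_dtheta:
  fixes f :: "real \<Rightarrow> 'b::{second_countable_topology,banach}"
  assumes "f \<in> borel_measurable borel"
  shows "(LINT \<theta>|dtheta. f \<theta>) = (LINT \<theta>:{0..2*pi}|lborel. f \<theta>) /\<^sub>R (2*pi)"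
proof -
  have "(LINT \<theta>|dtheta. f \<theta>) = (LINT \<theta>|lborel. (indicator {0..<2*pi} \<theta> / (2*pi)) *\<^sub>R f \<theta>)"
    unfolding dtheta_density using assms by (subst integral_density) auto
  also have "\<dots> = (LINT \<theta>|lborel. (indicator {0..2*pi} \<theta> *\<^sub>R f \<theta>) /\<^sub>R (2*pi))"
  proof (rule integral_cong_AE)
    show "AE \<theta> in lborel. (indicator {0..<2*pi} \<theta> / (2*pi)) *\<^sub>R f \<theta> = (indicator {0..2*pi} \<theta> *\<^sub>R f \<theta>) /\<^sub>R (2*pi)"
      using AE_lborel_singleton[of "2*pi"] by eventually_elim (auto simp: indicator_def inverse_eq_divide)
  qed (use assms in auto)
  also have "\<dots> = (LINT \<theta>:{0..2*pi}|lborel. f \<theta>) /\<^sub>R (2*pi)"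
    unfolding set_lebesgue_integral_def by (rule integral_scaleR_right)
  finally show ?thesis .
qed

lemma integrable_dtheta_iff:
  fixes f :: "real \<Rightarrow> 'b::{second_countable_topology,banach}"
  assumes "f \<in> borel_measurable borel"
  shows "integrable dtheta f \<longleftrightarrow> set_integrable lborel {0..2*pi} f"
proof -
  have "integrable dtheta f \<longleftrightarrow> integrable lborel (\<lambda>\<theta>. (indicator {0..<2*pi} \<theta> / (2*pi)) *\<^sub>R f \<theta>)"
    unfolding dtheta_density using assms by (subst integrable_density) auto
  also have "\<dots> \<longleftrightarrow> integrable lborel (\<lambda>\<theta>. (1 / (2*pi)) *\<^sub>R (indicator {0..2*pi} \<theta> *\<^sub>R f \<theta>))"
  proof (rule integrable_cong_AE)
    show "AE \<theta> in lborel. (indicator {0..<2*pi} \<theta> / (2*pi)) *\<^sub>R f \<theta> = (1 / (2*pi)) *\<^sub>R (indicator {0..2*pi} \<theta> *\<^sub>R f \<theta>)"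
      using AE_lborel_singleton[of "2*pi"] by eventually_elim (auto simp: indicator_def)
  qed (use assms in auto)
  also have "\<dots> \<longleftrightarrow> set_integrable lborel {0..2*pi} f"
    unfolding set_integrable_def
  proof
    assume "integrable lborel (\<lambda>\<theta>. (1 / (2*pi)) *\<^sub>R (indicator {0..2*pi} \<theta> *\<^sub>R f \<theta>))"
    then have "integrable lborel (\<lambda>\<theta>. (2*pi) *\<^sub>R ((1 / (2*pi)) *\<^sub>R (indicator {0..2*pi} \<theta> *\<^sub>R f \<theta>)))"
      by (rule integrable_scaleR_right)
    moreover have "(2*pi) *\<^sub>R ((1 / (2*pi)) *\<^sub>R x) = x" for x :: 'b by simp
    ultimately show "integrable lborel (\<lambda>\<theta>. indicator {0..2*pi} \<theta> *\<^sub>R f \<theta>)" by (simp only:)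
  qed (rule integrable_scaleR_right)
  finally show ?thesis .
qed

text \<open>In the angle coordinate, \<open>cis \<theta>\<close> against \<open>dtheta\<close> is d
  zeta / (2 pi i). This moves Cauchy's formula from the gauge integral to the Bochner
  integral.\<close>

lemma circle_integral:
  assumes f: "continuous_on (sphere 0 1) f" and I: "(f has_contour_integral I) (circlepath 0 1)"
  shows "(LINT \<theta>|dtheta. f (cis \<theta>) * cis \<theta>) = I / (2 * of_real pi * \<i>)"
proof -
  let ?g = "\<lambda>\<theta>. f (cis \<theta>) * cis \<theta>"
  have c: "continuous_on (sphere 0 1) (\<lambda>\<zeta>. f \<zeta> * \<zeta>)" by (intro continuous_intros f)
  have m: "?g \<in> borel_measurable borel"
    using measurable_dtheta_cont[OF c] measurable_cong_sets[OF sets_dtheta refl] by blast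
  have "((\<lambda>t. f (0 + of_real 1 * cis t) * of_real 1 * \<i> * cis t) has_integral I) {0..2*pi}"
    using I unfolding circlepath_def by (subst (asm) has_contour_integral_part_circlepath_iff) auto
  then have "((\<lambda>t. \<i> * ?g t) has_integral I) {0..2*pi}" by (simp add: mult_ac)
  then have "((\<lambda>t. (- \<i>) * (\<i> * ?g t)) has_integral (- \<i>) * I) {0..2*pi}" by (rule has_integral_mult_right)
  then have hk: "(?g has_integral (- \<i>) * I) {0..2*pi}" by (simp add: mult.assoc[symmetric])
  have "set_integrable lborel {0..2*pi} ?g"
    using integrable_dtheta_cont[OF c] integrable_dtheta_iff[OF m] by simp
  then have "(LINT \<theta>:{0..2*pi}|lborel. ?g \<theta>) = - \<i> * I"
    using set_borel_integral_eq_integral(2) hk by (metis integral_unique)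
  then show ?thesis
    unfolding integral_dtheta[OF m] by (simp add: scaleR_conv_of_real field_simps)
qed

lemma cauchy_circle:
  assumes c: "continuous_on (cball 0 1) h" and h: "h holomorphic_on ball 0 1" and z: "cmod z < 1"
  shows "(LINT \<theta>|dtheta. h (cis \<theta>) * (cis \<theta> / (cis \<theta> - z))) = h z"
proof -
  have "((\<lambda>u. h u / (u - z)) has_contour_integral (2 * of_real pi * \<i> * h z)) (circlepath 0 1)"
    using Cauchy_integral_circlepath[OF c h] z by simp
  moreover have "continuous_on (sphere 0 1) (\<lambda>u. h u / (u - z))"
    using z by (intro continuous_intros continuous_on_subset[OF c]) auto
  ultimately have "(LINT \<theta>|dtheta. h (cis \<theta>) / (cis \<theta> - z) * cis \<theta>) = h z"
    by (subst circle_integral) auto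
  then show ?thesis by (simp add: mult.commute)
qed

lemma mean_value_circle:
  assumes c: "continuous_on (cball 0 1) h" and h: "h holomorphic_on ball 0 1"
  shows "(LINT \<theta>|dtheta. h (cis \<theta>)) = h 0"
  using cauchy_circle[OF assms, of 0] by simp

lemma one_minus_cnj_nonzero: "cmod z < 1 \<Longrightarrow> cmod \<xi> \<le> 1 \<Longrightarrow> 1 - cnj z * \<xi> \<noteq> 0"
proof
  assume z: "cmod z < 1" "cmod \<xi> \<le> 1" and "1 - cnj z * \<xi> = 0"
  then have "cmod z * cmod \<xi> = 1"
    by (metis complex_mod_cnj eq_iff_diff_eq_0 norm_mult norm_one)
  moreover have "cmod z * cmod \<xi> \<le> cmod z * 1" using z by (intro mult_left_mono) auto
  ultimately show False using z by simp
qed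

text \<open>On the circle the Poisson kernel is the Cauchy kernel times a function holomorphic in
  \<open>\<xi>\<close> with no pole in the closed disk, which reduces the Poisson formula to
  Cauchy's.\<close>

lemma poisson_factor:
  assumes "cmod \<xi> = 1" "cmod z < 1"
  shows "complex_of_real (poisson z \<xi>) = (1 - complex_of_real ((cmod z)\<^sup>2)) / (1 - cnj z * \<xi>) * (\<xi> / (\<xi> - z))"
proof -
  have u: "\<xi> * cnj \<xi> = 1" using complex_norm_square[of \<xi>] assms by simp
  have "complex_of_real ((cmod (\<xi> - z))\<^sup>2) = (\<xi> - z) * (cnj \<xi> - cnj z)"
    unfolding complex_norm_square by simp
  moreover have "\<xi> * (cnj \<xi> - cnj z) = 1 - cnj z * \<xi>" using u by (simp add: algebra_simps)
  then have "cnj \<xi> - cnj z = (1 - cnj z * \<xi>) / \<xi>"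
    using assms by (simp add: eq_divide_eq mult.commute) (metis norm_zero zero_neq_one)
  ultimately have "complex_of_real ((cmod (\<xi> - z))\<^sup>2) = (\<xi> - z) * ((1 - cnj z * \<xi>) / \<xi>)" by simp
  then show ?thesis
    unfolding poisson_def of_real_divide by simp
qed

lemma poisson_formula:
  assumes c: "continuous_on (cball 0 1) h" and h: "h holomorphic_on ball 0 1" and z: "cmod z < 1"
  shows "(LINT \<theta>|dtheta. complex_of_real (poisson z (cis \<theta>)) * h (cis \<theta>)) = h z"
proof -
  \<comment> \<open>The extra factor equals 1 at \<open>\<xi> = z\<close>, so Cauchy's formula for
    \<open>G\<close> returns \<open>h z\<close>.\<close>
  define G where "G \<xi> = h \<xi> * ((1 - complex_of_real ((cmod z)\<^sup>2)) / (1 - cnj z * \<xi>))" for \<xi>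
  have "(LINT \<theta>|dtheta. G (cis \<theta>) * (cis \<theta> / (cis \<theta> - z))) = G z"
    using one_minus_cnj_nonzero[OF z] unfolding G_def
    by (intro cauchy_circle z continuous_intros c holomorphic_intros h) auto
  moreover have "cnj z * z = complex_of_real ((cmod z)\<^sup>2)"
    unfolding complex_norm_square by simp
  then have "G z = h z"
    using one_minus_cnj_nonzero[OF z, of z] z by (simp add: G_def)
  moreover have "G (cis \<theta>) * (cis \<theta> / (cis \<theta> - z)) = complex_of_real (poisson z (cis \<theta>)) * h (cis \<theta>)" for \<theta>
    unfolding G_def poisson_factor[OF norm_cis z] by (simp only: mult_ac)
  ultimately show ?thesis by simp
qed

lemma poisson_continuous: "cmod z < 1 \<Longrightarrow> continuous_on (sphere 0 1) (poisson z)"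
  unfolding poisson_def by (intro continuous_intros) auto

lemma poisson_integral_1:
  assumes z: "cmod z < 1"
  shows "(LINT \<theta>|dtheta. poisson z (cis \<theta>)) = 1"
proof -
  have "complex_of_real (LINT \<theta>|dtheta. poisson z (cis \<theta>)) = (LINT \<theta>|dtheta. complex_of_real (poisson z (cis \<theta>)) * 1)"
    by (simp flip: integral_complex_of_real)
  also have "\<dots> = 1" using poisson_formula[of "\<lambda>_. 1" z] z by simp
  finally show ?thesis by (metis of_real_eq_1_iff)
qed

definition herglotz :: "complex \<Rightarrow> complex \<Rightarrow> complex" where
  "herglotz z \<xi> = (\<xi> + z) / (\<xi> - z)"

lemma herglotz_continuous: "cmod z < 1 \<Longrightarrow> continuous_on (sphere 0 1) (herglotz z)"
  unfolding herglotz_def by (intro continuous_intros) auto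

text \<open>With 2 Re h = h + cnj h, the first half is a Cauchy integral. On the circle the kernel
  times \<open>cnj h\<close> is the conjugate of the function \<open>k\<close>, holomorphic in the
  disk, so the mean value property reduces the second half to the conjugate of
  \<open>h 0\<close>.\<close>

lemma schwarz_formula:
  assumes c: "continuous_on (cball 0 1) h" and h: "h holomorphic_on ball 0 1" and z: "cmod z < 1"
  shows "(LINT \<theta>|dtheta. herglotz z (cis \<theta>) * complex_of_real (Re (h (cis \<theta>)))) = h z - \<i> * Im (h 0)"
proof -
  have cs: "continuous_on (sphere 0 1) h" by (rule continuous_on_subset[OF c]) auto
  have ch: "continuous_on (sphere 0 1) (\<lambda>\<xi>. h \<xi> * (\<xi> / (\<xi> - z)))"
    using z by (intro continuous_intros cs) auto
  define k where "k \<xi> = h \<xi> * ((1 + cnj z * \<xi>) / (1 - cnj z * \<xi>))" for \<xi>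
  have ck: "continuous_on (cball 0 1) k" "k holomorphic_on ball 0 1"
    unfolding k_def using one_minus_cnj_nonzero[OF z]
    by (auto intro!: continuous_intros holomorphic_intros c h)
  have cks: "continuous_on (sphere 0 1) k" by (rule continuous_on_subset[OF ck(1)]) auto
  have eq: "herglotz z (cis \<theta>) * complex_of_real (Re (h (cis \<theta>)))
      = (h (cis \<theta>) * (cis \<theta> / (cis \<theta> - z)) - h (cis \<theta>) / 2) + cnj (k (cis \<theta>)) / 2" for \<theta>
  proof -
    define \<xi> where "\<xi> = cis \<theta>"
    have nz: "\<xi> - z \<noteq> 0" using z by (auto simp: \<xi>_def)
    have u: "\<xi> * cnj \<xi> = 1" using complex_norm_square[of \<xi>] by (simp add: \<xi>_def)
    have n1: "1 - z * cnj \<xi> \<noteq> 0"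
      using one_minus_cnj_nonzero[OF z, of \<xi>] by (metis complex_cnj_cancel_iff complex_cnj_cnj complex_cnj_diff complex_cnj_mult complex_cnj_one complex_cnj_zero norm_cis \<xi>_def order_refl)
    have "(1 + z * cnj \<xi>) * (\<xi> - z) = (\<xi> + z) * (1 - z * cnj \<xi>)"
      using u by (simp add: algebra_simps)
    then have "(1 + z * cnj \<xi>) / (1 - z * cnj \<xi>) = (\<xi> + z) / (\<xi> - z)"
      using nz n1 by (simp add: frac_eq_eq)
    then have 1: "cnj (k \<xi>) = cnj (h \<xi>) * ((\<xi> + z) / (\<xi> - z))" by (simp add: k_def flip: times_divide_eq_right)
    have 2: "complex_of_real (Re (h \<xi>)) = (h \<xi> + cnj (h \<xi>)) / 2"
      using complex_add_cnj[of "h \<xi>"] by simp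
    have 3: "(\<xi> + z) / (\<xi> - z) = 2 * (\<xi> / (\<xi> - z)) - 1" using nz by (simp add: field_simps)
    define q where "q = \<xi> / (\<xi> - z)"
    show ?thesis unfolding \<xi>_def[symmetric] 1 2 herglotz_def 3 q_def[symmetric] by (simp add: field_simps)
  qed
  have "(LINT \<theta>|dtheta. herglotz z (cis \<theta>) * complex_of_real (Re (h (cis \<theta>))))
     = (LINT \<theta>|dtheta. h (cis \<theta>) * (cis \<theta> / (cis \<theta> - z)) - h (cis \<theta>) / 2) + (LINT \<theta>|dtheta. cnj (k (cis \<theta>)) / 2)"
    unfolding eq
    by (intro Bochner_Integration.integral_add Bochner_Integration.integrable_diff
        integrable_dtheta_cont[OF ch] integrable_dtheta_cont[where f = "\<lambda>\<xi>. h \<xi> / 2"]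
        integrable_dtheta_cont[where f = "\<lambda>\<xi>. cnj (k \<xi>) / 2"] continuous_intros cs cks) auto
  also have "(LINT \<theta>|dtheta. h (cis \<theta>) * (cis \<theta> / (cis \<theta> - z)) - h (cis \<theta>) / 2) = h z - h 0 / 2"
  proof -
    have "(LINT \<theta>|dtheta. h (cis \<theta>) * (cis \<theta> / (cis \<theta> - z)) - h (cis \<theta>) / 2)
      = (LINT \<theta>|dtheta. h (cis \<theta>) * (cis \<theta> / (cis \<theta> - z))) - (LINT \<theta>|dtheta. h (cis \<theta>) / 2)"
      by (intro Bochner_Integration.integral_diff
        integrable_dtheta_cont[OF ch] integrable_dtheta_cont[where f = "\<lambda>\<xi>. h \<xi> / 2"] continuous_intros cs) auto
    then show ?thesis using cauchy_circle[OF c h z] mean_value_circle[OF c h] by simp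
  qed
  also have "(LINT \<theta>|dtheta. cnj (k (cis \<theta>)) / 2) = cnj (h 0) / 2"
  proof -
    have "k 0 = h 0" by (simp add: k_def)
    then show ?thesis
      by (simp only: integral_divide_zero Bochner_Integration.integral_cnj mean_value_circle[OF ck])
  qed
  also have "h z - h 0 / 2 + cnj (h 0) / 2 = h z - \<i> * Im (h 0)"
    by (simp add: complex_eq_iff)
  finally show ?thesis .
qed

subsection \<open>Fatou's theorem\<close>

definition poisson_int :: "complex measure \<Rightarrow> real \<Rightarrow> complex \<Rightarrow> real" where
  "poisson_int M r \<zeta> = (LINT \<xi>|M. poisson (of_real r * \<zeta>) \<xi>)"

lemma eventually_radial: "eventually (\<lambda>r. 0 < r \<and> r < 1) (at_left (1::real))"
  unfolding eventually_at_left_field by (auto intro!: exI[of _ 0])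

locale circle_finite_measure = finite_measure M for M :: "complex measure" +
  assumes sets_M: "sets M = sets borel" and sphere_M: "AE \<xi> in M. cmod \<xi> = 1"
begin

lemma space_M: "space M = UNIV"
  using sets_eq_imp_space_eq[OF sets_M] by simp

lemma meas_poisson: "poisson z \<in> borel_measurable M"
  using measurable_cong_sets[OF sets_M refl] measurable_poisson by blast

lemma norm_lt: "cmod \<zeta> = 1 \<Longrightarrow> 0 \<le> r \<Longrightarrow> r < 1 \<Longrightarrow> cmod (complex_of_real r * \<zeta>) < 1"
  by (simp add: norm_mult)

lemma integrable_poisson:
  assumes \<zeta>: "cmod \<zeta> = 1" and r: "0 \<le> r" "r < 1"
  shows "integrable M (poisson (of_real r * \<zeta>))"
proof (rule integrable_const_bound[where B = "2 / (1 - r)"])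
  show "AE \<xi> in M. norm (poisson (of_real r * \<zeta>) \<xi>) \<le> 2 / (1 - r)"
    using sphere_M by eventually_elim
      (use poisson_bounds(1)[OF \<zeta> _ r] poisson_nonneg[OF norm_lt[OF \<zeta> r]] in auto)
qed (rule meas_poisson)

lemma poisson_int_nn:
  assumes \<zeta>: "cmod \<zeta> = 1" and r: "0 \<le> r" "r < 1"
  shows "(\<integral>\<^sup>+\<xi>. ennreal (poisson (of_real r * \<zeta>) \<xi>) \<partial>M) = ennreal (poisson_int M r \<zeta>)"
  unfolding poisson_int_def
  by (rule nn_integral_eq_integral[OF integrable_poisson[OF assms]])
     (use poisson_nonneg[OF norm_lt[OF assms]] in auto)

lemma poisson_int_nonneg:
  assumes \<zeta>: "cmod \<zeta> = 1" and r: "0 \<le> r" "r < 1"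
  shows "0 \<le> poisson_int M r \<zeta>"
  unfolding poisson_int_def by (intro integral_nonneg_AE) (use poisson_nonneg[OF norm_lt[OF assms]] in auto)

text \<open>Mass on a compact set missing \<open>A\<close> lies at positive distance from a point of
  \<open>A\<close>, where the kernel tends to 0; the remaining mass is small and controlled by the
  maximal function. One statement thus covers the singular part of a measure and an absolutely
  continuous measure at the zeros of its density.\<close>

lemma poisson_limit_0:
  assumes A: "\<And>e. e > 0 \<Longrightarrow> \<exists>K. compact K \<and> K \<inter> A = {} \<and> measure M (- K) \<le> e"
  shows "AE \<zeta> in arc_measure. \<zeta> \<in> A \<longrightarrow> ((\<lambda>r. poisson_int M r \<zeta>) \<longlongrightarrow> 0) (at_left 1)"
proof -
  have step: "AE \<zeta> in arc_measure. cmod \<zeta> = 1 \<longrightarrow> \<zeta> \<in> A \<longrightarrow> eventually (\<lambda>r. poisson_int M r \<zeta> \<le> d) (at_left 1)"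
    if d: "d > 0" for d
  proof (rule AE_small_exceptional)
    fix e :: real assume e: "e > 0"
    \<comment> \<open>Then 64 c = d/2, the share of the error left to the maximal bound.\<close>
    define c where "c = d / 128"
    have c: "c > 0" using d by (simp add: c_def)
    \<comment> \<open>The weak-type factor 15/c turns this mass into an exceptional set of measure
      at most \<open>e\<close>.\<close>
    have "e * c / 15 > 0" using e c by simp
    then obtain K where K: "compact K" "K \<inter> A = {}" "measure M (- K) \<le> e * c / 15" using A by blast
    have Kb: "K \<in> sets borel" "K \<in> sets M" "- K \<in> sets M" using borel_compact[OF K(1)] sets_M by (auto intro!: borel_comp)
    define N where "N = density M (indicator (- K))"
    have sN: "sets N = sets borel" by (simp add: N_def sets_M)
    have emN: "emeasure N B = emeasure M (- K \<inter> B)" if "B \<in> sets M" for B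
      unfolding N_def using that Kb
      by (subst emeasure_density) (auto simp flip: indicator_inter_arith)
    have fN: "finite_measure N"
      by (rule finite_measureI) (use emN[of UNIV] sets_M Kb in \<open>auto simp: N_def space_M emeasure_eq_measure\<close>)
    have mN: "measure N UNIV = measure M (- K)"
      using emN[of UNIV] sets_M by (simp add: measure_def)
    have spN: "AE \<xi> in N. cmod \<xi> = 1"
      unfolding N_def using Kb sphere_M by (subst AE_density) auto
    have "emeasure arc_measure (maximal_set N c) \<le> ennreal (15 * measure N UNIV / c)"
      by (rule maximal_set_weak_type[OF fN sN c])
    also have "\<dots> \<le> ennreal e"
      using K(3) c by (intro ennreal_leI) (simp add: mN field_simps)
    finally have small: "emeasure arc_measure (maximal_set N c) \<le> ennreal e" .
    show "\<exists>B\<in>sets arc_measure. emeasure arc_measure B \<le> ennreal e \<and> (\<forall>\<zeta>\<in>space arc_measure - B.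
        cmod \<zeta> = 1 \<longrightarrow> \<zeta> \<in> A \<longrightarrow> eventually (\<lambda>r. poisson_int M r \<zeta> \<le> d) (at_left 1))"
    proof (intro bexI[of _ "maximal_set N c"] conjI small ballI impI)
      show "maximal_set N c \<in> sets arc_measure" using open_maximal_set[OF fN sN c] by simp
      fix \<zeta> assume "\<zeta> \<in> space arc_measure - maximal_set N c" and \<zeta>: "cmod \<zeta> = 1" "\<zeta> \<in> A"
      then have nmax: "\<zeta> \<notin> maximal_set N c" by simp
      have "\<zeta> \<notin> K" using K(2) \<zeta> by auto
      then obtain d0 where d0: "d0 > 0" "\<And>\<xi>. \<xi> \<in> K \<Longrightarrow> d0 \<le> dist \<zeta> \<xi>"
        using separate_point_closed[OF compact_imp_closed[OF K(1)]] by blast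
      define m where "m = measure M UNIV"
      have bound: "poisson_int M r \<zeta> \<le> 8 * (1 - r) / d0\<^sup>2 * m + d / 2" if r: "0 < r" "r < 1" for r
      proof -
        have r': "0 \<le> r" "r < 1" using r by auto
        let ?P = "\<lambda>\<xi>. ennreal (poisson (of_real r * \<zeta>) \<xi>)"
        have mP: "?P \<in> borel_measurable M" using meas_poisson by measurable
        have "ennreal (poisson_int M r \<zeta>) = (\<integral>\<^sup>+\<xi>. ?P \<xi> * indicator K \<xi> + indicator (- K) \<xi> * ?P \<xi> \<partial>M)"
          unfolding poisson_int_nn[OF \<zeta>(1) r', symmetric] by (intro nn_integral_cong) (auto simp: indicator_def)
        also have "\<dots> = (\<integral>\<^sup>+\<xi>. ?P \<xi> * indicator K \<xi> \<partial>M) + (\<integral>\<^sup>+\<xi>. indicator (- K) \<xi> * ?P \<xi> \<partial>M)"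
          using mP Kb by (intro nn_integral_add) auto
        also have "(\<integral>\<^sup>+\<xi>. indicator (- K) \<xi> * ?P \<xi> \<partial>M) = (\<integral>\<^sup>+\<xi>. ?P \<xi> \<partial>N)"
          unfolding N_def using mP Kb by (intro nn_integral_density[symmetric]) auto
        also have "\<dots> \<le> ennreal (64 * c)"
          by (rule poisson_maximal[OF fN sN spN c \<zeta>(1) nmax r'])
        also have "(\<integral>\<^sup>+\<xi>. ?P \<xi> * indicator K \<xi> \<partial>M) \<le> (\<integral>\<^sup>+\<xi>. ennreal (8 * (1 - r) / d0\<^sup>2) \<partial>M)"
        proof (rule nn_integral_mono_AE, use sphere_M in eventually_elim)
          fix \<xi> :: complex assume \<xi>: "cmod \<xi> = 1"
          show "?P \<xi> * indicator K \<xi> \<le> ennreal (8 * (1 - r) / d0\<^sup>2)"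
          proof (cases "\<xi> \<in> K")
            case True
            then have "\<xi> \<noteq> \<zeta>" using \<open>\<zeta> \<notin> K\<close> by auto
            have "poisson (of_real r * \<zeta>) \<xi> \<le> 8 * (1 - r) / (dist \<zeta> \<xi>)\<^sup>2"
              by (rule poisson_bounds(2)[OF \<zeta>(1) \<xi> r' \<open>\<xi> \<noteq> \<zeta>\<close>])
            also have "\<dots> \<le> 8 * (1 - r) / d0\<^sup>2"
              using d0(1) d0(2)[OF True] r by (intro divide_left_mono power_mono mult_pos_pos) auto
            finally show ?thesis using True by (simp add: ennreal_leI)
          qed simp
        qed
        also have "\<dots> = ennreal (8 * (1 - r) / d0\<^sup>2 * m)"
          unfolding nn_integral_const space_M emeasure_eq_measure m_def using r d0(1)
          by (intro ennreal_mult[symmetric]) auto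
        finally have "ennreal (poisson_int M r \<zeta>) \<le> ennreal (8 * (1 - r) / d0\<^sup>2 * m) + ennreal (64 * c)"
          by (simp add: add_mono)
        also have "\<dots> = ennreal (8 * (1 - r) / d0\<^sup>2 * m + d / 2)"
          using r d0(1) c by (subst ennreal_plus[symmetric]) (auto simp: c_def m_def)
        finally show ?thesis
          by (subst (asm) ennreal_le_iff) (use r d0(1) d in \<open>auto simp: m_def\<close>)
      qed
      have "((\<lambda>r. 8 * (1 - r) / d0\<^sup>2 * m + d / 2) \<longlongrightarrow> 8 * (1 - 1) / d0\<^sup>2 * m + d / 2) (at_left (1::real))"
        using d0(1) by (intro tendsto_intros) auto
      then have "eventually (\<lambda>r. 8 * (1 - r) / d0\<^sup>2 * m + d / 2 < d) (at_left (1::real))"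
        by (rule order_tendstoD(2)) (use d in simp)
      then show "eventually (\<lambda>r. poisson_int M r \<zeta> \<le> d) (at_left 1)"
        using eventually_radial by eventually_elim (use bound in force)
    qed
  qed
  have "AE \<zeta> in arc_measure. \<forall>n. cmod \<zeta> = 1 \<longrightarrow> \<zeta> \<in> A \<longrightarrow> eventually (\<lambda>r. poisson_int M r \<zeta> \<le> 1 / Suc n) (at_left 1)"
    by (intro AE_all_countable[THEN iffD2] allI step) simp
  then show ?thesis
    using AE_arc_sphere
  proof eventually_elim
    fix \<zeta> assume all: "\<forall>n. cmod \<zeta> = 1 \<longrightarrow> \<zeta> \<in> A \<longrightarrow> eventually (\<lambda>r. poisson_int M r \<zeta> \<le> 1 / Suc n) (at_left 1)"
      and \<zeta>: "cmod \<zeta> = 1"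
    show "\<zeta> \<in> A \<longrightarrow> ((\<lambda>r. poisson_int M r \<zeta>) \<longlongrightarrow> 0) (at_left 1)"
    proof
      assume "\<zeta> \<in> A"
      have "eventually (\<lambda>r. dist (poisson_int M r \<zeta>) 0 < e) (at_left 1)" if e: "e > 0" for e
      proof -
        obtain n where n: "inverse (real (Suc n)) < e" using reals_Archimedean[OF e] by blast
        have "eventually (\<lambda>r. poisson_int M r \<zeta> \<le> 1 / Suc n) (at_left 1)" using all \<zeta> \<open>\<zeta> \<in> A\<close> by blast
        then show ?thesis using eventually_radial
          by eventually_elim (use n poisson_int_nonneg[OF \<zeta>] in \<open>force simp: inverse_eq_divide\<close>)
      qed
      then show "((\<lambda>r. poisson_int M r \<zeta>) \<longlongrightarrow> 0) (at_left 1)" by (intro tendstoI)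
    qed
  qed
qed

end

section \<open>Radial limits of Poisson integrals of measures\<close>

lemma inner_regular_compl:
  fixes M :: "'a::{second_countable_topology, complete_space} measure"
  assumes M: "finite_measure M" "sets M = sets borel" and B: "B \<in> sets borel" "emeasure M (- B) = 0"
    and e: "e > 0"
  obtains K where "compact K" "K \<subseteq> B" "measure M (- K) \<le> e"
proof -
  interpret finite_measure M by fact
  have sp: "space M = UNIV" using sets_eq_imp_space_eq[OF M(2)] by simp
  have nt: "emeasure M (space M) \<noteq> \<infinity>" by simp
  have sup: "emeasure M B = (SUP K \<in> {K. K \<subseteq> B \<and> compact K}. emeasure M K)"
    by (rule inner_regular[OF M(2) nt B(1)])
  have K0: "\<exists>K. K \<subseteq> B \<and> compact K \<and> measure M B - e < measure M K"
  \<comment> \<open>If the target is negative, the empty set does; otherwise the comparison can be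
    carried out in \<open>ennreal\<close>.\<close>
  proof (cases "measure M B - e < 0")
    case True
    then show ?thesis by (intro exI[of _ "{}"]) auto
  next
    case False
    have "ennreal (measure M B - e) < emeasure M B"
      using e False by (simp add: emeasure_eq_measure ennreal_less_iff)
    then have "\<exists>K\<in>{K. K \<subseteq> B \<and> compact K}. ennreal (measure M B - e) < emeasure M K"
      unfolding sup by (subst (asm) less_SUP_iff)
    then show ?thesis using False by (auto simp: emeasure_eq_measure ennreal_less_iff)
  qed
  then obtain K where K: "K \<subseteq> B" "compact K" "measure M B - e < measure M K" by blast
  have Kb: "K \<in> sets M" "B \<in> sets M" using borel_compact[OF K(2)] B(1) M(2) by auto
  have "measure M (- K) = measure M UNIV - measure M K"
    using finite_measure_compl[OF Kb(1)] sp by (simp add: Compl_eq_Diff_UNIV)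
  also have "measure M UNIV = measure M B + measure M (- B)"
    using finite_measure_compl[OF Kb(2)] sp by (simp add: Compl_eq_Diff_UNIV)
  also have "measure M (- B) = 0" using B(2) by (simp add: measure_def)
  finally show ?thesis using that K by simp
qed

text \<open>This is \<open>cis_close\<close> at radius 0.\<close>

lemma cis_inj_on: "inj_on cis {0..<2*pi}"
proof (rule inj_onI)
  fix a b assume ab: "a \<in> {0..<2*pi}" "b \<in> {0..<2*pi}" "cis a = cis b"
  then have "\<bar>a - b\<bar> \<le> 0 \<or> \<bar>a - b\<bar> \<ge> 2 * pi" using cis_close[OF ab(1,2), of 0] by simp
  then show "a = b" using ab(1,2) by auto
qed

text \<open>The measure with density \<open>g\<close> is carried by the image of {g > 0}, and
  compact pieces of that image miss the image of {g = 0} because \<open>cis\<close> is injective on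
  the half-open interval.\<close>

lemma poisson_density_limit_0:
  assumes g: "g \<in> borel_measurable borel" "integrable dtheta g" and g0: "\<And>\<theta>. 0 \<le> g \<theta>"
  shows "AE \<theta> in dtheta. g \<theta> = 0 \<longrightarrow>
     ((\<lambda>r. LINT \<phi>|dtheta. g \<phi> * poisson (of_real r * cis \<theta>) (cis \<phi>)) \<longlongrightarrow> 0) (at_left 1)"
proof -
  note [measurable] = g(1)
  define D where "D = density dtheta (\<lambda>\<theta>. ennreal (g \<theta>))"
  define M where "M = distr D borel cis"
  have sD: "sets D = sets borel" by (simp add: D_def)
  have cD: "cis \<in> measurable D borel" using measurable_cong_sets[OF sD refl] measurable_cis by blast
  have fD: "finite_measure D"
  proof
    have "emeasure D (space D) = ennreal (LINT \<theta>|dtheta. g \<theta>)"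
      unfolding D_def using g g0 by (simp add: emeasure_density nn_integral_eq_integral)
    then show "emeasure D (space D) \<noteq> \<infinity>" by simp
  qed
  interpret D: finite_measure D by fact
  interpret circle_finite_measure M
  proof (intro circle_finite_measure.intro circle_finite_measure_axioms.intro)
    show "finite_measure M" unfolding M_def using D.finite_measure_distr[OF cD] .
    show "sets M = sets borel" by (simp add: M_def)
    show "AE \<xi> in M. cmod \<xi> = 1" unfolding M_def using cD by (subst AE_distr_iff) auto
  qed
  define B where "B = {0..<2*pi} \<inter> {\<theta>. g \<theta> > 0}"
  have Bb: "B \<in> sets borel" unfolding B_def by measurable
  have "emeasure D (- B) = (\<integral>\<^sup>+\<theta>. ennreal (g \<theta>) * indicator (- B) \<theta> \<partial>dtheta)"
    unfolding D_def using Bb by (intro emeasure_density) auto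
  also have "\<dots> = (\<integral>\<^sup>+\<theta>. 0 \<partial>dtheta)"
    by (rule nn_integral_cong_AE, use AE_dtheta_range in eventually_elim)
       (use g0 in \<open>auto simp: B_def indicator_def not_less intro: antisym\<close>)
  finally have D0: "emeasure D (- B) = 0" by simp
  have "AE \<zeta> in arc_measure. \<zeta> \<in> cis ` {\<theta>\<in>{0..<2*pi}. g \<theta> = 0} \<longrightarrow> ((\<lambda>r. poisson_int M r \<zeta>) \<longlongrightarrow> 0) (at_left 1)"
  proof (rule poisson_limit_0)
    fix e :: real assume "e > 0"
    then obtain K where K: "compact K" "K \<subseteq> B" "measure D (- K) \<le> e"
      using inner_regular_compl[OF fD sD Bb D0] by blast
    show "\<exists>K. compact K \<and> K \<inter> cis ` {\<theta> \<in> {0..<2 * pi}. g \<theta> = 0} = {} \<and> measure M (- K) \<le> e"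
    proof (intro exI[of _ "cis ` K"] conjI)
      show cK: "compact (cis ` K)" by (intro compact_continuous_image continuous_intros K)
      show "cis ` K \<inter> cis ` {\<theta> \<in> {0..<2 * pi}. g \<theta> = 0} = {}"
      proof (rule ccontr)
        assume "cis ` K \<inter> cis ` {\<theta> \<in> {0..<2 * pi}. g \<theta> = 0} \<noteq> {}"
        then obtain a b where ab: "a \<in> K" "b \<in> {0..<2*pi}" "g b = 0" "cis a = cis b" by auto
        then have "a = b" using inj_onD[OF cis_inj_on ab(4)] K(2) by (auto simp: B_def)
        then show False using ab K(2) by (auto simp: B_def)
      qed
      have "- (cis ` K) \<in> sets borel" by (intro borel_comp borel_compact cK)
      then have "measure M (- (cis ` K)) = measure D (cis -` (- (cis ` K)) \<inter> space D)"
        unfolding M_def using cD by (intro measure_distr) auto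
      also have "\<dots> \<le> measure D (- K)"
        using borel_compact[OF K(1)] sD by (intro D.finite_measure_mono) (auto intro!: borel_comp)
      finally show "measure M (- (cis ` K)) \<le> e" using K(3) by simp
    qed
  qed
  then have "AE \<theta> in dtheta. cis \<theta> \<in> cis ` {\<theta>\<in>{0..<2*pi}. g \<theta> = 0} \<longrightarrow> ((\<lambda>r. poisson_int M r (cis \<theta>)) \<longlongrightarrow> 0) (at_left 1)"
    by (rule AE_arcD)
  moreover have "poisson_int M r \<zeta> = (LINT \<phi>|dtheta. g \<phi> * poisson (of_real r * \<zeta>) (cis \<phi>))" for r \<zeta>
  proof -
    have "poisson_int M r \<zeta> = (LINT \<phi>|D. poisson (of_real r * \<zeta>) (cis \<phi>))"
      unfolding poisson_int_def M_def using cD by (intro integral_distr) auto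
    also have "\<dots> = (LINT \<phi>|dtheta. g \<phi> *\<^sub>R poisson (of_real r * \<zeta>) (cis \<phi>))"
      unfolding D_def using g0 by (intro integral_density) auto
    finally show ?thesis by simp
  qed
  ultimately show ?thesis
    using AE_dtheta_range by (auto elim: eventually_elim2)
qed

lemma nn_integral_decomposition:
  assumes sM: "sets M = sets borel" and s\<nu>: "sets \<nu> = sets borel"
    and w: "w \<in> borel_measurable borel"
    and eq: "\<And>A. A \<in> sets borel \<Longrightarrow>
       emeasure M A = (\<integral>\<^sup>+\<theta>. ennreal (w \<theta>) * indicator A (cis \<theta>) \<partial>dtheta) + emeasure \<nu> A"
    and g: "g \<in> borel_measurable borel"
  shows "(\<integral>\<^sup>+\<xi>. g \<xi> \<partial>M) = (\<integral>\<^sup>+\<theta>. ennreal (w \<theta>) * g (cis \<theta>) \<partial>dtheta) + (\<integral>\<^sup>+\<xi>. g \<xi> \<partial>\<nu>)"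
  using g
proof (induction rule: borel_measurable_induct)
  case (cong f g)
  then show ?case by simp
next
  case (set A)
  then show ?case using eq[of A] sM s\<nu> by simp
next
  case (mult u c)
  note [measurable_cong] = sM s\<nu>
  note [measurable] = mult(1,2) w
  show ?case
    using mult by (simp add: nn_integral_cmult distrib_left mult.left_commute)
next
  case (add u v)
  note [measurable_cong] = sM s\<nu>
  note [measurable] = add(1,4) w
  show ?case
    using add by (simp add: nn_integral_add distrib_left add_ac)
next
  case (seq U)
  note [measurable_cong] = sM s\<nu>
  have [measurable]: "U i \<in> borel_measurable borel" for i using seq by auto
  note [measurable] = w
  have inc: "incseq U" using seq by auto
  have inc2: "incseq (\<lambda>i \<theta>. ennreal (w \<theta>) * U i (cis \<theta>))"
    using inc by (auto simp: incseq_def le_fun_def intro!: mult_left_mono)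
  have "(\<integral>\<^sup>+\<xi>. (SUP i. U i \<xi>) \<partial>M) = (SUP i. \<integral>\<^sup>+\<xi>. U i \<xi> \<partial>M)"
    by (intro nn_integral_monotone_convergence_SUP inc) measurable
  also have "\<dots> = (SUP i. (\<integral>\<^sup>+\<theta>. ennreal (w \<theta>) * U i (cis \<theta>) \<partial>dtheta) + (\<integral>\<^sup>+\<xi>. U i \<xi> \<partial>\<nu>))"
    using seq by simp
  also have "\<dots> = (SUP i. \<integral>\<^sup>+\<theta>. ennreal (w \<theta>) * U i (cis \<theta>) \<partial>dtheta) + (SUP i. \<integral>\<^sup>+\<xi>. U i \<xi> \<partial>\<nu>)"
    using inc inc2 by (intro ennreal_SUP_add)
      (auto simp: incseq_def le_fun_def intro!: nn_integral_mono)
  also have "(SUP i. \<integral>\<^sup>+\<xi>. U i \<xi> \<partial>\<nu>) = (\<integral>\<^sup>+\<xi>. (SUP i. U i \<xi>) \<partial>\<nu>)"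
    by (intro nn_integral_monotone_convergence_SUP[symmetric] inc) measurable
  also have "(SUP i. \<integral>\<^sup>+\<theta>. ennreal (w \<theta>) * U i (cis \<theta>) \<partial>dtheta) = (\<integral>\<^sup>+\<theta>. (SUP i. ennreal (w \<theta>) * U i (cis \<theta>)) \<partial>dtheta)"
    by (intro nn_integral_monotone_convergence_SUP[symmetric] inc2) measurable
  finally show ?case by (simp add: SUP_mult_left_ennreal image_comp)
qed

text \<open>Neither part exceeds \<open>M\<close>, so finiteness and concentration on the circle
  pass to both; the extended identity for Poisson integrals then becomes one between real
  numbers.\<close>

lemma integral_decomposition_poisson:
  assumes M: "circle_finite_measure M" and s\<nu>: "sets \<nu> = sets borel"
    and w: "w \<in> borel_measurable borel" "\<And>\<theta>. 0 \<le> w \<theta>"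
    and eq: "\<And>A. A \<in> sets borel \<Longrightarrow>
       emeasure M A = (\<integral>\<^sup>+\<theta>. ennreal (w \<theta>) * indicator A (cis \<theta>) \<partial>dtheta) + emeasure \<nu> A"
  shows "circle_finite_measure \<nu>" and "integrable dtheta w"
    and "\<And>r \<zeta>. cmod \<zeta> = 1 \<Longrightarrow> 0 \<le> r \<Longrightarrow> r < 1 \<Longrightarrow>
      poisson_int M r \<zeta> = (LINT \<phi>|dtheta. w \<phi> * poisson (of_real r * \<zeta>) (cis \<phi>)) + poisson_int \<nu> r \<zeta>"
proof -
  interpret circle_finite_measure M by fact
  note [measurable] = w(1)
  have sp\<nu>: "space \<nu> = UNIV" using sets_eq_imp_space_eq[OF s\<nu>] by simp
  have U: "emeasure M UNIV = (\<integral>\<^sup>+\<theta>. ennreal (w \<theta>) \<partial>dtheta) + emeasure \<nu> UNIV"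
    using eq[of UNIV] by simp
  then have fin: "(\<integral>\<^sup>+\<theta>. ennreal (w \<theta>) \<partial>dtheta) < \<infinity>" "emeasure \<nu> UNIV < \<infinity>"
    using emeasure_finite[of UNIV] by (auto simp: less_top)
  have sph: "- sphere 0 (1::real) \<in> sets (borel :: complex measure)" by (intro borel_comp borel_closed) auto
  have "emeasure M (- sphere 0 1) = 0"
    using sphere_M sph sets_M by (subst AE_iff_measurable[symmetric, where P = "\<lambda>\<xi>. cmod \<xi> = 1"]) (auto simp: space_M)
  then have "emeasure \<nu> (- sphere 0 1) = 0" using eq[OF sph] by simp
  then have "AE \<xi> in \<nu>. cmod \<xi> = 1"
    using sph s\<nu> by (intro AE_I[of _ _ "- sphere 0 1"]) auto
  then show \<nu>: "circle_finite_measure \<nu>"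
    using fin(2) s\<nu> by (intro circle_finite_measure.intro circle_finite_measure_axioms.intro finite_measureI) (auto simp: sp\<nu>)
  interpret \<nu>: circle_finite_measure \<nu> by (rule \<nu>)
  show int: "integrable dtheta w"
    using fin(1) w by (intro integrableI_nonneg) auto
  fix r :: real and \<zeta> :: complex assume \<zeta>: "cmod \<zeta> = 1" and r: "0 \<le> r" "r < 1"
  let ?P = "poisson (of_real r * \<zeta>)"
  have P0: "0 \<le> ?P \<xi>" for \<xi> by (rule poisson_nonneg[OF norm_lt[OF \<zeta> r]])
  have P: "?P (cis \<phi>) \<le> 2 / (1 - r)" for \<phi> by (rule poisson_bounds(1)[OF \<zeta> _ r]) simp
  have intwP: "integrable dtheta (\<lambda>\<phi>. w \<phi> * ?P (cis \<phi>))"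
  proof (rule Bochner_Integration.integrable_bound)
    show "integrable dtheta (\<lambda>\<phi>. w \<phi> * (2 / (1 - r)))" using int by (rule integrable_mult_left)
    show "AE \<phi> in dtheta. norm (w \<phi> * ?P (cis \<phi>)) \<le> norm (w \<phi> * (2 / (1 - r)))"
    proof (intro AE_I2)
      fix \<phi>
      have "w \<phi> * ?P (cis \<phi>) \<le> w \<phi> * (2 / (1 - r))" by (intro mult_left_mono P w)
      then show "norm (w \<phi> * ?P (cis \<phi>)) \<le> norm (w \<phi> * (2 / (1 - r)))"
        using P0[of "cis \<phi>"] w(2)[of \<phi>] r by (simp add: abs_mult)
    qed
  qed measurable
  have "ennreal (poisson_int M r \<zeta>) = (\<integral>\<^sup>+\<phi>. ennreal (w \<phi>) * ennreal (?P (cis \<phi>)) \<partial>dtheta) + ennreal (poisson_int \<nu> r \<zeta>)"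
    unfolding poisson_int_nn[OF \<zeta> r, symmetric] \<nu>.poisson_int_nn[OF \<zeta> r, symmetric]
    by (rule nn_integral_decomposition[OF sets_M s\<nu> w(1)], erule eq, measurable)
  also have "(\<integral>\<^sup>+\<phi>. ennreal (w \<phi>) * ennreal (?P (cis \<phi>)) \<partial>dtheta) = (\<integral>\<^sup>+\<phi>. ennreal (w \<phi> * ?P (cis \<phi>)) \<partial>dtheta)"
    using w P0 by (simp add: ennreal_mult)
  also have "\<dots> = ennreal (LINT \<phi>|dtheta. w \<phi> * ?P (cis \<phi>))"
    using intwP w P0 by (intro nn_integral_eq_integral) auto
  also have "\<dots> + ennreal (poisson_int \<nu> r \<zeta>) = ennreal ((LINT \<phi>|dtheta. w \<phi> * ?P (cis \<phi>)) + poisson_int \<nu> r \<zeta>)"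
    using w P0 \<nu>.poisson_int_nonneg[OF \<zeta> r] by (intro ennreal_plus[symmetric] Bochner_Integration.integral_nonneg) auto
  finally show "poisson_int M r \<zeta> = (LINT \<phi>|dtheta. w \<phi> * ?P (cis \<phi>)) + poisson_int \<nu> r \<zeta>"
    using w P0 poisson_int_nonneg[OF \<zeta> r] \<nu>.poisson_int_nonneg[OF \<zeta> r]
    by (subst (asm) ennreal_inj) (auto intro!: add_nonneg_nonneg Bochner_Integration.integral_nonneg)
qed

text \<open>Cutting the density at rational levels \<open>q\<close> reduces the absolutely continuous part to
  \<open>poisson_density_limit_0\<close>, since the excess $(w-q)^+$ vanishes where $w \<le> q$.\<close>

lemma fatou_measure:
  assumes M: "circle_finite_measure M" and s\<nu>: "sets \<nu> = sets borel"
    and w: "w \<in> borel_measurable borel" "\<And>\<theta>. 0 \<le> w \<theta>"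
    and eq: "\<And>A. A \<in> sets borel \<Longrightarrow>
       emeasure M A = (\<integral>\<^sup>+\<theta>. ennreal (w \<theta>) * indicator A (cis \<theta>) \<partial>dtheta) + emeasure \<nu> A"
    and N: "N \<in> sets borel" "emeasure \<nu> (- N) = 0" "emeasure arc_measure N = 0"
  shows "AE \<theta> in dtheta. ((\<lambda>r. poisson_int M r (cis \<theta>)) \<longlongrightarrow> w \<theta>) (at_left 1)"
proof -
  note dec = integral_decomposition_poisson[OF M s\<nu> w eq]
  interpret \<nu>: circle_finite_measure \<nu> by (rule dec(1))
  note [measurable] = w(1)
  have "AE \<zeta> in arc_measure. \<zeta> \<in> - N \<longrightarrow> ((\<lambda>r. poisson_int \<nu> r \<zeta>) \<longlongrightarrow> 0) (at_left 1)"
  proof (rule \<nu>.poisson_limit_0)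
    fix e :: real assume "e > 0"
    then obtain K where "compact K" "K \<subseteq> N" "measure \<nu> (- K) \<le> e"
      using inner_regular_compl[OF \<nu>.finite_measure_axioms s\<nu> N(1,2)] by blast
    then show "\<exists>K. compact K \<and> K \<inter> - N = {} \<and> measure \<nu> (- K) \<le> e" by blast
  qed
  moreover have "AE \<zeta> in arc_measure. \<zeta> \<in> - N"
    using N by (intro AE_I[of _ _ N]) auto
  ultimately have "AE \<zeta> in arc_measure. ((\<lambda>r. poisson_int \<nu> r \<zeta>) \<longlongrightarrow> 0) (at_left 1)"
    by eventually_elim auto
  then have ae1: "AE \<theta> in dtheta. ((\<lambda>r. poisson_int \<nu> r (cis \<theta>)) \<longlongrightarrow> 0) (at_left 1)"
    by (rule AE_arcD)
  \<comment> \<open>The density is q plus its excess over q minus its deficit below q, and the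
    Poisson kernel reproduces the constant q.\<close>
  define p where "p q r \<zeta> = (LINT \<phi>|dtheta. max 0 (w \<phi> - q) * poisson (of_real r * \<zeta>) (cis \<phi>))" for q r \<zeta>
  define m where "m q r \<zeta> = (LINT \<phi>|dtheta. max 0 (q - w \<phi>) * poisson (of_real r * \<zeta>) (cis \<phi>))" for q r \<zeta>
  have ip: "integrable dtheta (\<lambda>\<phi>. max 0 (w \<phi> - q))" and im: "integrable dtheta (\<lambda>\<phi>. max 0 (q - w \<phi>))" for q
    using dec(2) by (auto intro!: Bochner_Integration.integrable_max Bochner_Integration.integrable_diff)
  have "AE \<theta> in dtheta. max 0 (w \<theta> - q) = 0 \<longrightarrow> ((\<lambda>r. p q r (cis \<theta>)) \<longlongrightarrow> 0) (at_left 1)" for q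
    unfolding p_def by (rule poisson_density_limit_0[OF _ ip]) auto
  then have ae2: "AE \<theta> in dtheta. \<forall>q\<in>\<rat>. max 0 (w \<theta> - q) = 0 \<longrightarrow> ((\<lambda>r. p q r (cis \<theta>)) \<longlongrightarrow> 0) (at_left 1)"
    by (intro AE_ball_countable[THEN iffD2] countable_rat ballI)
  have "AE \<theta> in dtheta. max 0 (q - w \<theta>) = 0 \<longrightarrow> ((\<lambda>r. m q r (cis \<theta>)) \<longlongrightarrow> 0) (at_left 1)" for q
    unfolding m_def by (rule poisson_density_limit_0[OF _ im]) auto
  then have ae3: "AE \<theta> in dtheta. \<forall>q\<in>\<rat>. max 0 (q - w \<theta>) = 0 \<longrightarrow> ((\<lambda>r. m q r (cis \<theta>)) \<longlongrightarrow> 0) (at_left 1)"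
    by (intro AE_ball_countable[THEN iffD2] countable_rat ballI)
  have split: "poisson_int M r \<zeta> = q + p q r \<zeta> - m q r \<zeta> + poisson_int \<nu> r \<zeta>" and pm0: "0 \<le> p q r \<zeta>" "0 \<le> m q r \<zeta>"
    if \<zeta>: "cmod \<zeta> = 1" and r: "0 \<le> r" "r < 1" for q r \<zeta>
  proof -
    let ?P = "\<lambda>\<phi>. poisson (of_real r * \<zeta>) (cis \<phi>)"
    have lt: "cmod (of_real r * \<zeta>) < 1" by (rule \<nu>.norm_lt[OF that])
    have P0: "0 \<le> ?P \<phi>" for \<phi> by (rule poisson_nonneg[OF lt])
    have P: "?P \<phi> \<le> 2 / (1 - r)" for \<phi> by (rule poisson_bounds(1)[OF \<zeta> _ r]) simp
    have intP: "integrable dtheta (\<lambda>\<phi>. g \<phi> * ?P \<phi>)" if g: "integrable dtheta g" for g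
    proof (rule Bochner_Integration.integrable_bound)
      show "integrable dtheta (\<lambda>\<phi>. g \<phi> * (2 / (1 - r)))" using g by (rule integrable_mult_left)
      show "AE \<phi> in dtheta. norm (g \<phi> * ?P \<phi>) \<le> norm (g \<phi> * (2 / (1 - r)))"
      proof (intro AE_I2)
        fix \<phi>
        have "\<bar>g \<phi>\<bar> * ?P \<phi> \<le> \<bar>g \<phi>\<bar> * (2 / (1 - r))" by (intro mult_left_mono P) auto
        then show "norm (g \<phi> * ?P \<phi>) \<le> norm (g \<phi> * (2 / (1 - r)))"
          using P0[of \<phi>] r by (simp add: abs_mult)
      qed
      show "(\<lambda>\<phi>. g \<phi> * ?P \<phi>) \<in> borel_measurable dtheta"
        using borel_measurable_integrable[OF g] by measurable
    qed
    have "(LINT \<phi>|dtheta. w \<phi> * ?P \<phi>)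
      = (LINT \<phi>|dtheta. q * ?P \<phi> + max 0 (w \<phi> - q) * ?P \<phi> - max 0 (q - w \<phi>) * ?P \<phi>)"
      by (intro Bochner_Integration.integral_cong refl) (auto simp: max_def algebra_simps)
    also have "\<dots> = (LINT \<phi>|dtheta. q * ?P \<phi> + max 0 (w \<phi> - q) * ?P \<phi>) - (LINT \<phi>|dtheta. max 0 (q - w \<phi>) * ?P \<phi>)"
      by (intro Bochner_Integration.integral_diff Bochner_Integration.integrable_add intP ip im) auto
    also have "(LINT \<phi>|dtheta. q * ?P \<phi> + max 0 (w \<phi> - q) * ?P \<phi>)
      = (LINT \<phi>|dtheta. q * ?P \<phi>) + (LINT \<phi>|dtheta. max 0 (w \<phi> - q) * ?P \<phi>)"
      by (intro Bochner_Integration.integral_add intP ip) auto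
    also have "(LINT \<phi>|dtheta. q * ?P \<phi>) = q"
      using poisson_integral_1[OF lt] by simp
    finally show "poisson_int M r \<zeta> = q + p q r \<zeta> - m q r \<zeta> + poisson_int \<nu> r \<zeta>"
      using integral_decomposition_poisson(3)[OF M s\<nu> w eq \<zeta> r] by (simp add: p_def m_def)
    show "0 \<le> p q r \<zeta>" "0 \<le> m q r \<zeta>"
      unfolding p_def m_def using P0 by (auto intro!: Bochner_Integration.integral_nonneg)
  qed
  from ae1 ae2 ae3 show ?thesis
  proof eventually_elim
    fix \<theta>
    assume l\<nu>: "((\<lambda>r. poisson_int \<nu> r (cis \<theta>)) \<longlongrightarrow> 0) (at_left 1)"
      and lp: "\<forall>q\<in>\<rat>. max 0 (w \<theta> - q) = 0 \<longrightarrow> ((\<lambda>r. p q r (cis \<theta>)) \<longlongrightarrow> 0) (at_left 1)"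
      and lm: "\<forall>q\<in>\<rat>. max 0 (q - w \<theta>) = 0 \<longrightarrow> ((\<lambda>r. m q r (cis \<theta>)) \<longlongrightarrow> 0) (at_left 1)"
    show "((\<lambda>r. poisson_int M r (cis \<theta>)) \<longlongrightarrow> w \<theta>) (at_left 1)"
    proof (rule order_tendstoI)
      fix a assume "a < w \<theta>"
      then obtain q where q: "q \<in> \<rat>" "a < q" "q < w \<theta>" using Rats_dense_in_real by blast
      \<comment> \<open>For the lower bound, \<open>p\<close> and the singular part are nonnegative
        and dropped, while \<open>m\<close> tends to 0 because q lies below
        \<open>w \<theta>\<close>. The upper bound exchanges the roles of \<open>p\<close> and
        \<open>m\<close>.\<close>
      have "((\<lambda>r. q - m q r (cis \<theta>)) \<longlongrightarrow> q - 0) (at_left 1)"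
        using lm q by (intro tendsto_intros) auto
      then have "eventually (\<lambda>r. a < q - m q r (cis \<theta>)) (at_left 1)"
        by (rule order_tendstoD) (use q in simp)
      then show "eventually (\<lambda>r. a < poisson_int M r (cis \<theta>)) (at_left 1)"
        using eventually_radial
      proof eventually_elim
        fix r assume h: "a < q - m q r (cis \<theta>)" and r: "0 < r \<and> r < 1"
        have "0 \<le> poisson_int \<nu> r (cis \<theta>)" using r by (intro \<nu>.poisson_int_nonneg) auto
        then show "a < poisson_int M r (cis \<theta>)"
          using split[of "cis \<theta>" r q] pm0(1)[of "cis \<theta>" r q] h r by simp
      qed
    next
      fix a assume "w \<theta> < a"
      then obtain q where q: "q \<in> \<rat>" "w \<theta> < q" "q < a" using Rats_dense_in_real by blast
      have "((\<lambda>r. q + p q r (cis \<theta>) + poisson_int \<nu> r (cis \<theta>)) \<longlongrightarrow> q + 0 + 0) (at_left 1)"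
        using lp q l\<nu> by (intro tendsto_intros) auto
      then have "eventually (\<lambda>r. q + p q r (cis \<theta>) + poisson_int \<nu> r (cis \<theta>) < a) (at_left 1)"
        by (rule order_tendstoD) (use q in simp)
      then show "eventually (\<lambda>r. poisson_int M r (cis \<theta>) < a) (at_left 1)"
        using eventually_radial
      proof eventually_elim
        fix r assume h: "q + p q r (cis \<theta>) + poisson_int \<nu> r (cis \<theta>) < a" and r: "0 < r \<and> r < 1"
        show "poisson_int M r (cis \<theta>) < a"
          using split[of "cis \<theta>" r q] pm0(2)[of "cis \<theta>" r q] h r by simp
      qed
    qed
  qed
qed

section \<open>Parseval on circles and square-summable Taylor coefficients\<close>

lemma cis_power_integral:
  "(LINT \<theta>|dtheta. cis \<theta> ^ n * cnj (cis \<theta> ^ m)) = (if n = m then 1 else 0)"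
proof -
  have ge: "(LINT \<theta>|dtheta. cis \<theta> ^ n * cnj (cis \<theta> ^ m)) = (if n = m then 1 else 0)" if "m \<le> n" for n m
  proof -
    have "cis \<theta> ^ n * cnj (cis \<theta> ^ m) = cis \<theta> ^ (n - m)" for \<theta>
    proof -
      have "cis \<theta> ^ n * cnj (cis \<theta> ^ m) = cis \<theta> ^ (n - m) * (cis \<theta> ^ m * cnj (cis \<theta> ^ m))"
        using that by (simp add: mult.assoc[symmetric] flip: power_add)
      also have "cis \<theta> ^ m * cnj (cis \<theta> ^ m) = 1"
        using complex_norm_square[of "cis \<theta> ^ m"] by (simp add: norm_power)
      finally show ?thesis by simp
    qed
    moreover have "(LINT \<theta>|dtheta. cis \<theta> ^ (n - m)) = 0 ^ (n - m)"
      by (rule mean_value_circle) (intro continuous_intros holomorphic_intros)+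
    ultimately show ?thesis using that by simp
  qed
  show ?thesis
  proof (cases "m \<le> n")
    case False
    have "(LINT \<theta>|dtheta. cis \<theta> ^ n * cnj (cis \<theta> ^ m)) = (LINT \<theta>|dtheta. cnj (cis \<theta> ^ m * cnj (cis \<theta> ^ n)))"
      by (intro Bochner_Integration.integral_cong refl) (simp add: mult.commute)
    also have "\<dots> = cnj (LINT \<theta>|dtheta. cis \<theta> ^ m * cnj (cis \<theta> ^ n))" by (rule Bochner_Integration.integral_cnj)
    finally show ?thesis using ge[of n m] False by simp
  qed (rule ge)
qed

lemma trig_poly_L2:
  assumes "finite S"
  shows "(LINT \<theta>|dtheta. (cmod (\<Sum>n\<in>S. c n * cis \<theta> ^ n))\<^sup>2) = (\<Sum>n\<in>S. (cmod (c n))\<^sup>2)"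
proof -
  have int: "integrable dtheta (\<lambda>\<theta>. c n * cnj (c m) * (cis \<theta> ^ n * cnj (cis \<theta> ^ m)))" for n m
    by (rule integrable_dtheta_cont[where f = "\<lambda>\<xi>. c n * cnj (c m) * (\<xi> ^ n * cnj (\<xi> ^ m))"])
       (intro continuous_intros)
  have "complex_of_real (LINT \<theta>|dtheta. (cmod (\<Sum>n\<in>S. c n * cis \<theta> ^ n))\<^sup>2)
     = (LINT \<theta>|dtheta. (\<Sum>n\<in>S. \<Sum>m\<in>S. c n * cnj (c m) * (cis \<theta> ^ n * cnj (cis \<theta> ^ m))))"
    unfolding integral_complex_of_real[symmetric] complex_norm_square
    by (intro Bochner_Integration.integral_cong refl) (simp add: sum_product mult_ac)
  also have "\<dots> = (\<Sum>n\<in>S. \<Sum>m\<in>S. (LINT \<theta>|dtheta. c n * cnj (c m) * (cis \<theta> ^ n * cnj (cis \<theta> ^ m))))"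
    using int by (subst Bochner_Integration.integral_sum, simp)+ simp
  also have "\<dots> = (\<Sum>n\<in>S. \<Sum>m\<in>S. c n * cnj (c m) * (if n = m then 1 else 0))"
    by (intro sum.cong refl) (simp only: integral_mult_right_zero cis_power_integral)
  also have "\<dots> = (\<Sum>n\<in>S. complex_of_real ((cmod (c n))\<^sup>2))"
    using assms by (intro sum.cong refl) (simp add: complex_norm_square if_distrib sum.delta del: of_real_power cong: if_cong)
  also have "\<dots> = complex_of_real (\<Sum>n\<in>S. (cmod (c n))\<^sup>2)" by (simp only: of_real_sum)
  finally show ?thesis using of_real_eq_iff by blast
qed

text \<open>Parseval for a Taylor tail on a circle of radius R < 1. As a limit of finite sums it
  serves both ways: to bound coefficients by a mean, and a mean by coefficients.\<close>

lemma L2_limit: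
  assumes sums: "\<And>z. cmod z < 1 \<Longrightarrow> (\<lambda>n. a n * z ^ n) sums h z" and R: "0 < R" "R < 1"
  shows "(\<lambda>M. \<Sum>n\<in>{N..<M}. (cmod (a n))\<^sup>2 * (R\<^sup>2) ^ n)
     \<longlonglongrightarrow> (LINT \<theta>|dtheta. (cmod (h (of_real R * cis \<theta>) - (\<Sum>n<N. a n * (of_real R * cis \<theta>) ^ n)))\<^sup>2)"
proof -
  define S where "S M \<theta> = (\<Sum>n\<in>{N..<M}. a n * (of_real R * cis \<theta>) ^ n)" for M \<theta>
  have eqS: "S M \<theta> = (\<Sum>n\<in>{N..<M}. (a n * of_real R ^ n) * cis \<theta> ^ n)" for M \<theta>
    by (simp add: S_def power_mult_distrib mult.assoc)
  have cont: "continuous_on A (\<lambda>\<xi>. \<Sum>n\<in>{N..<M}. a n * (of_real R * \<xi>) ^ n)" for A M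
    by (intro continuous_intros)
  have Sm: "S M \<in> borel_measurable dtheta" for M
    unfolding S_def using cont by (rule measurable_dtheta_cont)
  \<comment> \<open>A radius strictly between R and 1; convergence there gives absolute convergence
    at R.\<close>
  have r2: "cmod (of_real ((1 + R) / 2)) < 1" unfolding norm_of_real using R by simp
  have sumR: "summable (\<lambda>n. cmod (a n) * R ^ n)"
  proof -
    have "summable (\<lambda>n. a n * (of_real ((1 + R) / 2)) ^ n)" using sums[OF r2] by (rule sums_summable)
    then have "summable (\<lambda>n. norm (a n * (of_real R) ^ n))"
      by (rule powser_insidea) (unfold norm_of_real, use R in simp)
    then show ?thesis using R by (simp add: norm_mult norm_power)
  qed
  define B where "B = (\<Sum>n. cmod (a n) * R ^ n)"
  have SB: "cmod (S M \<theta>) \<le> B" for M \<theta>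
  proof -
    have "cmod (S M \<theta>) \<le> (\<Sum>n\<in>{N..<M}. cmod (a n) * R ^ n)"
      unfolding S_def using R by (intro sum_norm_le) (simp add: norm_mult norm_power)
    also have "\<dots> \<le> B" unfolding B_def using R by (intro sum_le_suminf sumR) auto
    finally show ?thesis .
  qed
  have lim: "(\<lambda>M. S M \<theta>) \<longlonglongrightarrow> h (of_real R * cis \<theta>) - (\<Sum>n<N. a n * (of_real R * cis \<theta>) ^ n)" for \<theta>
  proof -
    let ?t = "\<lambda>n. a n * (of_real R * cis \<theta>) ^ n"
    have "?t sums h (of_real R * cis \<theta>)" using R by (intro sums) (simp add: norm_mult)
    then have "(\<lambda>M. (\<Sum>n<M. ?t n) - (\<Sum>n<N. ?t n)) \<longlonglongrightarrow> h (of_real R * cis \<theta>) - (\<Sum>n<N. ?t n)"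
      unfolding sums_def by (intro tendsto_intros)
    then show ?thesis
    proof (rule Lim_transform_eventually)
      show "eventually (\<lambda>M. (\<Sum>n<M. ?t n) - (\<Sum>n<N. ?t n) = S M \<theta>) sequentially"
        using eventually_ge_at_top[of N]
      proof eventually_elim
        fix M assume "N \<le> M"
        then show "(\<Sum>n<M. ?t n) - (\<Sum>n<N. ?t n) = S M \<theta>"
          using sum_diff_nat_ivl[of 0 N M ?t] by (simp add: S_def lessThan_atLeast0)
      qed
    qed
  qed
  have "(\<lambda>M. LINT \<theta>|dtheta. (cmod (S M \<theta>))\<^sup>2)
     \<longlonglongrightarrow> (LINT \<theta>|dtheta. (cmod (h (of_real R * cis \<theta>) - (\<Sum>n<N. a n * (of_real R * cis \<theta>) ^ n)))\<^sup>2)"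
  proof (rule integral_dominated_convergence[where w = "\<lambda>_. B\<^sup>2"])
    show meas: "(\<lambda>\<theta>. (cmod (S M \<theta>))\<^sup>2) \<in> borel_measurable dtheta" for M
      using Sm[of M] by measurable
    show "(\<lambda>\<theta>. (cmod (h (of_real R * cis \<theta>) - (\<Sum>n<N. a n * (of_real R * cis \<theta>) ^ n)))\<^sup>2) \<in> borel_measurable dtheta"
      by (rule borel_measurable_LIMSEQ_real[where u = "\<lambda>M \<theta>. (cmod (S M \<theta>))\<^sup>2", OF _ meas]) (intro tendsto_intros lim)
    show "AE \<theta> in dtheta. (\<lambda>M. (cmod (S M \<theta>))\<^sup>2)
      \<longlonglongrightarrow> (cmod (h (of_real R * cis \<theta>) - (\<Sum>n<N. a n * (of_real R * cis \<theta>) ^ n)))\<^sup>2"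
      by (intro AE_I2 tendsto_intros lim)
    show "AE \<theta> in dtheta. norm ((cmod (S M \<theta>))\<^sup>2) \<le> B\<^sup>2" for M
      using SB by (intro AE_I2) (simp add: power_mono)
  qed auto
  moreover have "(LINT \<theta>|dtheta. (cmod (S M \<theta>))\<^sup>2) = (\<Sum>n\<in>{N..<M}. (cmod (a n))\<^sup>2 * (R\<^sup>2) ^ n)" for M
  proof -
    have "(R ^ n)\<^sup>2 = (R\<^sup>2) ^ n" for n by (metis power_mult mult.commute)
    then show ?thesis
      unfolding eqS using R by (subst trig_poly_L2) (simp_all add: norm_mult norm_power power_mult_distrib)
  qed
  ultimately show ?thesis by simp
qed

lemma bounded_coeffs_L2:
  assumes sums: "\<And>z. cmod z < 1 \<Longrightarrow> (\<lambda>n. a n * z ^ n) sums h z"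
    and bd: "\<And>z. cmod z < 1 \<Longrightarrow> cmod (h z) \<le> 1"
  shows "summable (\<lambda>n. (cmod (a n))\<^sup>2)"
proof -
  have R: "(\<Sum>n<M. (cmod (a n))\<^sup>2 * (R\<^sup>2) ^ n) \<le> 1" if R: "0 < R" "R < 1" for R M
  proof -
    let ?I = "LINT \<theta>|dtheta. (cmod (h (of_real R * cis \<theta>) - (\<Sum>n<0. a n * (of_real R * cis \<theta>) ^ n)))\<^sup>2"
    have "(\<lambda>M. \<Sum>n\<in>{0..<M}. (cmod (a n))\<^sup>2 * (R\<^sup>2) ^ n) \<longlonglongrightarrow> ?I"
      by (rule L2_limit[OF sums R])
    then have "(\<Sum>n<M. (cmod (a n))\<^sup>2 * (R\<^sup>2) ^ n) \<le> ?I"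
      by (intro LIMSEQ_le_const) (auto intro!: exI[of _ M] sum_mono2 simp: lessThan_atLeast0)
    also have "?I \<le> 1"
    \<comment> \<open>A non-integrable function has Bochner integral 0 by convention, so the bound
      holds in that case too.\<close>
    proof (cases "integrable dtheta (\<lambda>\<theta>. (cmod (h (of_real R * cis \<theta>) - (\<Sum>n<0. a n * (of_real R * cis \<theta>) ^ n)))\<^sup>2)")
      case True
      have "?I \<le> (LINT \<theta>|dtheta. 1)"
        using True R bd by (intro integral_mono) (auto simp: abs_square_le_1 norm_mult)
      then show ?thesis using dtheta.prob_space by simp
    qed (simp add: not_integrable_integral_eq)
    finally show ?thesis .
  qed
  have le: "(\<Sum>n<M. (cmod (a n))\<^sup>2) \<le> 1" for M
  proof (rule tendsto_upperbound)
    show "((\<lambda>R. \<Sum>n<M. (cmod (a n))\<^sup>2 * (R\<^sup>2) ^ n) \<longlongrightarrow> (\<Sum>n<M. (cmod (a n))\<^sup>2)) (at_left (1::real))"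
      by (auto intro!: tendsto_eq_intros)
    show "eventually (\<lambda>R. (\<Sum>n<M. (cmod (a n))\<^sup>2 * (R\<^sup>2) ^ n) \<le> 1) (at_left (1::real))"
      unfolding eventually_at_left_field using R by (intro exI[of _ 0]) auto
  qed simp
  show ?thesis
  proof (rule bounded_imp_summable)
    show "(\<Sum>k\<le>n. (cmod (a k))\<^sup>2) \<le> 1" for n
      using le[of "Suc n"] by (simp only: lessThan_Suc_atMost)
  qed simp
qed

section \<open>Dilations and maximal estimates for holomorphic functions\<close>

lemma dilate_disk_subset:
  fixes r :: real
  assumes "0 < r" "r < 1"
  shows "(\<lambda>z. complex_of_real r * z) ` cball 0 1 \<subseteq> ball 0 1"
proof (rule image_subsetI)
  fix z :: complex assume "z \<in> cball 0 1"
  then have "r * cmod z \<le> r * 1" using assms by (intro mult_left_mono) auto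
  then have "r * cmod z < 1" using assms by linarith
  then show "of_real r * z \<in> ball 0 1" using assms by (simp add: norm_mult)
qed

lemma dilate_continuous:
  fixes r :: real
  assumes "f holomorphic_on ball 0 1" "0 < r" "r < 1"
  shows "continuous_on (cball 0 1) (\<lambda>z. f (of_real r * z))"
  by (rule continuous_on_compose2[OF holomorphic_on_imp_continuous_on[OF assms(1)] _ dilate_disk_subset[OF assms(2,3)]])
     (intro continuous_intros)

lemma dilate_continuous_sphere:
  fixes r :: real
  assumes "f holomorphic_on ball 0 1" "0 < r" "r < 1"
  shows "continuous_on (sphere 0 1) (\<lambda>z. f (of_real r * z))"
  using dilate_continuous[OF assms] by (rule continuous_on_subset) auto

lemma dilate_holomorphic:
  fixes r :: real
  assumes "f holomorphic_on ball 0 1" "0 < r" "r < 1"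
  shows "(\<lambda>z. f (of_real r * z)) holomorphic_on ball 0 1"
proof (rule holomorphic_on_compose_gen[OF _ assms(1), of "\<lambda>z. of_real r * z", unfolded o_def])
  show "(\<lambda>z. complex_of_real r * z) ` ball 0 1 \<subseteq> ball 0 1"
    using dilate_disk_subset[OF assms(2,3)] ball_subset_cball by blast
qed (intro holomorphic_intros)

text \<open>By the Poisson formula on the circle of radius R, |k| inside is at most a Poisson
  integral of the measure with density |k| on that circle, whose mass is at most \<open>t\<close>;
  \<open>s / R\<close> is the relative radius. The maximal inequality does the rest.\<close>

lemma maximal_holomorphic:
  assumes k: "k holomorphic_on ball 0 1" and R: "0 < R" "R < 1" and c: "c > 0"
    and t: "(LINT \<theta>|dtheta. cmod (k (of_real R * cis \<theta>))) \<le> t"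
  shows "\<exists>G\<in>sets borel. emeasure arc_measure G \<le> ennreal (15 * t / c) \<and>
     (\<forall>\<zeta> s. cmod \<zeta> = 1 \<longrightarrow> \<zeta> \<notin> G \<longrightarrow> 0 \<le> s \<longrightarrow> s < R \<longrightarrow> cmod (k (of_real s * \<zeta>)) \<le> 64 * c)"
proof -
  define q where "q z = k (of_real R * z)" for z
  have qc: "continuous_on (cball 0 1) q" and qh: "q holomorphic_on ball 0 1"
    unfolding q_def by (rule dilate_continuous[OF k R] dilate_holomorphic[OF k R])+
  have qs: "continuous_on (sphere 0 1) q" by (rule continuous_on_subset[OF qc]) auto
  define D where "D = density dtheta (\<lambda>\<theta>. ennreal (cmod (q (cis \<theta>))))"
  define M where "M = distr D borel cis"
  have qm: "(\<lambda>\<theta>. cmod (q (cis \<theta>))) \<in> borel_measurable dtheta"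
    using measurable_dtheta_cont[OF qs] by measurable
  have qi: "integrable dtheta (\<lambda>\<theta>. cmod (q (cis \<theta>)))"
    using integrable_dtheta_cont[OF qs] by (rule integrable_norm)
  have sD: "sets D = sets borel" by (simp add: D_def)
  have cD: "cis \<in> measurable D borel" using measurable_cong_sets[OF sD refl] measurable_cis by blast
  have eD: "emeasure D (space D) = ennreal (LINT \<theta>|dtheta. cmod (q (cis \<theta>)))"
    unfolding D_def using qm qi by (simp add: emeasure_density nn_integral_eq_integral)
  have fD: "finite_measure D" by (rule finite_measureI) (simp add: eD)
  have M: "circle_finite_measure M"
  proof (intro circle_finite_measure.intro circle_finite_measure_axioms.intro)
    show "finite_measure M" unfolding M_def by (rule finite_measure.finite_measure_distr[OF fD cD])
    show "sets M = sets borel" by (simp add: M_def)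
    show "AE \<xi> in M. cmod \<xi> = 1" unfolding M_def using cD by (subst AE_distr_iff) auto
  qed
  interpret M: circle_finite_measure M by (rule M)
  have "emeasure M UNIV = ennreal (LINT \<theta>|dtheta. cmod (q (cis \<theta>)))"
    unfolding M_def using cD eD by (subst emeasure_distr) auto
  then have mM: "measure M UNIV \<le> t"
    using t by (simp add: measure_def q_def)
  show ?thesis
  proof (intro bexI[of _ "maximal_set M c"] conjI allI impI)
    show "maximal_set M c \<in> sets borel"
      using open_maximal_set[OF M.finite_measure_axioms M.sets_M c] by simp
    have "emeasure arc_measure (maximal_set M c) \<le> ennreal (15 * measure M UNIV / c)"
      by (rule maximal_set_weak_type[OF M.finite_measure_axioms M.sets_M c])
    also have "\<dots> \<le> ennreal (15 * t / c)"
      using mM c by (intro ennreal_leI divide_right_mono) auto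
    finally show "emeasure arc_measure (maximal_set M c) \<le> ennreal (15 * t / c)" .
    fix \<zeta> s assume \<zeta>: "cmod \<zeta> = 1" "\<zeta> \<notin> maximal_set M c" and s: "0 \<le> s" "s < R"
    define r where "r = s / R"
    have r: "0 \<le> r" "r < 1" using s R by (auto simp: r_def)
    let ?P = "\<lambda>\<theta>. poisson (of_real r * \<zeta>) (cis \<theta>)"
    have lt: "cmod (of_real r * \<zeta>) < 1" by (rule M.norm_lt[OF \<zeta>(1) r])
    have P0: "0 \<le> poisson (of_real r * \<zeta>) \<xi>" for \<xi> by (rule poisson_nonneg[OF lt])
    have Pm: "?P \<in> borel_measurable dtheta" by measurable
    have "ennreal (cmod (k (of_real s * \<zeta>))) = ennreal (cmod (q (of_real r * \<zeta>)))"
      using R by (simp add: q_def r_def mult.assoc[symmetric])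
    also have "q (of_real r * \<zeta>) = (LINT \<theta>|dtheta. complex_of_real (?P \<theta>) * q (cis \<theta>))"
      by (rule poisson_formula[OF qc qh lt, symmetric])
    also have "ennreal (cmod \<dots>) \<le> (\<integral>\<^sup>+\<theta>. ennreal (norm (complex_of_real (?P \<theta>) * q (cis \<theta>))) \<partial>dtheta)"
      by (rule integral_norm_bound_ennreal)
        (rule integrable_dtheta_cont[where f = "\<lambda>\<xi>. complex_of_real (poisson (of_real r * \<zeta>) \<xi>) * q \<xi>"],
         intro continuous_intros qs poisson_continuous lt)
    also have "\<dots> = (\<integral>\<^sup>+\<theta>. ennreal (cmod (q (cis \<theta>))) * ennreal (?P \<theta>) \<partial>dtheta)"
      using P0 by (intro nn_integral_cong) (simp add: norm_mult ennreal_mult mult.commute)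
    also have "\<dots> = (\<integral>\<^sup>+\<theta>. ennreal (?P \<theta>) \<partial>D)"
      unfolding D_def using qm Pm by (intro nn_integral_density[symmetric]) auto
    also have "\<dots> = (\<integral>\<^sup>+\<xi>. ennreal (poisson (of_real r * \<zeta>) \<xi>) \<partial>M)"
      unfolding M_def using cD by (intro nn_integral_distr[symmetric]) auto
    also have "\<dots> \<le> ennreal (64 * c)"
      by (rule poisson_maximal[OF M.finite_measure_axioms M.sets_M M.sphere_M c \<zeta> r])
    finally show "cmod (k (of_real s * \<zeta>)) \<le> 64 * c"
      using c by (subst (asm) ennreal_le_iff) auto
  qed
qed

text \<open>The exceptional sets obtained for different R need not be nested. The limit R -> 1 is
  therefore taken through the sets where the bound fails on [0, R), which increase with R.\<close>

lemma maximal_holomorphic_disk: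
  assumes k: "k holomorphic_on ball 0 1" and c: "c > 0"
    and t: "\<And>R. 0 < R \<Longrightarrow> R < 1 \<Longrightarrow> (LINT \<theta>|dtheta. cmod (k (of_real R * cis \<theta>))) \<le> t"
  defines "A \<equiv> {\<zeta>. cmod \<zeta> = 1 \<and> (\<exists>s. 0 \<le> s \<and> s < 1 \<and> cmod (k (of_real s * \<zeta>)) > 64 * c)}"
  shows "A \<in> sets borel" "emeasure arc_measure A \<le> ennreal (15 * t / c)"
proof -
  define AR where "AR R = {\<zeta>. cmod \<zeta> = 1 \<and> (\<exists>s. 0 \<le> s \<and> s < R \<and> cmod (k (of_real s * \<zeta>)) > 64 * c)}" for R
  have meas: "AR R \<in> sets borel" if "R \<le> 1" for R
  proof -
    \<comment> \<open>The union over s is uncountable; relative openness survives it, where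
      measurability of the single sets would not suffice.\<close>
    have "openin (top_of_set (sphere 0 1)) (sphere 0 1 \<inter> (\<lambda>\<zeta>. cmod (k (of_real s * \<zeta>))) -` {64 * c<..})"
      if s: "0 \<le> s" "s < R" for s
    proof (rule continuous_openin_preimage_gen)
      have "(\<lambda>\<zeta>. complex_of_real s * \<zeta>) ` sphere 0 1 \<subseteq> ball 0 1"
        using s \<open>R \<le> 1\<close> by (auto simp: norm_mult)
      then show "continuous_on (sphere 0 1) (\<lambda>\<zeta>. cmod (k (of_real s * \<zeta>)))"
        by (intro continuous_on_norm continuous_on_compose2[OF holomorphic_on_imp_continuous_on[OF k]] continuous_intros)
    qed auto
    then have "openin (top_of_set (sphere 0 1)) (\<Union>s\<in>{0..<R}. sphere 0 1 \<inter> (\<lambda>\<zeta>. cmod (k (of_real s * \<zeta>))) -` {64 * c<..})"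
      by (intro openin_Union) auto
    also have "(\<Union>s\<in>{0..<R}. sphere 0 1 \<inter> (\<lambda>\<zeta>. cmod (k (of_real s * \<zeta>))) -` {64 * c<..}) = AR R"
      by (auto simp: AR_def)
    finally obtain T where "open T" "AR R = sphere 0 1 \<inter> T" unfolding openin_open by blast
    then show ?thesis by (auto intro!: sets.Int borel_open borel_closed)
  qed
  have A1: "A = AR 1" by (simp add: A_def AR_def)
  show "A \<in> sets borel" unfolding A1 by (rule meas) simp
  define R where "R n = 1 - 1 / real (n + 2)" for n
  have R: "0 < R n" "R n < 1" for n by (auto simp: R_def)
  have le: "emeasure arc_measure (AR (R n)) \<le> ennreal (15 * t / c)" for n
  proof -
    obtain G where G: "G \<in> sets borel" "emeasure arc_measure G \<le> ennreal (15 * t / c)"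
      "\<forall>\<zeta> s. cmod \<zeta> = 1 \<longrightarrow> \<zeta> \<notin> G \<longrightarrow> 0 \<le> s \<longrightarrow> s < R n \<longrightarrow> cmod (k (of_real s * \<zeta>)) \<le> 64 * c"
      using maximal_holomorphic[OF k R c t[OF R]] by blast
    have "AR (R n) \<subseteq> G" using G(3) by (force simp: AR_def)
    then show ?thesis using G emeasure_mono[of "AR (R n)" G arc_measure] by (auto intro: order.trans)
  qed
  have inc: "incseq (\<lambda>n. AR (R n))"
  proof (rule incseq_SucI)
    fix n
    have "R n \<le> R (Suc n)" by (simp add: R_def field_simps)
    then show "AR (R n) \<subseteq> AR (R (Suc n))" by (force simp: AR_def)
  qed
  have "(\<Union>n. AR (R n)) = A"
  proof
    show "(\<Union>n. AR (R n)) \<subseteq> A" unfolding A1 AR_def using R by (auto intro: less_trans)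
    show "A \<subseteq> (\<Union>n. AR (R n))"
    proof
      fix \<zeta> assume "\<zeta> \<in> A"
      then obtain s where s: "cmod \<zeta> = 1" "0 \<le> s" "s < 1" "cmod (k (of_real s * \<zeta>)) > 64 * c"
        by (auto simp: A_def)
      obtain n where n: "inverse (real (Suc n)) < 1 - s" using reals_Archimedean[of "1 - s"] s by auto
      have "1 / real (n + 2) \<le> inverse (real (Suc n))" by (simp add: field_simps)
      then have "s < R n" using n by (simp add: R_def)
      then show "\<zeta> \<in> (\<Union>n. AR (R n))" using s by (auto simp: AR_def)
    qed
  qed
  moreover have "range (\<lambda>n. AR (R n)) \<subseteq> sets arc_measure" using meas R by (auto simp: less_imp_le)
  ultimately have "emeasure arc_measure A = (SUP n. emeasure arc_measure (AR (R n)))"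
    using SUP_emeasure_incseq[OF _ inc, of arc_measure] by simp
  also have "\<dots> \<le> ennreal (15 * t / c)" by (intro SUP_least le)
  finally show "emeasure arc_measure A \<le> ennreal (15 * t / c)" .
qed

text \<open>A fixed sequence that turns radial limits into sequential ones, as Fatou's lemma and
  dominated convergence require. The shift by 2 keeps every term positive.\<close>

definition radial_seq :: "nat \<Rightarrow> real" where
  "radial_seq n = 1 - 1 / real (n + 2)"

lemma radial_seq: "0 < radial_seq n" "radial_seq n < 1"
  by (simp_all add: radial_seq_def)

lemma radial_seq_tendsto: "radial_seq \<longlonglongrightarrow> 1"
proof -
  have "(\<lambda>n. 1 - 1 / real (n + 2)) \<longlonglongrightarrow> 1 - 0"
    by (intro tendsto_diff tendsto_const LIMSEQ_ignore_initial_segment[OF lim_1_over_n])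
  then show ?thesis by (simp add: radial_seq_def[abs_def])
qed

lemma radial_limit_seq:
  assumes "(f \<longlongrightarrow> l) (at_left (1::real))"
  shows "(\<lambda>n. f (radial_seq n)) \<longlonglongrightarrow> l"
proof (rule filterlim_compose[OF assms])
  show "filterlim radial_seq (at_left 1) sequentially"
    unfolding filterlim_at using radial_seq_tendsto radial_seq
    by (auto intro!: always_eventually simp: less_imp_neq)
qed

text \<open>The Taylor tail \<open>h - T N\<close> is small in mean uniformly in the radius, so off
  a set of small measure it is small along entire radii, while the polynomial \<open>T N\<close> is
  continuous up to the circle. Hence the radial oscillation of \<open>h\<close> at the boundary is
  almost everywhere below any given bound.\<close>

theorem fatou_bounded:
  assumes h: "h holomorphic_on ball 0 1" and bd: "\<And>z. cmod z < 1 \<Longrightarrow> cmod (h z) \<le> 1"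
  shows "AE \<theta> in dtheta. \<exists>l. ((\<lambda>r. h (of_real r * cis \<theta>)) \<longlongrightarrow> l) (at_left 1)"
proof -
  define a where "a n = (deriv ^^ n) h 0 / fact n" for n
  have sums: "(\<lambda>n. a n * z ^ n) sums h z" if "cmod z < 1" for z
    using holomorphic_power_series[OF h, of z] that by (simp add: a_def)
  have summ: "summable (\<lambda>n. (cmod (a n))\<^sup>2)" by (rule bounded_coeffs_L2[OF sums bd])
  define T where "T N z = (\<Sum>n<N. a n * z ^ n)" for N z
  have Th: "T N holomorphic_on A" for N A unfolding T_def by (intro holomorphic_intros)
  have small: "\<exists>N. \<forall>R. 0 < R \<longrightarrow> R < 1 \<longrightarrow> (LINT \<theta>|dtheta. cmod (h (of_real R * cis \<theta>) - T N (of_real R * cis \<theta>))) \<le> t"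
    if t: "t > 0" for t
  proof -
    have "eventually (\<lambda>N. dist (\<Sum>n. (cmod (a (n + N)))\<^sup>2) 0 < t\<^sup>2) sequentially"
      using suminf_exist_split[OF _ summ, of "t\<^sup>2"] t by (auto simp: eventually_sequentially dist_real_def)
    then obtain N where "\<bar>\<Sum>n. (cmod (a (n + N)))\<^sup>2\<bar> < t\<^sup>2" by (auto simp: eventually_sequentially)
    then have N: "(\<Sum>n. (cmod (a (n + N)))\<^sup>2) \<le> t\<^sup>2" by simp
    show ?thesis
    proof (intro exI[of _ N] allI impI)
      fix R :: real assume R: "0 < R" "R < 1"
      let ?k = "\<lambda>\<theta>. cmod (h (of_real R * cis \<theta>) - T N (of_real R * cis \<theta>))"
      have L: "(LINT \<theta>|dtheta. (?k \<theta>)\<^sup>2) \<le> t\<^sup>2"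
      proof (rule LIMSEQ_le_const2)
        show "(\<lambda>M. \<Sum>n\<in>{N..<M}. (cmod (a n))\<^sup>2 * (R\<^sup>2) ^ n) \<longlonglongrightarrow> (LINT \<theta>|dtheta. (?k \<theta>)\<^sup>2)"
          unfolding T_def by (rule L2_limit[OF sums R])
        have "(\<Sum>n\<in>{N..<M}. (cmod (a n))\<^sup>2 * (R\<^sup>2) ^ n) \<le> t\<^sup>2" if "N \<le> M" for M
        proof -
          have "(\<Sum>n\<in>{N..<M}. (cmod (a n))\<^sup>2 * (R\<^sup>2) ^ n) \<le> (\<Sum>n\<in>{N..<M}. (cmod (a n))\<^sup>2)"
            using R by (intro sum_mono mult_left_le power_le_one) (auto simp: power_le_one)
          also have "\<dots> = (\<Sum>n\<in>{..<M - N}. (cmod (a (n + N)))\<^sup>2)"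
            using that sum.shift_bounds_nat_ivl[of "\<lambda>n. (cmod (a n))\<^sup>2" 0 N "M - N"] by (simp add: lessThan_atLeast0)
          also have "\<dots> \<le> (\<Sum>n. (cmod (a (n + N)))\<^sup>2)"
            using summable_ignore_initial_segment[OF summ] by (intro sum_le_suminf) auto
          finally show ?thesis using N by simp
        qed
        then show "\<exists>K. \<forall>M\<ge>K. (\<Sum>n\<in>{N..<M}. (cmod (a n))\<^sup>2 * (R\<^sup>2) ^ n) \<le> t\<^sup>2" by blast
      qed
      have "(\<lambda>z. complex_of_real R * z) ` sphere 0 1 \<subseteq> ball 0 1" using R by (auto simp: norm_mult)
      then have c: "continuous_on (sphere 0 1) (\<lambda>\<xi>. h (of_real R * \<xi>) - T N (of_real R * \<xi>))"
      proof -
        assume sub: "(\<lambda>z. complex_of_real R * z) ` sphere 0 1 \<subseteq> ball 0 1"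
        have "continuous_on (ball 0 1) (\<lambda>z. h z - T N z)"
          by (intro continuous_on_diff holomorphic_on_imp_continuous_on h Th)
        then show ?thesis
          by (rule continuous_on_compose2[OF _ _ sub]) (intro continuous_intros)
      qed
      have i1: "integrable dtheta ?k"
        by (rule integrable_dtheta_cont[where f = "\<lambda>\<xi>. cmod (h (of_real R * \<xi>) - T N (of_real R * \<xi>))"])
           (intro continuous_intros c)
      have i2: "integrable dtheta (\<lambda>\<theta>. (?k \<theta>)\<^sup>2)"
        by (rule integrable_dtheta_cont[where f = "\<lambda>\<xi>. (cmod (h (of_real R * \<xi>) - T N (of_real R * \<xi>)))\<^sup>2"])
           (intro continuous_intros c)
      have "(LINT \<theta>|dtheta. ?k \<theta>) \<le> (LINT \<theta>|dtheta. t / 2 + (?k \<theta>)\<^sup>2 / (2 * t))"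
      proof (rule integral_mono[OF i1])
        show "integrable dtheta (\<lambda>\<theta>. t / 2 + (?k \<theta>)\<^sup>2 / (2 * t))" using i2 by simp
        fix \<theta>
        \<comment> \<open>This square replaces the Cauchy-Schwarz inequality: a mean square of at
          most t^2 yields a mean of at most t.\<close>
        have "0 \<le> (t - ?k \<theta>)\<^sup>2" by simp
        then have "2 * t * ?k \<theta> \<le> t\<^sup>2 + (?k \<theta>)\<^sup>2" by (simp add: power2_diff)
        then show "?k \<theta> \<le> t / 2 + (?k \<theta>)\<^sup>2 / (2 * t)" using t by (simp add: field_simps power2_eq_square)
      qed
      also have "\<dots> = t / 2 + (LINT \<theta>|dtheta. (?k \<theta>)\<^sup>2) / (2 * t)"
        using i2 dtheta.prob_space by simp
      also have "\<dots> \<le> t / 2 + t\<^sup>2 / (2 * t)"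
        using L t by (intro add_left_mono divide_right_mono) auto
      also have "\<dots> = t" using t by (simp add: power2_eq_square)
      finally show "(LINT \<theta>|dtheta. ?k \<theta>) \<le> t" .
    qed
  qed
  \<comment> \<open>129 = 64 + 1 + 64, for two tails and the polynomial between them.\<close>
  have osc: "AE \<zeta> in arc_measure. cmod \<zeta> = 1 \<longrightarrow>
     (\<exists>d<1. \<forall>r s. d < r \<longrightarrow> r < 1 \<longrightarrow> d < s \<longrightarrow> s < 1 \<longrightarrow> cmod (h (of_real r * \<zeta>) - h (of_real s * \<zeta>)) \<le> 129 * c)"
    if c: "c > 0" for c
  proof (rule AE_small_exceptional)
    fix e :: real assume e: "e > 0"
    define t where "t = e * c / 15"
    have t: "t > 0" using e c by (simp add: t_def)
    obtain N where N: "\<And>R. 0 < R \<Longrightarrow> R < 1 \<Longrightarrow>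
        (LINT \<theta>|dtheta. cmod (h (of_real R * cis \<theta>) - T N (of_real R * cis \<theta>))) \<le> t"
      using small[OF t] by blast
    define A where "A = {\<zeta>. cmod \<zeta> = 1 \<and> (\<exists>s. 0 \<le> s \<and> s < 1 \<and> cmod (h (of_real s * \<zeta>) - T N (of_real s * \<zeta>)) > 64 * c)}"
    have kh: "(\<lambda>z. h z - T N z) holomorphic_on ball 0 1" by (intro holomorphic_intros h Th)
    note A = maximal_holomorphic_disk[OF kh c N, folded A_def]
    show "\<exists>B\<in>sets arc_measure. emeasure arc_measure B \<le> ennreal e \<and> (\<forall>\<zeta>\<in>space arc_measure - B. cmod \<zeta> = 1 \<longrightarrow>
     (\<exists>d<1. \<forall>r s. d < r \<longrightarrow> r < 1 \<longrightarrow> d < s \<longrightarrow> s < 1 \<longrightarrow> cmod (h (of_real r * \<zeta>) - h (of_real s * \<zeta>)) \<le> 129 * c))"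
    proof (intro bexI[of _ A] conjI ballI impI)
      show "A \<in> sets arc_measure" using A(1) by simp
      show "emeasure arc_measure A \<le> ennreal e" using A(2) c by (simp add: t_def)
      fix \<zeta> assume "\<zeta> \<in> space arc_measure - A" and \<zeta>: "cmod \<zeta> = 1"
      then have k: "cmod (h (of_real s * \<zeta>) - T N (of_real s * \<zeta>)) \<le> 64 * c" if "0 \<le> s" "s < 1" for s
        using that by (auto simp: A_def not_less)
      have "((\<lambda>r. T N (of_real r * \<zeta>)) \<longlongrightarrow> T N (of_real 1 * \<zeta>)) (at_left 1)"
        unfolding T_def by (intro tendsto_intros)
      then have "eventually (\<lambda>r. dist (T N (of_real r * \<zeta>)) (T N (of_real 1 * \<zeta>)) < c / 2) (at_left (1::real))"
        by (rule tendstoD) (use c in simp)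
      then obtain d where d: "d < 1" "\<And>r. d < r \<Longrightarrow> r < 1 \<Longrightarrow> dist (T N (of_real r * \<zeta>)) (T N (of_real 1 * \<zeta>)) < c / 2"
        unfolding eventually_at_left_field by blast
      show "\<exists>d<1. \<forall>r s. d < r \<longrightarrow> r < 1 \<longrightarrow> d < s \<longrightarrow> s < 1 \<longrightarrow> cmod (h (of_real r * \<zeta>) - h (of_real s * \<zeta>)) \<le> 129 * c"
      proof (intro exI[of _ "max d 0"] conjI allI impI)
        fix r s :: real assume rs: "max d 0 < r" "r < 1" "max d 0 < s" "s < 1"
        have 1: "cmod (T N (of_real r * \<zeta>) - T N (of_real s * \<zeta>)) \<le> c"
          using dist_triangle2[of "T N (of_real r * \<zeta>)" "T N (of_real s * \<zeta>)" "T N (of_real 1 * \<zeta>)"]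
            d(2)[of r] d(2)[of s] rs by (simp add: dist_norm)
        have "h (of_real r * \<zeta>) - h (of_real s * \<zeta>) = (h (of_real r * \<zeta>) - T N (of_real r * \<zeta>))
            + (T N (of_real r * \<zeta>) - T N (of_real s * \<zeta>)) - (h (of_real s * \<zeta>) - T N (of_real s * \<zeta>))" by simp
        also have "cmod \<dots> \<le> cmod (h (of_real r * \<zeta>) - T N (of_real r * \<zeta>))
            + cmod (T N (of_real r * \<zeta>) - T N (of_real s * \<zeta>)) + cmod (h (of_real s * \<zeta>) - T N (of_real s * \<zeta>))"
          by (intro order.trans[OF norm_triangle_ineq4] add_right_mono norm_triangle_ineq)
        also have "\<dots> \<le> 64 * c + c + 64 * c" using rs 1 by (intro add_mono k) auto
        finally show "cmod (h (of_real r * \<zeta>) - h (of_real s * \<zeta>)) \<le> 129 * c" by simp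
      qed (use d in auto)
    qed
  qed
  have "AE \<zeta> in arc_measure. \<forall>n. cmod \<zeta> = 1 \<longrightarrow>
     (\<exists>d<1. \<forall>r s. d < r \<longrightarrow> r < 1 \<longrightarrow> d < s \<longrightarrow> s < 1 \<longrightarrow> cmod (h (of_real r * \<zeta>) - h (of_real s * \<zeta>)) \<le> 129 * (1 / Suc n))"
    by (intro AE_all_countable[THEN iffD2] allI osc) simp
  then have "AE \<zeta> in arc_measure. \<exists>l. ((\<lambda>r. h (of_real r * \<zeta>)) \<longlongrightarrow> l) (at_left 1)"
    using AE_arc_sphere
  proof eventually_elim
    fix \<zeta> :: complex
    assume \<zeta>: "cmod \<zeta> = 1"
    assume all: "\<forall>n. cmod \<zeta> = 1 \<longrightarrow> (\<exists>d<1. \<forall>r s. d < r \<longrightarrow> r < 1 \<longrightarrow> d < s \<longrightarrow> s < 1 \<longrightarrow>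
        cmod (h (of_real r * \<zeta>) - h (of_real s * \<zeta>)) \<le> 129 * (1 / Suc n))"
    have cau: "\<exists>d<1. \<forall>r s. d < r \<longrightarrow> r < 1 \<longrightarrow> d < s \<longrightarrow> s < 1 \<longrightarrow> cmod (h (of_real r * \<zeta>) - h (of_real s * \<zeta>)) < e"
      if e: "e > 0" for e
    proof -
      obtain n where n: "inverse (real (Suc n)) < e / 129" using reals_Archimedean[of "e / 129"] e by auto
      obtain d where d: "d < 1" "\<forall>r s. d < r \<longrightarrow> r < 1 \<longrightarrow> d < s \<longrightarrow> s < 1 \<longrightarrow>
        cmod (h (of_real r * \<zeta>) - h (of_real s * \<zeta>)) \<le> 129 * (1 / Suc n)" using all \<zeta> by blast
      have "129 * (1 / Suc n) < e" using n by (simp add: inverse_eq_divide)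
      then show ?thesis using d by (meson le_less_trans)
    qed
    \<comment> \<open>One sequence produces the candidate limit; the oscillation bound then extends
      the convergence to all radii.\<close>
    define x where "x = radial_seq"
    have x1: "x n < 1" for n by (simp add: x_def radial_seq)
    have xlim: "x \<longlonglongrightarrow> 1" unfolding x_def by (rule radial_seq_tendsto)
    have "Cauchy (\<lambda>n. h (of_real (x n) * \<zeta>))"
      unfolding Cauchy_def dist_norm
    proof (intro allI impI)
      fix e :: real assume "e > 0"
      then obtain d where d: "d < 1" "\<forall>r s. d < r \<longrightarrow> r < 1 \<longrightarrow> d < s \<longrightarrow> s < 1 \<longrightarrow> cmod (h (of_real r * \<zeta>) - h (of_real s * \<zeta>)) < e"
        using cau by blast
      obtain M where "\<And>n. n \<ge> M \<Longrightarrow> d < x n"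
        using order_tendstoD(1)[OF xlim d(1)] by (auto simp: eventually_sequentially)
      then show "\<exists>M. \<forall>m\<ge>M. \<forall>n\<ge>M. cmod (h (of_real (x m) * \<zeta>) - h (of_real (x n) * \<zeta>)) < e"
        using d x1 by blast
    qed
    then obtain l where l: "(\<lambda>n. h (of_real (x n) * \<zeta>)) \<longlonglongrightarrow> l"
      using Cauchy_convergent_iff convergent_def by blast
    have "((\<lambda>r. h (of_real r * \<zeta>)) \<longlongrightarrow> l) (at_left 1)"
    proof (rule tendstoI)
      fix e :: real assume e: "e > 0"
      then obtain d where d: "d < 1" "\<forall>r s. d < r \<longrightarrow> r < 1 \<longrightarrow> d < s \<longrightarrow> s < 1 \<longrightarrow> cmod (h (of_real r * \<zeta>) - h (of_real s * \<zeta>)) < e / 2"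
        using cau[of "e / 2"] by auto
      have ev: "eventually (\<lambda>n. d < x n) sequentially" using order_tendstoD(1)[OF xlim d(1)] .
      have "dist (h (of_real r * \<zeta>)) l \<le> e / 2" if r: "d < r" "r < 1" for r
      proof (rule tendsto_upperbound)
        show "(\<lambda>n. dist (h (of_real r * \<zeta>)) (h (of_real (x n) * \<zeta>))) \<longlonglongrightarrow> dist (h (of_real r * \<zeta>)) l"
          by (intro tendsto_intros l)
        show "eventually (\<lambda>n. dist (h (of_real r * \<zeta>)) (h (of_real (x n) * \<zeta>)) \<le> e / 2) sequentially"
          using ev by eventually_elim (use d(2) r x1 in \<open>auto simp: dist_norm intro: less_imp_le\<close>)
      qed simp
      then show "eventually (\<lambda>r. dist (h (of_real r * \<zeta>)) l < e) (at_left 1)"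
        unfolding eventually_at_left_field using d(1) e by (intro exI[of _ d]) force
    qed
    then show "\<exists>l. ((\<lambda>r. h (of_real r * \<zeta>)) \<longlongrightarrow> l) (at_left 1)" by blast
  qed
  then show ?thesis by (rule AE_arcD)
qed

subsection \<open>Logarithms of $1-g$ for self-maps $g$ of the disk\<close>

lemma hardy_space_iff:
  "f \<in> hardy_space p \<longleftrightarrow> f holomorphic_on ball 0 1 \<and>
     (\<exists>C. \<forall>r. 0 < r \<longrightarrow> r < 1 \<longrightarrow>
        (\<integral>\<^sup>+\<theta>. ennreal (cmod (f (of_real r * cis \<theta>)) powr p) \<partial>dtheta) \<le> ennreal C)"
proof -
  let ?S = "SUP r\<in>{0<..<1}. \<integral>\<^sup>+\<theta>. ennreal (cmod (f (of_real r * cis \<theta>)) powr p) \<partial>dtheta"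
  have "?S < \<infinity> \<longleftrightarrow> (\<exists>C. \<forall>r. 0 < r \<longrightarrow> r < 1 \<longrightarrow>
        (\<integral>\<^sup>+\<theta>. ennreal (cmod (f (of_real r * cis \<theta>)) powr p) \<partial>dtheta) \<le> ennreal C)" (is "_ \<longleftrightarrow> ?R")
  proof
    assume "?S < \<infinity>"
    then obtain C where "?S = ennreal C" by (cases ?S) auto
    then show ?R by (metis SUP_upper greaterThanLessThan_iff)
  next
    assume ?R
    then obtain C where "?S \<le> ennreal C" by (metis (no_types, lifting) SUP_least greaterThanLessThan_iff)
    then show "?S < \<infinity>" unfolding infinity_ennreal_def by (rule le_less_trans) simp
  qed
  then show ?thesis by (simp add: hardy_space_def)
qed

text \<open>A sum is at most twice the larger modulus, so a factor 2^p replaces Minkowski's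
  inequality. In the bound, \<open>max\<close> guards against negative constants, which
  \<open>ennreal\<close> sends to 0.\<close>

lemma hardy_space_add:
  assumes f: "f \<in> hardy_space p" and g: "g \<in> hardy_space p" and p: "p > 0"
  shows "(\<lambda>z. f z + g z) \<in> hardy_space p"
proof -
  obtain C D where hol: "f holomorphic_on ball 0 1" "g holomorphic_on ball 0 1"
    and C: "\<And>r. 0 < r \<Longrightarrow> r < 1 \<Longrightarrow> (\<integral>\<^sup>+\<theta>. ennreal (cmod (f (of_real r * cis \<theta>)) powr p) \<partial>dtheta) \<le> ennreal C"
    and D: "\<And>r. 0 < r \<Longrightarrow> r < 1 \<Longrightarrow> (\<integral>\<^sup>+\<theta>. ennreal (cmod (g (of_real r * cis \<theta>)) powr p) \<partial>dtheta) \<le> ennreal D"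
    using f g unfolding hardy_space_iff by blast
  have pt: "cmod (a + b) powr p \<le> 2 powr p * (cmod a powr p + cmod b powr p)" for a b
  proof -
    define m where "m = max (cmod a) (cmod b)"
    have "cmod (a + b) \<le> 2 * m" using norm_triangle_ineq[of a b] by (auto simp: m_def)
    then have "cmod (a + b) powr p \<le> (2 * m) powr p" using p by (intro powr_mono2) auto
    also have "\<dots> = 2 powr p * m powr p" by (simp add: powr_mult)
    also have "m powr p \<le> cmod a powr p + cmod b powr p" by (auto simp: m_def max_def)
    finally show ?thesis by simp
  qed
  have "(\<integral>\<^sup>+\<theta>. ennreal (cmod (f (of_real r * cis \<theta>) + g (of_real r * cis \<theta>)) powr p) \<partial>dtheta)
     \<le> ennreal (2 powr p * (max C 0 + max D 0))" if r: "0 < r" "r < 1" for r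
  proof -
    have m: "(\<lambda>\<theta>. f (of_real r * cis \<theta>)) \<in> borel_measurable dtheta" "(\<lambda>\<theta>. g (of_real r * cis \<theta>)) \<in> borel_measurable dtheta"
      by (intro measurable_dtheta_cont dilate_continuous_sphere hol r)+
    note [measurable] = m
    have "(\<integral>\<^sup>+\<theta>. ennreal (cmod (f (of_real r * cis \<theta>) + g (of_real r * cis \<theta>)) powr p) \<partial>dtheta)
      \<le> (\<integral>\<^sup>+\<theta>. ennreal (2 powr p) * (ennreal (cmod (f (of_real r * cis \<theta>)) powr p) + ennreal (cmod (g (of_real r * cis \<theta>)) powr p)) \<partial>dtheta)"
    proof (rule nn_integral_mono)
      fix \<theta>
      have "ennreal (cmod (f (of_real r * cis \<theta>) + g (of_real r * cis \<theta>)) powr p)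
        \<le> ennreal (2 powr p * (cmod (f (of_real r * cis \<theta>)) powr p + cmod (g (of_real r * cis \<theta>)) powr p))"
        by (intro ennreal_leI pt)
      also have "\<dots> = ennreal (2 powr p) * (ennreal (cmod (f (of_real r * cis \<theta>)) powr p) + ennreal (cmod (g (of_real r * cis \<theta>)) powr p))"
        by (simp add: ennreal_mult)
      finally show "ennreal (cmod (f (of_real r * cis \<theta>) + g (of_real r * cis \<theta>)) powr p)
        \<le> ennreal (2 powr p) * (ennreal (cmod (f (of_real r * cis \<theta>)) powr p) + ennreal (cmod (g (of_real r * cis \<theta>)) powr p))" .
    qed
    also have "\<dots> = ennreal (2 powr p) * ((\<integral>\<^sup>+\<theta>. ennreal (cmod (f (of_real r * cis \<theta>)) powr p) \<partial>dtheta)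
        + (\<integral>\<^sup>+\<theta>. ennreal (cmod (g (of_real r * cis \<theta>)) powr p) \<partial>dtheta))"
      by (subst nn_integral_cmult, measurable) (subst nn_integral_add, measurable)
    also have "\<dots> \<le> ennreal (2 powr p) * (ennreal (max C 0) + ennreal (max D 0))"
      by (intro mult_left_mono add_mono order.trans[OF C[OF r]] order.trans[OF D[OF r]] ennreal_leI) auto
    also have "\<dots> = ennreal (2 powr p * (max C 0 + max D 0))"
      by (simp add: ennreal_mult)
    finally show ?thesis .
  qed
  then show ?thesis
    unfolding hardy_space_iff using hol by (auto intro!: holomorphic_intros)
qed

lemma hardy_space_uminus: "f \<in> hardy_space p \<Longrightarrow> (\<lambda>z. - f z) \<in> hardy_space p"
  unfolding hardy_space_iff by (auto intro!: holomorphic_intros)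

lemma hardy_space_const: "(\<lambda>z. c) \<in> hardy_space p"
  unfolding hardy_space_iff using dtheta.emeasure_space_1 by (auto intro!: exI[of _ "cmod c powr p"])

lemma hardy_space_cong:
  assumes "f \<in> hardy_space p" and "\<And>z. z \<in> ball 0 1 \<Longrightarrow> f z = g z"
  shows "g \<in> hardy_space p"
proof -
  have "(\<integral>\<^sup>+\<theta>. ennreal (cmod (f (of_real r * cis \<theta>)) powr p) \<partial>dtheta)
      = (\<integral>\<^sup>+\<theta>. ennreal (cmod (g (of_real r * cis \<theta>)) powr p) \<partial>dtheta)" if "0 < r" "r < 1" for r
    using that assms(2) by (intro nn_integral_cong) (simp add: norm_mult)
  then show ?thesis
    using assms holomorphic_transform[of f "ball 0 1" g] unfolding hardy_space_iff by auto
qed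

text \<open>One exponential moment controls all powers, so a single mean bound serves every
  \<open>hardy_space p\<close>.\<close>

lemma powr_le_exp:
  fixes x p :: real
  assumes "0 \<le> x" "0 < p"
  shows "x powr p \<le> (2 * p) powr p * exp (x / 2)"
proof -
  have "x / (2 * p) \<le> exp (x / (2 * p))" using exp_ge_add_one_self[of "x / (2*p)"] by linarith
  then have "(x / (2 * p)) powr p \<le> exp (x / (2 * p)) powr p" using assms by (intro powr_mono2) auto
  also have "\<dots> = exp (x / 2)" using assms by (simp add: exp_powr_real)
  finally have "(2 * p) powr p * (x / (2 * p)) powr p \<le> (2 * p) powr p * exp (x / 2)" by (intro mult_left_mono) auto
  also have "(2 * p) powr p * (x / (2 * p)) powr p = x powr p"
    using assms by (subst powr_mult[symmetric]) auto
  finally show ?thesis .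
qed

locale disk_self_map =
  fixes g :: "complex \<Rightarrow> complex"
  assumes hol: "g holomorphic_on ball 0 1" and less: "\<And>z. cmod z < 1 \<Longrightarrow> cmod (g z) < 1"
begin

definition log1m :: "complex \<Rightarrow> complex" where "log1m z = Ln (1 - g z)"

lemma Re_pos: "cmod z < 1 \<Longrightarrow> Re (1 - g z) > 0"
  using less[of z] complex_Re_le_cmod[of "g z"] by simp

lemma nonzero: "cmod z < 1 \<Longrightarrow> 1 - g z \<noteq> 0"
  using Re_pos[of z] by (metis less_irrefl zero_complex.simps(1))

lemma log1m_holomorphic: "log1m holomorphic_on ball 0 1"
proof -
  have "1 - g z \<notin> \<real>\<^sub>\<le>\<^sub>0" if "z \<in> ball 0 1" for z
    using Re_pos[of z] that by (auto simp: complex_nonpos_Reals_iff)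
  then show ?thesis unfolding log1m_def by (intro holomorphic_intros hol)
qed

lemma exp_log1m: "cmod z < 1 \<Longrightarrow> exp (log1m z) = 1 - g z"
  unfolding log1m_def using nonzero by simp

lemma Im_log1m: "cmod z < 1 \<Longrightarrow> \<bar>Im (log1m z)\<bar> < pi / 2"
  unfolding log1m_def using Re_pos[of z] nonzero[of z] Re_Ln_pos_lt by blast

lemma Re_log1m: "cmod z < 1 \<Longrightarrow> Re (log1m z) = ln (cmod (1 - g z))"
  unfolding log1m_def using nonzero by simp

text \<open>The power $(1-g)^s$ with $|s| \<le> 1/2$ stays in a sector strictly inside the right half plane,
  so its modulus is controlled by its real part, whose circular means are constant.\<close>

lemma exp_mean_bound:
  fixes s r :: real
  assumes s: "\<bar>s\<bar> \<le> 1 / 2" and r: "0 < r" "r < 1"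
  shows "(\<integral>\<^sup>+\<theta>. ennreal (exp (s * Re (log1m (of_real r * cis \<theta>)))) \<partial>dtheta) \<le> ennreal (2 * exp (s * Re (log1m 0)))"
proof -
  define q where "q z = exp (of_real s * log1m z)" for z
  have qh: "q holomorphic_on ball 0 1" unfolding q_def by (intro holomorphic_intros log1m_holomorphic)
  have lt: "cmod (of_real r * cis \<theta>) < 1" for \<theta> using r by (simp add: norm_mult)
  have pt: "exp (s * Re (log1m z)) \<le> 2 * Re (q z)" if z: "cmod z < 1" for z
  proof -
    \<comment> \<open>The argument is at most pi/4, hence below pi/3; cos (pi/3) = 1/2 is where the
      factor 2 comes from.\<close>
    have "\<bar>s * Im (log1m z)\<bar> \<le> 1 / 2 * (pi / 2)"
      unfolding abs_mult using s Im_log1m[OF z] by (intro mult_mono) auto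
    then have "cos (pi / 3) \<le> cos \<bar>s * Im (log1m z)\<bar>" by (intro cos_monotone_0_pi_le) auto
    then have "1 / 2 \<le> cos (s * Im (log1m z))" by (simp add: cos_60)
    then have "exp (s * Re (log1m z)) * (1 / 2) \<le> exp (s * Re (log1m z)) * cos (s * Im (log1m z))" by (intro mult_left_mono) auto
    then show ?thesis by (simp add: q_def Re_exp)
  qed
  have cs: "continuous_on (sphere 0 1) (\<lambda>z. q (of_real r * z))" by (intro dilate_continuous_sphere qh r)
  have int: "integrable dtheta (\<lambda>\<theta>. 2 * Re (q (of_real r * cis \<theta>)))"
    by (rule integrable_dtheta_cont[where f = "\<lambda>\<xi>. 2 * Re (q (of_real r * \<xi>))"]) (intro continuous_intros cs)
  have nn: "0 \<le> 2 * Re (q (of_real r * cis \<theta>))" for \<theta>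
    using pt[OF lt] exp_ge_zero order.trans by blast
  have "(\<integral>\<^sup>+\<theta>. ennreal (exp (s * Re (log1m (of_real r * cis \<theta>)))) \<partial>dtheta)
     \<le> (\<integral>\<^sup>+\<theta>. ennreal (2 * Re (q (of_real r * cis \<theta>))) \<partial>dtheta)"
    by (intro nn_integral_mono ennreal_leI pt lt)
  also have "\<dots> = ennreal (LINT \<theta>|dtheta. 2 * Re (q (of_real r * cis \<theta>)))"
    using int nn by (intro nn_integral_eq_integral) auto
  also have "(LINT \<theta>|dtheta. 2 * Re (q (of_real r * cis \<theta>))) = 2 * Re (LINT \<theta>|dtheta. q (of_real r * cis \<theta>))"
    using integrable_dtheta_cont[OF cs] by simp
  also have "(LINT \<theta>|dtheta. q (of_real r * cis \<theta>)) = q 0"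
    using mean_value_circle[OF dilate_continuous[OF qh r] dilate_holomorphic[OF qh r]] by simp
  also have "2 * Re (q 0) \<le> 2 * exp (s * Re (log1m 0))"
    using complex_Re_le_cmod[of "q 0"] by (simp add: q_def)
  finally show ?thesis by (simp add: ennreal_leI)
qed

text \<open>The imaginary part stays below pi/2 < 2, so only the real part x can be large, and exp
  (|x|/2) <= exp (x/2) + exp (-x/2). The means of the two summands are the cases s = 1/2 and s =
  -1/2 of \<open>exp_mean_bound\<close>.\<close>

lemma log1m_hardy:
  assumes p: "p > 0"
  shows "log1m \<in> hardy_space p"
proof -
  define K where "K = (2 * p) powr p * exp 1"
  have K: "K \<ge> 0" by (simp add: K_def)
  define C where "C = 2 * exp (1/2 * Re (log1m 0)) + 2 * exp (- 1/2 * Re (log1m 0))"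
  have pt: "cmod (log1m z) powr p \<le> K * (exp (1/2 * Re (log1m z)) + exp (- 1/2 * Re (log1m z)))" if z: "cmod z < 1" for z
  proof -
    have "cmod (log1m z) \<le> \<bar>Re (log1m z)\<bar> + 2"
      using cmod_le[of "log1m z"] Im_log1m[OF z] pi_less_4 by linarith
    then have "cmod (log1m z) powr p \<le> (\<bar>Re (log1m z)\<bar> + 2) powr p" using p by (intro powr_mono2) auto
    also have "\<dots> \<le> (2 * p) powr p * exp ((\<bar>Re (log1m z)\<bar> + 2) / 2)" using p by (intro powr_le_exp) auto
    also have "exp ((\<bar>Re (log1m z)\<bar> + 2) / 2) = exp 1 * exp (\<bar>Re (log1m z)\<bar> / 2)"
      by (simp add: add_divide_distrib exp_add)
    also have "(2 * p) powr p * (exp 1 * exp (\<bar>Re (log1m z)\<bar> / 2)) = K * exp (\<bar>Re (log1m z)\<bar> / 2)"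
      by (simp add: K_def)
    also have "\<dots> \<le> K * (exp (1/2 * Re (log1m z)) + exp (- 1/2 * Re (log1m z)))"
      using K by (intro mult_left_mono) (auto simp: abs_if)
    finally show ?thesis .
  qed
  have "(\<integral>\<^sup>+\<theta>. ennreal (cmod (log1m (of_real r * cis \<theta>)) powr p) \<partial>dtheta) \<le> ennreal (K * C)"
    if r: "0 < r" "r < 1" for r
  proof -
    let ?e = "\<lambda>s \<theta>. ennreal (exp (s * Re (log1m (of_real r * cis \<theta>))))"
    have cL: "(\<lambda>\<theta>. log1m (of_real r * cis \<theta>)) \<in> borel_measurable dtheta"
      by (intro measurable_dtheta_cont dilate_continuous_sphere log1m_holomorphic r)
    note [measurable] = cL
    have "(\<integral>\<^sup>+\<theta>. ennreal (cmod (log1m (of_real r * cis \<theta>)) powr p) \<partial>dtheta)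
      \<le> (\<integral>\<^sup>+\<theta>. ennreal K * (?e (1/2) \<theta> + ?e (-1/2) \<theta>) \<partial>dtheta)"
    proof (rule nn_integral_mono)
      fix \<theta>
      have "cmod (of_real r * cis \<theta>) < 1" using r by (simp add: norm_mult)
      then have "ennreal (cmod (log1m (of_real r * cis \<theta>)) powr p) \<le> ennreal (K * (exp (1/2 * Re (log1m (of_real r * cis \<theta>))) + exp (- 1/2 * Re (log1m (of_real r * cis \<theta>)))))"
        by (intro ennreal_leI pt)
      also have "\<dots> = ennreal K * (?e (1/2) \<theta> + ?e (-1/2) \<theta>)"
        using K by (simp add: ennreal_mult)
      finally show "ennreal (cmod (log1m (of_real r * cis \<theta>)) powr p) \<le> ennreal K * (?e (1/2) \<theta> + ?e (-1/2) \<theta>)" .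
    qed
    also have "\<dots> = ennreal K * ((\<integral>\<^sup>+\<theta>. ?e (1/2) \<theta> \<partial>dtheta) + (\<integral>\<^sup>+\<theta>. ?e (-1/2) \<theta> \<partial>dtheta))"
      by (subst nn_integral_cmult, measurable) (subst nn_integral_add, measurable)
    also have "\<dots> \<le> ennreal K * (ennreal (2 * exp (1/2 * Re (log1m 0))) + ennreal (2 * exp (-1/2 * Re (log1m 0))))"
      using r by (intro mult_left_mono add_mono exp_mean_bound) auto
    also have "\<dots> = ennreal (K * C)"
    proof -
      have "ennreal (2 * exp (1/2 * Re (log1m 0))) + ennreal (2 * exp (-1/2 * Re (log1m 0))) = ennreal C"
        unfolding C_def by (subst ennreal_plus[symmetric]) auto
      moreover have "C \<ge> 0" by (simp add: C_def)
      ultimately show ?thesis using K by (simp only: ennreal_mult)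
    qed
    finally show ?thesis .
  qed
  then show ?thesis unfolding hardy_space_iff using log1m_holomorphic by blast
qed

end

section \<open>Boundary logarithms and their Schwarz integrals\<close>

locale disk_self_map_boundary = disk_self_map +
  fixes b :: "real \<Rightarrow> complex"
  assumes meas_b [measurable]: "b \<in> borel_measurable borel"
    and lim_b: "AE \<theta> in dtheta. ((\<lambda>r. g (of_real r * cis \<theta>)) \<longlongrightarrow> b \<theta>) (at_left 1)"
begin

lemma lim_b_seq: "AE \<theta> in dtheta. (\<lambda>n. g (of_real (radial_seq n) * cis \<theta>)) \<longlonglongrightarrow> b \<theta>"
  using lim_b by eventually_elim (rule radial_limit_seq)

lemma norm_lt: "cmod (of_real (radial_seq n) * cis \<theta>) < 1"
  using radial_seq[of n] by (simp add: norm_mult)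

lemma norm_b: "AE \<theta> in dtheta. cmod (b \<theta>) \<le> 1"
  using lim_b_seq
proof eventually_elim
  fix \<theta> assume "(\<lambda>n. g (of_real (radial_seq n) * cis \<theta>)) \<longlonglongrightarrow> b \<theta>"
  then have "(\<lambda>n. cmod (g (of_real (radial_seq n) * cis \<theta>))) \<longlonglongrightarrow> cmod (b \<theta>)" by (rule tendsto_norm)
  then show "cmod (b \<theta>) \<le> 1"
    by (rule LIMSEQ_le_const2) (use less[OF norm_lt] in \<open>auto intro: less_imp_le\<close>)
qed

lemma measurable_log1m_seq: "(\<lambda>\<theta>. log1m (of_real (radial_seq n) * cis \<theta>)) \<in> borel_measurable dtheta"
  by (intro measurable_dtheta_cont dilate_continuous_sphere log1m_holomorphic radial_seq)

text \<open>Both follow from the H^1 bound by Fatou's lemma. Where b = 1 the logarithms tend to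
  minus infinity and the liminf is infinite, which is possible only on a null set; elsewhere the
  liminf is the absolute value of the boundary logarithm.\<close>

lemma boundary_ne_1: "AE \<theta> in dtheta. b \<theta> \<noteq> 1"
  and integrable_log_boundary: "integrable dtheta (\<lambda>\<theta>. ln (cmod (1 - b \<theta>)))"
proof -
  note [measurable] = measurable_log1m_seq
  obtain C where C: "\<And>r. 0 < r \<Longrightarrow> r < 1 \<Longrightarrow> (\<integral>\<^sup>+\<theta>. ennreal (cmod (log1m (of_real r * cis \<theta>)) powr 1) \<partial>dtheta) \<le> ennreal C"
    using log1m_hardy[of 1] unfolding hardy_space_iff by auto
  let ?u = "\<lambda>n \<theta>. ennreal \<bar>Re (log1m (of_real (radial_seq n) * cis \<theta>))\<bar>"
  have "(\<integral>\<^sup>+\<theta>. liminf (\<lambda>n. ?u n \<theta>) \<partial>dtheta) \<le> liminf (\<lambda>n. \<integral>\<^sup>+\<theta>. ?u n \<theta> \<partial>dtheta)"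
    by (rule nn_integral_liminf) measurable
  also have "\<dots> \<le> liminf (\<lambda>n. ennreal C)"
  proof (intro Liminf_mono always_eventually allI)
    fix n
    have "(\<integral>\<^sup>+\<theta>. ?u n \<theta> \<partial>dtheta) \<le> (\<integral>\<^sup>+\<theta>. ennreal (cmod (log1m (of_real (radial_seq n) * cis \<theta>)) powr 1) \<partial>dtheta)"
      by (intro nn_integral_mono ennreal_leI) (simp add: abs_Re_le_cmod)
    also have "\<dots> \<le> ennreal C" using radial_seq by (intro C)
    finally show "(\<integral>\<^sup>+\<theta>. ?u n \<theta> \<partial>dtheta) \<le> ennreal C" .
  qed
  also have "\<dots> = ennreal C" by (simp add: Liminf_const)
  finally have le: "(\<integral>\<^sup>+\<theta>. liminf (\<lambda>n. ?u n \<theta>) \<partial>dtheta) \<le> ennreal C" .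
  then have fin: "(\<integral>\<^sup>+\<theta>. liminf (\<lambda>n. ?u n \<theta>) \<partial>dtheta) \<noteq> \<infinity>" by (auto simp: top_unique)
  have "AE \<theta> in dtheta. liminf (\<lambda>n. ?u n \<theta>) \<noteq> \<infinity>"
    by (rule nn_integral_noteq_infinite[OF _ fin]) measurable
  then show ne: "AE \<theta> in dtheta. b \<theta> \<noteq> 1"
    using lim_b_seq
  proof eventually_elim
    fix \<theta> assume f: "liminf (\<lambda>n. ?u n \<theta>) \<noteq> \<infinity>" and l: "(\<lambda>n. g (of_real (radial_seq n) * cis \<theta>)) \<longlonglongrightarrow> b \<theta>"
    show "b \<theta> \<noteq> 1"
    proof
      assume b1: "b \<theta> = 1"
      define x where "x n = cmod (1 - g (of_real (radial_seq n) * cis \<theta>))" for n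
      have "x \<longlonglongrightarrow> cmod (1 - b \<theta>)" unfolding x_def by (intro tendsto_intros l)
      then have "filterlim x (at_right 0) sequentially"
        unfolding filterlim_at using b1 nonzero[OF norm_lt]
        by (auto intro!: always_eventually simp: x_def)
      then have "filterlim (\<lambda>n. ln (x n)) at_bot sequentially"
        by (rule filterlim_compose[OF ln_at_0])
      then have "filterlim (\<lambda>n. Re (log1m (of_real (radial_seq n) * cis \<theta>))) at_bot sequentially"
        by (simp add: x_def Re_log1m[OF norm_lt])
      then have "filterlim (\<lambda>n. \<bar>Re (log1m (of_real (radial_seq n) * cis \<theta>))\<bar>) at_top sequentially"
        unfolding filterlim_uminus_at_bot by (rule filterlim_at_top_mono) (auto intro!: always_eventually)
      then have "(\<lambda>n. ?u n \<theta>) \<longlonglongrightarrow> \<infinity>"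
        by (simp add: ennreal_tendsto_top_eq_at_top)
      then have "liminf (\<lambda>n. ?u n \<theta>) = \<infinity>" by (intro lim_imp_Liminf) auto
      then show False using f by simp
    qed
  qed
  show "integrable dtheta (\<lambda>\<theta>. ln (cmod (1 - b \<theta>)))"
  proof (rule integrableI_bounded)
    have "(\<integral>\<^sup>+\<theta>. ennreal (norm (ln (cmod (1 - b \<theta>)))) \<partial>dtheta) = (\<integral>\<^sup>+\<theta>. liminf (\<lambda>n. ?u n \<theta>) \<partial>dtheta)"
    proof (rule nn_integral_cong_AE, use ne lim_b_seq in eventually_elim)
      fix \<theta> assume "b \<theta> \<noteq> 1" and l: "(\<lambda>n. g (of_real (radial_seq n) * cis \<theta>)) \<longlonglongrightarrow> b \<theta>"
      then have "(\<lambda>n. ennreal \<bar>ln (cmod (1 - g (of_real (radial_seq n) * cis \<theta>)))\<bar>) \<longlonglongrightarrow> ennreal \<bar>ln (cmod (1 - b \<theta>))\<bar>"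
        by (intro tendsto_ennrealI tendsto_intros) auto
      then have "liminf (\<lambda>n. ?u n \<theta>) = ennreal \<bar>ln (cmod (1 - b \<theta>))\<bar>"
        by (intro lim_imp_Liminf) (simp_all add: Re_log1m[OF norm_lt])
      then show "ennreal (norm (ln (cmod (1 - b \<theta>)))) = liminf (\<lambda>n. ?u n \<theta>)" by simp
    qed
    then show "(\<integral>\<^sup>+\<theta>. ennreal (norm (ln (cmod (1 - b \<theta>)))) \<partial>dtheta) < \<infinity>"
      using fin by (simp add: less_top)
  qed measurable
qed

text \<open>For t < 1 the function 1 - t g stays away from 0, so its logarithms have a constant
  majorant and the radial limit passes under the integral. This separates the limit in the radius
  from the limit t -> 1.\<close>

lemma schwarz_log_scaled:
  fixes t :: real
  assumes t: "0 < t" "t < 1" and z: "cmod z < 1"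
  shows "(LINT \<theta>|dtheta. herglotz z (cis \<theta>) * complex_of_real (ln (cmod (1 - of_real t * b \<theta>))))
     = Ln (1 - of_real t * g z) - \<i> * Im (Ln (1 - of_real t * g 0))"
proof -
  have "disk_self_map (\<lambda>z. of_real t * g z)"
  proof
    show "cmod (of_real t * g z) < 1" if "cmod z < 1" for z
      using mult_strict_mono'[of t 1 "cmod (g z)" 1] t less[OF that] by (simp add: norm_mult)
  qed (intro holomorphic_intros hol)
  then interpret tg: disk_self_map "\<lambda>z. of_real t * g z" .
  let ?L = "tg.log1m"
  have eq: "(LINT \<theta>|dtheta. herglotz z (cis \<theta>) * complex_of_real (Re (?L (of_real r * cis \<theta>))))
     = ?L (of_real r * z) - \<i> * Im (?L 0)" if r: "0 < r" "r < 1" for r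
    using schwarz_formula[OF dilate_continuous[OF tg.log1m_holomorphic r] dilate_holomorphic[OF tg.log1m_holomorphic r] z] by simp
  obtain B where B: "\<And>\<theta>. norm (herglotz z (cis \<theta>)) \<le> B" using sphere_bounded[OF herglotz_continuous[OF z]] by blast
  have B0: "B \<ge> 0" using B[of 0] norm_ge_zero order.trans by blast
  have lnb: "\<bar>ln (cmod (1 - of_real t * x))\<bar> \<le> \<bar>ln (1 - t)\<bar> + ln 2" if x: "cmod x \<le> 1" for x
  proof -
    have n: "cmod (of_real t * x) \<le> t" using x t mult_left_mono[of "cmod x" 1 t] by (simp add: norm_mult)
    have 1: "1 - t \<le> cmod (1 - of_real t * x)" using norm_triangle_ineq2[of 1 "of_real t * x"] n by simp
    have 2: "cmod (1 - of_real t * x) \<le> 2" using norm_triangle_ineq4[of 1 "of_real t * x"] n t by simp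
    have "ln (1 - t) \<le> ln (cmod (1 - of_real t * x))" using 1 t by (intro ln_mono) auto
    moreover have "ln (cmod (1 - of_real t * x)) \<le> ln 2" using 1 2 t by (intro ln_mono) auto
    ultimately show ?thesis using ln_gt_zero[of "2::real"] by linarith
  qed
  have mh: "(\<lambda>\<theta>. herglotz z (cis \<theta>)) \<in> borel_measurable dtheta"
    by (rule measurable_dtheta_cont[OF herglotz_continuous[OF z]])
  note [measurable] = mh
  have mL: "(\<lambda>\<theta>. ?L (of_real (radial_seq n) * cis \<theta>)) \<in> borel_measurable dtheta" for n
    by (intro measurable_dtheta_cont dilate_continuous_sphere tg.log1m_holomorphic radial_seq)
  note [measurable] = mL
  have "(\<lambda>n. LINT \<theta>|dtheta. herglotz z (cis \<theta>) * complex_of_real (Re (?L (of_real (radial_seq n) * cis \<theta>))))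
     \<longlonglongrightarrow> (LINT \<theta>|dtheta. herglotz z (cis \<theta>) * complex_of_real (ln (cmod (1 - of_real t * b \<theta>))))"
  proof (rule integral_dominated_convergence[where w = "\<lambda>_. B * (\<bar>ln (1 - t)\<bar> + ln 2)"])
    show "AE \<theta> in dtheta. (\<lambda>n. herglotz z (cis \<theta>) * complex_of_real (Re (?L (of_real (radial_seq n) * cis \<theta>))))
        \<longlonglongrightarrow> herglotz z (cis \<theta>) * complex_of_real (ln (cmod (1 - of_real t * b \<theta>)))"
      using lim_b_seq norm_b
    proof eventually_elim
      fix \<theta> assume l: "(\<lambda>n. g (of_real (radial_seq n) * cis \<theta>)) \<longlonglongrightarrow> b \<theta>" and b1: "cmod (b \<theta>) \<le> 1"
      have "t * cmod (b \<theta>) \<le> t * 1" using b1 t by (intro mult_left_mono) auto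
      then have "t * cmod (b \<theta>) < 1" using t by linarith
      then have "cmod (of_real t * b \<theta>) < 1" using t by (simp add: norm_mult)
      then have "cmod (1 - of_real t * b \<theta>) \<noteq> 0" by auto
      then have "(\<lambda>n. ln (cmod (1 - of_real t * g (of_real (radial_seq n) * cis \<theta>)))) \<longlonglongrightarrow> ln (cmod (1 - of_real t * b \<theta>))"
        by (intro tendsto_intros l)
      then show "(\<lambda>n. herglotz z (cis \<theta>) * complex_of_real (Re (?L (of_real (radial_seq n) * cis \<theta>))))
        \<longlonglongrightarrow> herglotz z (cis \<theta>) * complex_of_real (ln (cmod (1 - of_real t * b \<theta>)))"
        unfolding tg.Re_log1m[OF norm_lt] by (intro tendsto_mult tendsto_const tendsto_of_real)
    qed
    show "AE \<theta> in dtheta. norm (herglotz z (cis \<theta>) * complex_of_real (Re (?L (of_real (radial_seq n) * cis \<theta>))))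
       \<le> B * (\<bar>ln (1 - t)\<bar> + ln 2)" for n
      unfolding norm_mult tg.Re_log1m[OF norm_lt] norm_of_real using B0
      by (intro AE_I2 mult_mono B lnb less_imp_le[OF less] norm_lt) auto
  qed measurable
  moreover have "(\<lambda>n. ?L (of_real (radial_seq n) * z) - \<i> * Im (?L 0)) \<longlonglongrightarrow> ?L z - \<i> * Im (?L 0)"
  proof (intro tendsto_intros)
    have "isCont ?L z"
      using holomorphic_on_imp_continuous_on[OF tg.log1m_holomorphic] z by (auto simp: continuous_on_eq_continuous_at)
    moreover have "(\<lambda>n. complex_of_real (radial_seq n) * z) \<longlonglongrightarrow> of_real 1 * z"
      by (intro tendsto_intros radial_seq_tendsto)
    ultimately show "(\<lambda>n. ?L (of_real (radial_seq n) * z)) \<longlonglongrightarrow> ?L z"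
      using isCont_tendsto_compose by fastforce
  qed
  ultimately have "(LINT \<theta>|dtheta. herglotz z (cis \<theta>) * complex_of_real (ln (cmod (1 - of_real t * b \<theta>)))) = ?L z - \<i> * Im (?L 0)"
    unfolding eq[OF radial_seq] by (rule LIMSEQ_unique)
  then show ?thesis by (simp add: tg.log1m_def)
qed

lemma schwarz_log:
  assumes z: "cmod z < 1"
  shows "(LINT \<theta>|dtheta. herglotz z (cis \<theta>) * complex_of_real (ln (cmod (1 - b \<theta>)))) = log1m z - \<i> * Im (log1m 0)"
proof -
  obtain B where B: "\<And>\<theta>. norm (herglotz z (cis \<theta>)) \<le> B" using sphere_bounded[OF herglotz_continuous[OF z]] by blast
  have B0: "B \<ge> 0" using B[of 0] norm_ge_zero order.trans by blast
  have mh: "(\<lambda>\<theta>. herglotz z (cis \<theta>)) \<in> borel_measurable dtheta"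
    by (rule measurable_dtheta_cont[OF herglotz_continuous[OF z]])
  note [measurable] = mh
  \<comment> \<open>Replacing x by t x at most halves the distance to 1, so the boundary logarithm,
    already known to be integrable, dominates uniformly in t.\<close>
  have lnb: "\<bar>ln (cmod (1 - of_real t * x))\<bar> \<le> \<bar>ln (cmod (1 - x))\<bar> + ln 2"
    if x: "cmod x \<le> 1" "x \<noteq> 1" and t: "0 < t" "t < 1" for x and t :: real
  proof -
    have n: "cmod (of_real t * x) \<le> t" using x t mult_left_mono[of "cmod x" 1 t] by (simp add: norm_mult)
    have 1: "1 - t \<le> cmod (1 - of_real t * x)" using norm_triangle_ineq2[of 1 "of_real t * x"] n by simp
    have 2: "cmod (1 - of_real t * x) \<le> 2" using norm_triangle_ineq4[of 1 "of_real t * x"] n t by simp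
    have "1 - x = (1 - of_real t * x) - of_real (1 - t) * x" by (simp add: algebra_simps)
    then have "cmod (1 - x) \<le> cmod (1 - of_real t * x) + cmod (of_real (1 - t) * x)" by (metis norm_triangle_ineq4)
    also have "cmod (of_real (1 - t) * x) \<le> 1 - t"
      unfolding norm_mult norm_of_real using x t mult_left_mono[of "cmod x" 1 "1 - t"] by simp
    finally have 3: "cmod (1 - x) / 2 \<le> cmod (1 - of_real t * x)" using 1 by simp
    have "ln (cmod (1 - x) / 2) \<le> ln (cmod (1 - of_real t * x))" using 3 x by (intro ln_mono) auto
    moreover have "ln (cmod (1 - x) / 2) = ln (cmod (1 - x)) - ln 2" using x by (simp add: ln_div)
    moreover have "ln (cmod (1 - of_real t * x)) \<le> ln 2" using 1 2 t by (intro ln_mono) auto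
    ultimately show ?thesis by linarith
  qed
  have "(\<lambda>n. LINT \<theta>|dtheta. herglotz z (cis \<theta>) * complex_of_real (ln (cmod (1 - of_real (radial_seq n) * b \<theta>))))
     \<longlonglongrightarrow> (LINT \<theta>|dtheta. herglotz z (cis \<theta>) * complex_of_real (ln (cmod (1 - b \<theta>))))"
  proof (rule integral_dominated_convergence[where w = "\<lambda>\<theta>. B * (\<bar>ln (cmod (1 - b \<theta>))\<bar> + ln 2)"])
    show "integrable dtheta (\<lambda>\<theta>. B * (\<bar>ln (cmod (1 - b \<theta>))\<bar> + ln 2))"
      using integrable_log_boundary by (intro integrable_mult_right Bochner_Integration.integrable_add) auto
    show "AE \<theta> in dtheta. (\<lambda>n. herglotz z (cis \<theta>) * complex_of_real (ln (cmod (1 - of_real (radial_seq n) * b \<theta>))))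
        \<longlonglongrightarrow> herglotz z (cis \<theta>) * complex_of_real (ln (cmod (1 - b \<theta>)))"
      using boundary_ne_1
    proof eventually_elim
      fix \<theta> assume "b \<theta> \<noteq> 1"
      then have "cmod (1 - of_real 1 * b \<theta>) \<noteq> 0" by simp
      then have "(\<lambda>n. herglotz z (cis \<theta>) * complex_of_real (ln (cmod (1 - of_real (radial_seq n) * b \<theta>))))
        \<longlonglongrightarrow> herglotz z (cis \<theta>) * complex_of_real (ln (cmod (1 - of_real 1 * b \<theta>)))"
        by (intro tendsto_intros radial_seq_tendsto)
      then show "(\<lambda>n. herglotz z (cis \<theta>) * complex_of_real (ln (cmod (1 - of_real (radial_seq n) * b \<theta>))))
        \<longlonglongrightarrow> herglotz z (cis \<theta>) * complex_of_real (ln (cmod (1 - b \<theta>)))" by simp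
    qed
    show "AE \<theta> in dtheta. norm (herglotz z (cis \<theta>) * complex_of_real (ln (cmod (1 - of_real (radial_seq n) * b \<theta>))))
       \<le> B * (\<bar>ln (cmod (1 - b \<theta>))\<bar> + ln 2)" for n
      using boundary_ne_1 norm_b
    proof eventually_elim
      fix \<theta> assume "b \<theta> \<noteq> 1" "cmod (b \<theta>) \<le> 1"
      then show "norm (herglotz z (cis \<theta>) * complex_of_real (ln (cmod (1 - of_real (radial_seq n) * b \<theta>))))
       \<le> B * (\<bar>ln (cmod (1 - b \<theta>))\<bar> + ln 2)"
        unfolding norm_mult norm_of_real using B0 radial_seq by (intro mult_mono B lnb) auto
    qed
  qed measurable
  moreover have "(\<lambda>n. Ln (1 - of_real (radial_seq n) * g z) - \<i> * Im (Ln (1 - of_real (radial_seq n) * g 0)))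
      \<longlonglongrightarrow> Ln (1 - of_real 1 * g z) - \<i> * Im (Ln (1 - of_real 1 * g 0))"
  proof -
    have nr: "1 - of_real 1 * g w \<notin> \<real>\<^sub>\<le>\<^sub>0" if "cmod w < 1" for w
      using Re_pos[OF that] by (auto simp: complex_nonpos_Reals_iff)
    have nr1: "(\<lambda>n. Ln (1 - of_real (radial_seq n) * g w)) \<longlonglongrightarrow> Ln (1 - of_real 1 * g w)" if "cmod w < 1" for w
      by (intro tendsto_Ln tendsto_intros radial_seq_tendsto nr that)
    show ?thesis by (intro tendsto_intros nr1 z) simp
  qed
  ultimately show ?thesis
    unfolding schwarz_log_scaled[OF radial_seq z] using LIMSEQ_unique by (fastforce simp: log1m_def)
qed

end

subsection \<open>Boundary values and weights\<close>

lemma sets_circle_borelI: "A \<in> sets borel \<Longrightarrow> A \<inter> sphere 0 1 \<in> sets circle_borel"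
  by (auto simp: circle_borel_def sets_restrict_space)

lemma sets_circle_borelD: "A \<in> sets circle_borel \<Longrightarrow> A \<in> sets borel"
  by (auto simp: circle_borel_def sets_restrict_space intro: sets.Int[OF borel_closed[OF closed_sphere]])

lemma measurable_circle_borel_id: "(\<lambda>x. x) \<in> measurable circle_borel borel"
  unfolding circle_borel_def by (rule measurable_restrict_space1) simp

text \<open>A measure over \<open>circle_borel\<close> has the circle as its space; this copy lives
  on the plane, where the Poisson and maximal estimates are stated.\<close>

definition extend :: "complex measure \<Rightarrow> complex measure" where
  "extend \<nu> = distr \<nu> borel (\<lambda>x. x)"

lemma sets_extend: "sets (extend \<nu>) = sets borel"
  by (simp add: extend_def)

lemma
  assumes "sets \<nu> = sets circle_borel"
  shows measurable_id_circle: "(\<lambda>x. x) \<in> measurable \<nu> borel"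
    and emeasure_extend: "A \<in> sets borel \<Longrightarrow> emeasure (extend \<nu>) A = emeasure \<nu> (A \<inter> sphere 0 1)"
proof -
  show m: "(\<lambda>x. x) \<in> measurable \<nu> borel"
    using measurable_circle_borel_id measurable_cong_sets[OF assms refl] by blast
  show "A \<in> sets borel \<Longrightarrow> emeasure (extend \<nu>) A = emeasure \<nu> (A \<inter> sphere 0 1)"
    unfolding extend_def using m sets_eq_imp_space_eq[OF assms] by (subst emeasure_distr) auto
qed

lemma Re_cayley:
  assumes "x \<noteq> 1"
  shows "Re ((1 + x) / (1 - x)) = (1 - (cmod x)\<^sup>2) / (cmod (1 - x))\<^sup>2"
proof -
  have "Re ((1 + x) * cnj (1 - x)) = 1 - (cmod x)\<^sup>2"
    unfolding cmod_power2 by (simp add: power2_eq_square algebra_simps)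
  then show ?thesis by (metis Re_divide_of_real complex_div_cnj)
qed

text \<open>As a \<open>lim\<close> along \<open>radial_seq\<close> the boundary function is total
  and measurable; by Fatou's theorem it is the radial limit almost everywhere.\<close>

lemma radial_boundary:
  assumes h: "h holomorphic_on ball 0 1" and bd: "\<And>z. cmod z < 1 \<Longrightarrow> cmod (h z) < 1"
  obtains b where "disk_self_map_boundary h b"
proof -
  interpret disk_self_map h using assms by unfold_locales
  define b where "b \<theta> = lim (\<lambda>n. h (of_real (radial_seq n) * cis \<theta>))" for \<theta>
  have m: "(\<lambda>\<theta>. h (of_real (radial_seq n) * cis \<theta>)) \<in> borel_measurable dtheta" for n
    by (intro measurable_dtheta_cont dilate_continuous_sphere h radial_seq)
  then have "b \<in> borel_measurable dtheta"
    unfolding b_def by (intro borel_measurable_lim_metric) auto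
  then have mb: "b \<in> borel_measurable borel" using measurable_cong_sets[OF sets_dtheta refl] by blast
  have "AE \<theta> in dtheta. ((\<lambda>r. h (of_real r * cis \<theta>)) \<longlongrightarrow> b \<theta>) (at_left 1)"
  proof (rule eventually_mono[OF fatou_bounded[OF h]])
    show "cmod (h z) \<le> 1" if "cmod z < 1" for z by (rule less_imp_le[OF bd[OF that]])
  next
    fix \<theta> assume "\<exists>l. ((\<lambda>r. h (of_real r * cis \<theta>)) \<longlongrightarrow> l) (at_left 1)"
    then obtain l where l: "((\<lambda>r. h (of_real r * cis \<theta>)) \<longlongrightarrow> l) (at_left 1)" by blast
    have "b \<theta> = l" unfolding b_def by (rule limI[OF radial_limit_seq[OF l]])
    then show "((\<lambda>r. h (of_real r * cis \<theta>)) \<longlongrightarrow> b \<theta>) (at_left 1)" using l by simp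
  qed
  then have "disk_self_map_boundary h b" using mb by unfold_locales
  then show ?thesis by (rule that)
qed

context nontrivial_circle
begin

text \<open>Re F is the Poisson integral of the measure, so \<open>fatou_measure\<close> applies
  once the measures are transferred to the plane.\<close>

lemma Re_caratheodory_limit:
  assumes "lebesgue_decomposition \<mu> w \<nu>"
  shows "AE \<theta> in dtheta. ((\<lambda>r. Re (caratheodory_fun \<mu> (of_real r * cis \<theta>))) \<longlongrightarrow> w \<theta>) (at_left 1)"
proof -
  have w: "w \<in> borel_measurable borel" and w0: "AE \<theta> in dtheta. 0 \<le> w \<theta>" and s\<nu>: "sets \<nu> = sets circle_borel"
    and sing: "singular_dtheta \<nu>"
    and dec: "\<And>A. A \<in> sets circle_borel \<Longrightarrow>
        emeasure \<mu> A = (\<integral>\<^sup>+\<theta>. ennreal (w \<theta>) * indicator A (cis \<theta>) \<partial>dtheta) + emeasure \<nu> A"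
    using assms measurable_cong_sets[OF sets_dtheta refl] unfolding lebesgue_decomposition_def by blast+
  obtain N where N: "N \<in> sets circle_borel" "emeasure \<nu> (sphere 0 1 - N) = 0"
      "emeasure (distr dtheta circle_borel cis) N = 0"
    using sing unfolding singular_dtheta_def by blast
  have Nb: "N \<in> sets borel" by (rule sets_circle_borelD[OF N(1)])
  have cc: "cis \<in> measurable dtheta circle_borel"
    unfolding circle_borel_def by (intro measurable_restrict_space2) auto
  have M: "circle_finite_measure (extend \<mu>)"
  proof (intro circle_finite_measure.intro circle_finite_measure_axioms.intro)
    show "finite_measure (extend \<mu>)"
      unfolding extend_def by (rule finite_measure_distr[OF measurable_id_circle[OF sets_mu]])
    show "sets (extend \<mu>) = sets borel" by (rule sets_extend)
    show "AE \<xi> in extend \<mu>. cmod \<xi> = 1"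
      unfolding extend_def using AE_space[of \<mu>]
      by (subst AE_distr_iff[OF measurable_id_circle[OF sets_mu]]) (auto elim: eventually_mono)
  qed
  \<comment> \<open>\<open>w\<close> is nonnegative only almost everywhere;
    \<open>max 0 (w \<theta>)\<close> is so everywhere and has the same value under
    \<open>ennreal\<close>.\<close>
  have "AE \<theta> in dtheta. ((\<lambda>r. poisson_int (extend \<mu>) r (cis \<theta>)) \<longlongrightarrow> max 0 (w \<theta>)) (at_left 1)"
  proof (rule fatou_measure[OF M sets_extend[of \<nu>] _ _ _ Nb])
    show "(\<lambda>\<theta>. max 0 (w \<theta>)) \<in> borel_measurable borel" using w by measurable
    fix A :: "complex set" assume A: "A \<in> sets borel"
    have "emeasure (extend \<mu>) A = (\<integral>\<^sup>+\<theta>. ennreal (w \<theta>) * indicator (A \<inter> sphere 0 1) (cis \<theta>) \<partial>dtheta) + emeasure \<nu> (A \<inter> sphere 0 1)"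
      unfolding emeasure_extend[OF sets_mu A] by (rule dec[OF sets_circle_borelI[OF A]])
    also have "emeasure \<nu> (A \<inter> sphere 0 1) = emeasure (extend \<nu>) A" by (rule emeasure_extend[OF s\<nu> A, symmetric])
    also have "(\<integral>\<^sup>+\<theta>. ennreal (w \<theta>) * indicator (A \<inter> sphere 0 1) (cis \<theta>) \<partial>dtheta)
        = (\<integral>\<^sup>+\<theta>. ennreal (max 0 (w \<theta>)) * indicator A (cis \<theta>) \<partial>dtheta)"
      by (intro nn_integral_cong) (auto simp: indicator_def max_def ennreal_neg)
    finally show "emeasure (extend \<mu>) A = (\<integral>\<^sup>+\<theta>. ennreal (max 0 (w \<theta>)) * indicator A (cis \<theta>) \<partial>dtheta) + emeasure (extend \<nu>) A" .
  next
    have "- N \<in> sets borel" using Nb by (rule borel_comp)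
    then have "emeasure (extend \<nu>) (- N) = emeasure \<nu> (- N \<inter> sphere 0 1)" by (rule emeasure_extend[OF s\<nu>])
    also have "- N \<inter> sphere 0 1 = sphere 0 1 - N" by auto
    finally show "emeasure (extend \<nu>) (- N) = 0" using N(2) by simp
    show "emeasure arc_measure N = 0"
      using N(3) Nb N(1) cc unfolding arc_measure_def by (simp add: emeasure_distr)
  qed auto
  then show ?thesis
    using w0
  proof eventually_elim
    fix \<theta> assume l: "((\<lambda>r. poisson_int (extend \<mu>) r (cis \<theta>)) \<longlongrightarrow> max 0 (w \<theta>)) (at_left 1)" and "0 \<le> w \<theta>"
    then have "((\<lambda>r. poisson_int (extend \<mu>) r (cis \<theta>)) \<longlongrightarrow> w \<theta>) (at_left 1)" by simp
    then show "((\<lambda>r. Re (caratheodory_fun \<mu> (of_real r * cis \<theta>))) \<longlongrightarrow> w \<theta>) (at_left 1)"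
    proof (rule Lim_transform_eventually)
      show "eventually (\<lambda>r. poisson_int (extend \<mu>) r (cis \<theta>) = Re (caratheodory_fun \<mu> (of_real r * cis \<theta>))) (at_left 1)"
        using eventually_radial
      proof eventually_elim
        fix r :: real assume "0 < r \<and> r < 1"
        then have z: "cmod (of_real r * cis \<theta>) < 1" by (simp add: norm_mult)
        have "poisson_int (extend \<mu>) r (cis \<theta>) = (LINT \<xi>|\<mu>. poisson (of_real r * cis \<theta>) \<xi>)"
          unfolding poisson_int_def extend_def by (intro integral_distr measurable_id_circle sets_mu measurable_poisson)
        then show "poisson_int (extend \<mu>) r (cis \<theta>) = Re (caratheodory_fun \<mu> (of_real r * cis \<theta>))"
          by (simp add: Re_caratheodory[OF z] poisson_def)
      qed
    qed
  qed
qed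

lemma schur_boundary:
  obtains b where "disk_self_map_boundary sf b" "disk_self_map_boundary (\<lambda>z. z * sf z) (\<lambda>\<theta>. cis \<theta> * b \<theta>)"
proof -
  have hol: "sf holomorphic_on ball 0 1" using schur_class_sf by (simp add: schur_class_def)
  obtain b where b: "disk_self_map_boundary sf b" using radial_boundary[OF hol sf_less] by blast
  interpret disk_self_map_boundary sf b by (rule b)
  have "disk_self_map_boundary (\<lambda>z. z * sf z) (\<lambda>\<theta>. cis \<theta> * b \<theta>)"
  proof
    show "(\<lambda>z. z * sf z) holomorphic_on ball 0 1" by (intro holomorphic_intros hol)
    show "cmod (z * sf z) < 1" if "cmod z < 1" for z
      using norm_mult_less_1[OF that less_imp_le[OF sf_less[OF that]]] .
    show "(\<lambda>\<theta>. cis \<theta> * b \<theta>) \<in> borel_measurable borel" by measurable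
    show "AE \<theta> in dtheta. ((\<lambda>r. complex_of_real r * cis \<theta> * sf (of_real r * cis \<theta>)) \<longlongrightarrow> cis \<theta> * b \<theta>) (at_left 1)"
      using lim_b
    proof eventually_elim
      fix \<theta> assume "((\<lambda>r. sf (of_real r * cis \<theta>)) \<longlongrightarrow> b \<theta>) (at_left 1)"
      then have "((\<lambda>r. complex_of_real r * cis \<theta> * sf (of_real r * cis \<theta>)) \<longlongrightarrow> complex_of_real 1 * cis \<theta> * b \<theta>) (at_left 1)"
        by (intro tendsto_mult tendsto_of_real tendsto_ident_at tendsto_const)
      then show "((\<lambda>r. complex_of_real r * cis \<theta> * sf (of_real r * cis \<theta>)) \<longlongrightarrow> cis \<theta> * b \<theta>) (at_left 1)" by simp
    qed
  qed
  then show ?thesis using that b by blast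
qed

text \<open>The radial limit of Re F is computed in two ways: as the weight, and through the Cayley
  transform of z f, whose denominator is nonzero almost everywhere by
  \<open>boundary_ne_1\<close>.\<close>

lemma weight_boundary:
  assumes dec: "lebesgue_decomposition \<mu> w \<nu>" and b: "disk_self_map_boundary (\<lambda>z. z * sf z) (\<lambda>\<theta>. cis \<theta> * b \<theta>)"
  shows "AE \<theta> in dtheta. w \<theta> = (1 - (cmod (b \<theta>))\<^sup>2) / (cmod (1 - cis \<theta> * b \<theta>))\<^sup>2"
proof -
  interpret disk_self_map_boundary "\<lambda>z. z * sf z" "\<lambda>\<theta>. cis \<theta> * b \<theta>" by (rule b)
  show ?thesis
    using Re_caratheodory_limit[OF dec] lim_b boundary_ne_1
  proof eventually_elim
    fix \<theta> assume w: "((\<lambda>r. Re (caratheodory_fun \<mu> (of_real r * cis \<theta>))) \<longlongrightarrow> w \<theta>) (at_left 1)"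
      and l: "((\<lambda>r. complex_of_real r * cis \<theta> * sf (of_real r * cis \<theta>)) \<longlongrightarrow> cis \<theta> * b \<theta>) (at_left 1)"
      and ne: "cis \<theta> * b \<theta> \<noteq> 1"
    have "((\<lambda>r. Re ((1 + complex_of_real r * cis \<theta> * sf (of_real r * cis \<theta>)) / (1 - complex_of_real r * cis \<theta> * sf (of_real r * cis \<theta>))))
       \<longlongrightarrow> Re ((1 + cis \<theta> * b \<theta>) / (1 - cis \<theta> * b \<theta>))) (at_left 1)"
      using ne by (intro tendsto_Re tendsto_divide tendsto_add tendsto_diff tendsto_const l) auto
    then have "((\<lambda>r. Re (caratheodory_fun \<mu> (of_real r * cis \<theta>))) \<longlongrightarrow> Re ((1 + cis \<theta> * b \<theta>) / (1 - cis \<theta> * b \<theta>))) (at_left 1)"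
    proof (rule Lim_transform_eventually)
      show "eventually (\<lambda>r. Re ((1 + complex_of_real r * cis \<theta> * sf (of_real r * cis \<theta>)) / (1 - complex_of_real r * cis \<theta> * sf (of_real r * cis \<theta>)))
         = Re (caratheodory_fun \<mu> (of_real r * cis \<theta>))) (at_left 1)"
        using eventually_radial
      proof eventually_elim
        fix r :: real assume "0 < r \<and> r < 1"
        then have z: "cmod (of_real r * cis \<theta>) < 1" by (simp add: norm_mult)
        then show "Re ((1 + complex_of_real r * cis \<theta> * sf (of_real r * cis \<theta>)) / (1 - complex_of_real r * cis \<theta> * sf (of_real r * cis \<theta>)))
          = Re (caratheodory_fun \<mu> (of_real r * cis \<theta>))"
          by (simp only: caratheodory_sf)
      qed
    qed
    then have "w \<theta> = Re ((1 + cis \<theta> * b \<theta>) / (1 - cis \<theta> * b \<theta>))"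
      using tendsto_unique[OF _ w] by auto
    also have "\<dots> = (1 - (cmod (b \<theta>))\<^sup>2) / (cmod (1 - cis \<theta> * b \<theta>))\<^sup>2"
      using Re_cayley[OF ne] by (simp add: norm_mult)
    finally show "w \<theta> = (1 - (cmod (b \<theta>))\<^sup>2) / (cmod (1 - cis \<theta> * b \<theta>))\<^sup>2" .
  qed
qed

end

section \<open>The logarithm of \<open>relative_szego\<close>\<close>

context stripped_pair
begin

lemma disk_self_maps:
  shows self0: "disk_self_map (\<lambda>z. z * sf z)" and self1: "disk_self_map (\<lambda>z. z * one.sf z)"
    and selfa: "disk_self_map (\<lambda>z. cnj (\<alpha> 0) * sf z)"
proof -
  show "disk_self_map (\<lambda>z. z * sf z)"
  proof
    show "cmod (z * sf z) < 1" if "cmod z < 1" for z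
      using norm_mult_less_1[OF that less_imp_le[OF sf_less[OF that]]] .
  qed (intro holomorphic_intros sf_holomorphic)
  show "disk_self_map (\<lambda>z. z * one.sf z)"
  proof
    show "cmod (z * one.sf z) < 1" if "cmod z < 1" for z
      using norm_mult_less_1[OF that less_imp_le[OF one.sf_less[OF that]]] .
  qed (intro holomorphic_intros sf_holomorphic)
  show "disk_self_map (\<lambda>z. cnj (\<alpha> 0) * sf z)"
  proof
    show "cmod (cnj (\<alpha> 0) * sf z) < 1" if "cmod z < 1" for z
      using norm_cnj_mult_less[OF cmod_verblunsky less_imp_le[OF sf_less[OF that]]] .
  qed (intro holomorphic_intros sf_holomorphic)
qed

sublocale g0: disk_self_map "\<lambda>z. z * sf z" by (rule self0)
sublocale g1: disk_self_map "\<lambda>z. z * one.sf z" by (rule self1)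
sublocale ga: disk_self_map "\<lambda>z. cnj (\<alpha> 0) * sf z" by (rule selfa)

text \<open>Principal logarithms of the separate factors are added; the result is a branch, not
  necessarily the principal logarithm of the product.\<close>

definition log_delta :: "complex \<Rightarrow> complex" where
  "log_delta z = ga.log1m z + g1.log1m z - g0.log1m z - of_real (ln \<rho>)"

lemma exp_log_delta:
  assumes "cmod z < 1"
  shows "exp (log_delta z) = \<delta> z"
proof -
  have "exp (complex_of_real (ln \<rho>)) = complex_of_real \<rho>"
    using rho_pos by (simp add: exp_of_real)
  then show ?thesis
    unfolding log_delta_def relative_szego_eq exp_diff exp_add
    using assms by (simp add: ga.exp_log1m g1.exp_log1m g0.exp_log1m)
qed

lemma log_delta_holomorphic: "log_delta holomorphic_on ball 0 1"
  unfolding log_delta_def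
  by (intro holomorphic_intros ga.log1m_holomorphic g0.log1m_holomorphic g1.log1m_holomorphic)

lemma log_delta_hardy:
  assumes "p > 0"
  shows "log_delta \<in> hardy_space p"
proof -
  have "(\<lambda>z. ga.log1m z + g1.log1m z + - g0.log1m z + - of_real (ln \<rho>)) \<in> hardy_space p"
    by (intro hardy_space_add hardy_space_uminus hardy_space_const ga.log1m_hardy g0.log1m_hardy g1.log1m_hardy assms)
  then show ?thesis by (rule hardy_space_cong) (simp add: log_delta_def)
qed

text \<open>Two branches differ by a constant, because their difference has exponential 1 and
  therefore derivative 0 on a connected set; constants lie in every Hardy space.\<close>

lemma log_branch_hardy:
  assumes L: "holomorphic_log_branch \<delta> L" and p: "p > 0"
  shows "L \<in> hardy_space p"
proof -
  have Lh: "L holomorphic_on ball 0 1" and eL: "\<And>z. z \<in> ball 0 1 \<Longrightarrow> exp (L z) = \<delta> z"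
    using L by (auto simp: holomorphic_log_branch_def)
  define h where "h z = L z - log_delta z" for z
  have hh: "h holomorphic_on ball 0 1" unfolding h_def by (intro holomorphic_intros Lh log_delta_holomorphic)
  have e1: "exp (h z) = 1" if "z \<in> ball 0 1" for z
    using eL[OF that] exp_log_delta[of z] relative_szego_nonzero[of z] that by (simp add: h_def exp_diff)
  have "DERIV h z :> 0" if z: "z \<in> ball 0 1" for z
  proof -
    have d: "(h has_field_derivative deriv h z) (at z)"
      by (rule holomorphic_derivI[OF hh _ z]) auto
    then have "((\<lambda>z. exp (h z)) has_field_derivative exp (h z) * deriv h z) (at z)"
      by (auto intro!: derivative_eq_intros)
    moreover have "((\<lambda>z. exp (h z)) has_field_derivative 0) (at z)"
      by (rule has_field_derivative_transform_within_open[where f = "\<lambda>_. 1" and S = "ball 0 1"])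
         (use z e1 in auto)
    ultimately have "exp (h z) * deriv h z = 0" by (rule DERIV_unique)
    then show ?thesis using d by simp
  qed
  then obtain c where c: "\<And>z. z \<in> ball 0 1 \<Longrightarrow> h z = c"
    using DERIV_zero_connected_constant[of "ball 0 1" "{}" h] holomorphic_on_imp_continuous_on[OF hh]
    by (metis Diff_empty connected_ball finite.emptyI open_ball)
  have "(\<lambda>z. log_delta z + c) \<in> hardy_space p"
    by (intro hardy_space_add hardy_space_const log_delta_hardy p)
  then show ?thesis by (rule hardy_space_cong) (use c in \<open>force simp: h_def algebra_simps\<close>)
qed

end

section \<open>Szego functions and the entropy bound\<close>

lemma integrable_herglotz_mult:
  assumes z: "cmod z < 1" and g: "integrable dtheta g"
  shows "integrable dtheta (\<lambda>\<theta>. herglotz z (cis \<theta>) * complex_of_real (g \<theta>))"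
proof -
  obtain B where B: "\<And>\<theta>. norm (herglotz z (cis \<theta>)) \<le> B" using sphere_bounded[OF herglotz_continuous[OF z]] by blast
  have mh: "(\<lambda>\<theta>. herglotz z (cis \<theta>)) \<in> borel_measurable dtheta"
    by (rule measurable_dtheta_cont[OF herglotz_continuous[OF z]])
  show ?thesis
  proof (rule Bochner_Integration.integrable_bound)
    show "integrable dtheta (\<lambda>\<theta>. B * \<bar>g \<theta>\<bar>)" using g by (intro integrable_mult_right integrable_abs)
    show "(\<lambda>\<theta>. herglotz z (cis \<theta>) * complex_of_real (g \<theta>)) \<in> borel_measurable dtheta"
      using mh borel_measurable_integrable[OF g] by measurable
    have "norm (herglotz z (cis \<theta>) * complex_of_real (g \<theta>)) \<le> norm (B * \<bar>g \<theta>\<bar>)" for \<theta>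
    proof -
      have "norm (herglotz z (cis \<theta>)) * \<bar>g \<theta>\<bar> \<le> B * \<bar>g \<theta>\<bar>" by (intro mult_right_mono B) auto
      also have "\<dots> \<le> norm (B * \<bar>g \<theta>\<bar>)" unfolding real_norm_def by (rule abs_ge_self)
      finally show ?thesis by (simp add: norm_mult)
    qed
    then show "AE \<theta> in dtheta. norm (herglotz z (cis \<theta>) * complex_of_real (g \<theta>)) \<le> norm (B * \<bar>g \<theta>\<bar>)" by simp
  qed
qed

text \<open>The 1/2 is what remains of 4 pi after the 2 pi of the probability measure.\<close>

lemma szego_fun_dtheta:
  assumes z: "cmod z < 1" and w: "w \<in> borel_measurable borel"
  shows "szego_fun w z = exp ((LINT \<theta>|dtheta. herglotz z (cis \<theta>) * complex_of_real (ln (w \<theta>))) / 2)"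
proof -
  have "(\<lambda>\<theta>. herglotz z (cis \<theta>)) \<in> borel_measurable borel"
    using measurable_dtheta_cont[OF herglotz_continuous[OF z]] measurable_cong_sets[OF sets_dtheta refl] by blast
  then have m: "(\<lambda>\<theta>. herglotz z (cis \<theta>) * complex_of_real (ln (w \<theta>) / (4 * pi))) \<in> borel_measurable borel"
    using w by measurable
  have "(LINT \<theta>:{0..2*pi}|lborel. herglotz z (cis \<theta>) * complex_of_real (ln (w \<theta>) / (4 * pi)))
     = (2 * pi) *\<^sub>R (LINT \<theta>|dtheta. herglotz z (cis \<theta>) * complex_of_real (ln (w \<theta>) / (4 * pi)))"
    unfolding integral_dtheta[OF m] by simp
  also have "(LINT \<theta>|dtheta. herglotz z (cis \<theta>) * complex_of_real (ln (w \<theta>) / (4 * pi)))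
     = (LINT \<theta>|dtheta. herglotz z (cis \<theta>) * complex_of_real (ln (w \<theta>)) / complex_of_real (4 * pi))"
    by (simp only: of_real_divide times_divide_eq_right)
  also have "\<dots> = (LINT \<theta>|dtheta. herglotz z (cis \<theta>) * complex_of_real (ln (w \<theta>))) / complex_of_real (4 * pi)"
    by (rule integral_divide_zero)
  also have "(2 * pi) *\<^sub>R \<dots> = (LINT \<theta>|dtheta. herglotz z (cis \<theta>) * complex_of_real (ln (w \<theta>))) / 2"
    by (simp add: scaleR_conv_of_real)
  finally show ?thesis
    unfolding szego_fun_def herglotz_def[symmetric] by (simp only:)
qed

text \<open>The logarithm of \<open>mobius_defect\<close> at -a. For u = z s(z) the last term is the
  real part of a holomorphic function vanishing at 0, so it averages out over circles.\<close>

lemma schur_approx_Suc_defect: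
  assumes a: "cmod a < 1" and u: "cmod u < 1"
  shows "- ln (1 - (cmod ((a + u) / (1 + cnj a * u)))\<^sup>2)
     = - ln (1 - (cmod a)\<^sup>2) - ln (1 - (cmod u)\<^sup>2) + 2 * ln (cmod (1 + cnj a * u))"
proof -
  have nz: "1 + cnj a * u \<noteq> 0" by (intro one_plus_nonzero norm_cnj_mult_less a less_imp_le u)
  have pos: "1 - (cmod a)\<^sup>2 > 0" "1 - (cmod u)\<^sup>2 > 0" using a u by (simp_all add: abs_square_less_1)
  have "(cmod (1 + cnj a * u))\<^sup>2 - (cmod (a + u))\<^sup>2 = (1 - (cmod a)\<^sup>2) * (1 - (cmod u)\<^sup>2)"
    using mobius_defect[of "- a" u] by (simp add: add.commute)
  then have "1 - (cmod ((a + u) / (1 + cnj a * u)))\<^sup>2 = (1 - (cmod a)\<^sup>2) * (1 - (cmod u)\<^sup>2) / (cmod (1 + cnj a * u))\<^sup>2"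
    using nz by (simp add: norm_divide power_divide field_simps)
  then show ?thesis
    using pos nz by (simp add: ln_div ln_mult ln_realpow)
qed

text \<open>Boyd's sum rule as an inequality: each Schur step changes the mean of $-\log(1-|s|^2)$ by at
  most $-\log(1-|a_0|^2)$, because $\log|1+\bar a_0zs|$ is harmonic and vanishes at $0$.\<close>

lemma schur_approx_entropy:
  fixes r :: real
  assumes a: "\<And>j. cmod (a j) < 1" and r: "0 < r" "r < 1"
  shows "(LINT \<theta>|dtheta. - ln (1 - (cmod (schur_approx n a (of_real r * cis \<theta>)))\<^sup>2))
     \<le> (\<Sum>j<n. - ln (1 - (cmod (a j))\<^sup>2))"
  using a
proof (induction n arbitrary: a)
  case (Suc n)
  define s where "s = schur_approx n (\<lambda>j. a (Suc j))"
  have sh: "s holomorphic_on ball 0 1" unfolding s_def by (rule schur_approx_holomorphic) (rule Suc.prems)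
  have sl: "cmod (s z) < 1" if "cmod z < 1" for z
    unfolding s_def by (rule schur_approx_less) (use Suc.prems that in auto)
  let ?z = "\<lambda>\<theta>. complex_of_real r * cis \<theta>"
  have z1: "cmod (?z \<theta>) < 1" for \<theta> using r by (simp add: norm_mult)
  \<comment> \<open>The sign makes \<open>1 - g\<close> the denominator of the Schur step, and the
    factor z makes its logarithm vanish at 0.\<close>
  have "disk_self_map (\<lambda>z. - cnj (a 0) * (z * s z))"
  proof
    show "cmod (- cnj (a 0) * (z * s z)) < 1" if "cmod z < 1" for z
      using norm_cnj_mult_less[OF Suc.prems[of 0] less_imp_le[OF norm_mult_less_1[OF that less_imp_le[OF sl[OF that]]]]]
      by simp
  qed (intro holomorphic_intros sh)
  then interpret q: disk_self_map "\<lambda>z. - cnj (a 0) * (z * s z)" .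
  have ReL: "ln (cmod (1 + cnj (a 0) * (?z \<theta> * s (?z \<theta>)))) = Re (q.log1m (?z \<theta>))" for \<theta>
    using q.Re_log1m[OF z1[of \<theta>]] by simp
  have cs: "continuous_on (sphere 0 1) (\<lambda>\<xi>. s (of_real r * \<xi>))" by (rule dilate_continuous_sphere[OF sh r])
  have cq: "continuous_on (sphere 0 1) (\<lambda>\<xi>. q.log1m (of_real r * \<xi>))" by (rule dilate_continuous_sphere[OF q.log1m_holomorphic r])
  have spl: "cmod (of_real r * \<xi>) < 1" if "\<xi> \<in> sphere 0 1" for \<xi> :: complex using that r by (simp add: norm_mult)
  have sq: "(cmod x)\<^sup>2 < 1" if "cmod x < 1" for x :: complex using that by (simp add: abs_square_less_1)
  have i1: "integrable dtheta (\<lambda>\<theta>. - ln (1 - (cmod (s (?z \<theta>)))\<^sup>2))"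
    by (rule integrable_dtheta_cont[where f = "\<lambda>\<xi>. - ln (1 - (cmod (s (of_real r * \<xi>)))\<^sup>2)"])
       (intro continuous_intros cs, use sq sl spl in force)
  have i2: "integrable dtheta (\<lambda>\<theta>. - ln (1 - (cmod (?z \<theta> * s (?z \<theta>)))\<^sup>2))"
    by (rule integrable_dtheta_cont[where f = "\<lambda>\<xi>. - ln (1 - (cmod (of_real r * \<xi> * s (of_real r * \<xi>)))\<^sup>2)"])
       (intro continuous_intros cs, use sq[OF norm_mult_less_1[OF spl less_imp_le[OF sl[OF spl]]]] in force)
  have i3: "integrable dtheta (\<lambda>\<theta>. q.log1m (?z \<theta>))" by (rule integrable_dtheta_cont[OF cq])
  have "(LINT \<theta>|dtheta. q.log1m (?z \<theta>)) = q.log1m 0"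
    using mean_value_circle[OF dilate_continuous[OF q.log1m_holomorphic r] dilate_holomorphic[OF q.log1m_holomorphic r]] by simp
  also have "q.log1m 0 = 0" unfolding q.log1m_def by simp
  finally have m3: "(LINT \<theta>|dtheta. Re (q.log1m (?z \<theta>))) = 0" using i3 by simp
  have "(LINT \<theta>|dtheta. - ln (1 - (cmod (schur_approx (Suc n) a (?z \<theta>)))\<^sup>2))
     = (LINT \<theta>|dtheta. - ln (1 - (cmod (a 0))\<^sup>2) + (- ln (1 - (cmod (?z \<theta> * s (?z \<theta>)))\<^sup>2)) + 2 * Re (q.log1m (?z \<theta>)))"
  proof (intro Bochner_Integration.integral_cong refl)
    fix \<theta>
    have "- ln (1 - (cmod (schur_approx (Suc n) a (?z \<theta>)))\<^sup>2)
       = - ln (1 - (cmod (a 0))\<^sup>2) - ln (1 - (cmod (?z \<theta> * s (?z \<theta>)))\<^sup>2) + 2 * ln (cmod (1 + cnj (a 0) * (?z \<theta> * s (?z \<theta>))))"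
      unfolding schur_approx.simps s_def[symmetric]
      by (rule schur_approx_Suc_defect[OF Suc.prems norm_mult_less_1[OF z1 less_imp_le[OF sl[OF z1]]]])
    then show "- ln (1 - (cmod (schur_approx (Suc n) a (?z \<theta>)))\<^sup>2)
       = - ln (1 - (cmod (a 0))\<^sup>2) + (- ln (1 - (cmod (?z \<theta> * s (?z \<theta>)))\<^sup>2)) + 2 * Re (q.log1m (?z \<theta>))"
      unfolding ReL by linarith
  qed
  also have "\<dots> = - ln (1 - (cmod (a 0))\<^sup>2) + (LINT \<theta>|dtheta. - ln (1 - (cmod (?z \<theta> * s (?z \<theta>)))\<^sup>2))"
  proof -
    have "(LINT \<theta>|dtheta. - ln (1 - (cmod (a 0))\<^sup>2) + (- ln (1 - (cmod (?z \<theta> * s (?z \<theta>)))\<^sup>2)) + 2 * Re (q.log1m (?z \<theta>)))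
      = (LINT \<theta>|dtheta. - ln (1 - (cmod (a 0))\<^sup>2) + (- ln (1 - (cmod (?z \<theta> * s (?z \<theta>)))\<^sup>2))) + (LINT \<theta>|dtheta. 2 * Re (q.log1m (?z \<theta>)))"
      by (intro Bochner_Integration.integral_add Bochner_Integration.integrable_add i2 integrable_mult_right integrable_Re i3) auto
    also have "(LINT \<theta>|dtheta. - ln (1 - (cmod (a 0))\<^sup>2) + (- ln (1 - (cmod (?z \<theta> * s (?z \<theta>)))\<^sup>2)))
      = (LINT \<theta>|dtheta. - ln (1 - (cmod (a 0))\<^sup>2)) + (LINT \<theta>|dtheta. - ln (1 - (cmod (?z \<theta> * s (?z \<theta>)))\<^sup>2))"
      by (intro Bochner_Integration.integral_add i2) auto
    also have "(LINT \<theta>|dtheta. - ln (1 - (cmod (a 0))\<^sup>2)) = - ln (1 - (cmod (a 0))\<^sup>2)"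
      using dtheta.prob_space by simp
    also have "(LINT \<theta>|dtheta. 2 * Re (q.log1m (?z \<theta>))) = 0" using m3 by simp
    finally show ?thesis by simp
  qed
  \<comment> \<open>The one inequality within a Schur step: the factor of modulus r < 1 is dropped,
    which leaves the integral of the induction hypothesis.\<close>
  also have "(LINT \<theta>|dtheta. - ln (1 - (cmod (?z \<theta> * s (?z \<theta>)))\<^sup>2)) \<le> (LINT \<theta>|dtheta. - ln (1 - (cmod (s (?z \<theta>)))\<^sup>2))"
  proof (rule integral_mono[OF i2 i1])
    fix \<theta>
    have "r * cmod (s (?z \<theta>)) \<le> 1 * cmod (s (?z \<theta>))" using r by (intro mult_right_mono) auto
    then have "(cmod (?z \<theta> * s (?z \<theta>)))\<^sup>2 \<le> (cmod (s (?z \<theta>)))\<^sup>2"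
      using r by (intro power_mono) (auto simp: norm_mult)
    then have "ln (1 - (cmod (s (?z \<theta>)))\<^sup>2) \<le> ln (1 - (cmod (?z \<theta> * s (?z \<theta>)))\<^sup>2)"
      using sq[OF sl[OF z1]] by (intro ln_mono) auto
    then show "- ln (1 - (cmod (?z \<theta> * s (?z \<theta>)))\<^sup>2) \<le> - ln (1 - (cmod (s (?z \<theta>)))\<^sup>2)" by simp
  qed
  also have "\<dots> \<le> (\<Sum>j<n. - ln (1 - (cmod (a (Suc j)))\<^sup>2))"
    unfolding s_def by (rule Suc.IH) (rule Suc.prems)
  finally show ?case
    by (simp add: sum.lessThan_Suc_shift del: sum.lessThan_Suc)
qed simp

lemma neg_ln_one_minus_nonneg: "x \<ge> 0 \<Longrightarrow> x < 1 \<Longrightarrow> 0 \<le> - ln (1 - x)" for x :: real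
  using ln_le_zero_iff[of "1 - x"] by simp

text \<open>-ln (1-x) <= x/(1-x) <= 2x once x < 1/2, which holds eventually.\<close>

lemma summable_neg_ln:
  fixes x :: "nat \<Rightarrow> real"
  assumes "summable x" and "\<And>j. 0 \<le> x j" "\<And>j. x j < 1"
  shows "summable (\<lambda>j. - ln (1 - x j))"
proof (rule summable_comparison_test_ev[OF _ summable_mult[OF assms(1), of 2]])
  have "eventually (\<lambda>j. x j < 1 / 2) sequentially"
    using order_tendstoD(2)[OF summable_LIMSEQ_zero[OF assms(1)], of "1 / 2"] by simp
  then show "eventually (\<lambda>j. norm (- ln (1 - x j)) \<le> 2 * x j) sequentially"
  proof eventually_elim
    fix j assume j: "x j < 1 / 2"
    have "ln (inverse (1 - x j)) \<le> inverse (1 - x j) - 1" using j by (intro ln_le_minus_one) auto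
    also have "\<dots> \<le> 2 * x j"
    proof -
      have "0 \<le> x j * (1 - 2 * x j)" using j assms(2) by simp
      then show ?thesis using j by (simp add: field_simps power2_eq_square)
    qed
    finally have "- ln (1 - x j) \<le> 2 * x j" using j by (simp add: ln_inverse)
    then show "norm (- ln (1 - x j)) \<le> 2 * x j"
      using neg_ln_one_minus_nonneg[OF assms(2,3), of j] by simp
  qed
qed

context nontrivial_circle
begin

text \<open>Fatou's lemma is applied twice: over the approximants at a fixed radius, which gives the
  entropy bound for f, and along radii tending to 1. A boundary value of modulus 1 would make the
  second liminf infinite.\<close>

lemma boundary_entropy:
  assumes summ: "summable (\<lambda>j. (cmod (\<alpha> j))\<^sup>2)" and b: "disk_self_map_boundary sf b"
  shows "AE \<theta> in dtheta. cmod (b \<theta>) < 1" "integrable dtheta (\<lambda>\<theta>. ln (1 - (cmod (b \<theta>))\<^sup>2))"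
proof -
  interpret disk_self_map_boundary sf b by (rule b)
  have sq: "(cmod x)\<^sup>2 < 1" if "cmod x < 1" for x :: complex using that by (simp add: abs_square_less_1)
  define C where "C = (\<Sum>j. - ln (1 - (cmod (\<alpha> j))\<^sup>2))"
  have sC: "summable (\<lambda>j. - ln (1 - (cmod (\<alpha> j))\<^sup>2))"
    by (rule summable_neg_ln[OF summ]) (use sq[OF cmod_verblunsky] in auto)
  have bound: "(\<integral>\<^sup>+\<theta>. ennreal (- ln (1 - (cmod (sf (of_real r * cis \<theta>)))\<^sup>2)) \<partial>dtheta) \<le> ennreal C"
    if r: "0 < r" "r < 1" for r :: real
  proof -
    let ?z = "\<lambda>\<theta>. complex_of_real r * cis \<theta>"
    have z1: "cmod (?z \<theta>) < 1" for \<theta> using r by (simp add: norm_mult)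
    let ?u = "\<lambda>n \<theta>. ennreal (- ln (1 - (cmod (schur_approx n \<alpha> (?z \<theta>)))\<^sup>2))"
    have cS: "continuous_on (sphere 0 1) (\<lambda>\<xi>. schur_approx n \<alpha> (of_real r * \<xi>))" for n
      by (rule dilate_continuous_sphere[OF schur_approx_holomorphic[OF cmod_verblunsky] r])
    have spl: "cmod (of_real r * \<xi>) < 1" if "\<xi> \<in> sphere 0 1" for \<xi> :: complex using that r by (simp add: norm_mult)
    have int: "integrable dtheta (\<lambda>\<theta>. - ln (1 - (cmod (schur_approx n \<alpha> (?z \<theta>)))\<^sup>2))" for n
    proof (rule integrable_dtheta_cont[where f = "\<lambda>\<xi>. - ln (1 - (cmod (schur_approx n \<alpha> (of_real r * \<xi>)))\<^sup>2)"],
        intro continuous_intros cS ballI)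
      fix \<xi> :: complex assume "\<xi> \<in> sphere 0 1"
      then have "(cmod (schur_approx n \<alpha> (of_real r * \<xi>)))\<^sup>2 < 1"
        by (intro sq schur_approx_less cmod_verblunsky spl)
      then show "1 - (cmod (schur_approx n \<alpha> (of_real r * \<xi>)))\<^sup>2 \<noteq> 0" by simp
    qed
    have "(\<integral>\<^sup>+\<theta>. ennreal (- ln (1 - (cmod (sf (?z \<theta>)))\<^sup>2)) \<partial>dtheta) = (\<integral>\<^sup>+\<theta>. liminf (\<lambda>n. ?u n \<theta>) \<partial>dtheta)"
    proof (intro nn_integral_cong)
      fix \<theta>
      have "1 - (cmod (sf (?z \<theta>)))\<^sup>2 \<noteq> 0" using sq[OF sf_less[OF z1[of \<theta>]]] by simp
      then have "(\<lambda>n. ?u n \<theta>) \<longlonglongrightarrow> ennreal (- ln (1 - (cmod (sf (?z \<theta>)))\<^sup>2))"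
        by (intro tendsto_ennrealI tendsto_intros schur_approx_tendsto_sf z1)
      then show "ennreal (- ln (1 - (cmod (sf (?z \<theta>)))\<^sup>2)) = liminf (\<lambda>n. ?u n \<theta>)"
        by (intro lim_imp_Liminf[symmetric]) auto
    qed
    also have "\<dots> \<le> liminf (\<lambda>n. \<integral>\<^sup>+\<theta>. ?u n \<theta> \<partial>dtheta)"
      using borel_measurable_integrable[OF int] by (intro nn_integral_liminf measurable_compose[OF _ measurable_ennreal])
    also have "\<dots> \<le> liminf (\<lambda>n. ennreal C)"
    proof (intro Liminf_mono always_eventually allI)
      fix n
      have "(\<integral>\<^sup>+\<theta>. ?u n \<theta> \<partial>dtheta) = ennreal (LINT \<theta>|dtheta. - ln (1 - (cmod (schur_approx n \<alpha> (?z \<theta>)))\<^sup>2))"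
        using neg_ln_one_minus_nonneg[OF _ sq[OF schur_approx_less[where a = \<alpha>, OF cmod_verblunsky z1]]]
        by (intro nn_integral_eq_integral int AE_I2) auto
      also have "\<dots> \<le> ennreal (\<Sum>j<n. - ln (1 - (cmod (\<alpha> j))\<^sup>2))"
        by (intro ennreal_leI schur_approx_entropy cmod_verblunsky r)
      also have "\<dots> \<le> ennreal C"
        unfolding C_def using neg_ln_one_minus_nonneg[OF _ sq[OF cmod_verblunsky]]
        by (intro ennreal_leI sum_le_suminf sC) auto
      finally show "(\<integral>\<^sup>+\<theta>. ?u n \<theta> \<partial>dtheta) \<le> ennreal C" .
    qed
    also have "\<dots> = ennreal C" by (simp add: Liminf_const)
    finally show ?thesis .
  qed
  let ?v = "\<lambda>n \<theta>. ennreal (- ln (1 - (cmod (sf (of_real (radial_seq n) * cis \<theta>)))\<^sup>2))"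
  have mS: "(\<lambda>\<theta>. sf (of_real (radial_seq n) * cis \<theta>)) \<in> borel_measurable dtheta" for n
    by (intro measurable_dtheta_cont dilate_continuous_sphere hol radial_seq)
  note [measurable] = mS
  have "(\<integral>\<^sup>+\<theta>. liminf (\<lambda>n. ?v n \<theta>) \<partial>dtheta) \<le> liminf (\<lambda>n. \<integral>\<^sup>+\<theta>. ?v n \<theta> \<partial>dtheta)"
    by (intro nn_integral_liminf) measurable
  also have "\<dots> \<le> liminf (\<lambda>n. ennreal C)"
    by (intro Liminf_mono always_eventually allI bound radial_seq)
  also have "\<dots> = ennreal C" by (simp add: Liminf_const)
  finally have le: "(\<integral>\<^sup>+\<theta>. liminf (\<lambda>n. ?v n \<theta>) \<partial>dtheta) \<le> ennreal C" .
  then have fin: "(\<integral>\<^sup>+\<theta>. liminf (\<lambda>n. ?v n \<theta>) \<partial>dtheta) \<noteq> \<infinity>" by (auto simp: top_unique)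
  have "AE \<theta> in dtheta. liminf (\<lambda>n. ?v n \<theta>) \<noteq> \<infinity>"
    by (rule nn_integral_noteq_infinite[OF _ fin]) measurable
  then show lt: "AE \<theta> in dtheta. cmod (b \<theta>) < 1"
    using lim_b_seq norm_b
  proof eventually_elim
    fix \<theta> assume f: "liminf (\<lambda>n. ?v n \<theta>) \<noteq> \<infinity>" and l: "(\<lambda>n. sf (of_real (radial_seq n) * cis \<theta>)) \<longlonglongrightarrow> b \<theta>"
      and b1: "cmod (b \<theta>) \<le> 1"
    show "cmod (b \<theta>) < 1"
    proof (rule ccontr)
      assume "\<not> cmod (b \<theta>) < 1"
      then have eq1: "cmod (b \<theta>) = 1" using b1 by simp
      define x where "x n = 1 - (cmod (sf (of_real (radial_seq n) * cis \<theta>)))\<^sup>2" for n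
      have "x \<longlonglongrightarrow> 1 - (cmod (b \<theta>))\<^sup>2" unfolding x_def by (intro tendsto_intros l)
      moreover have "0 < x n" for n unfolding x_def using sq[OF sf_less[OF norm_lt[of n \<theta>]]] by simp
      ultimately have "filterlim x (at_right 0) sequentially"
        unfolding filterlim_at using eq1 by (auto intro!: always_eventually simp: less_imp_neq[symmetric])
      then have "filterlim (\<lambda>n. ln (x n)) at_bot sequentially"
        by (rule filterlim_compose[OF ln_at_0])
      then have "filterlim (\<lambda>n. - ln (x n)) at_top sequentially"
        by (simp add: filterlim_uminus_at_bot)
      then have "(\<lambda>n. ?v n \<theta>) \<longlonglongrightarrow> \<infinity>"
        by (simp add: ennreal_tendsto_top_eq_at_top x_def)
      then have "liminf (\<lambda>n. ?v n \<theta>) = \<infinity>" by (intro lim_imp_Liminf) auto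
      then show False using f by simp
    qed
  qed
  show "integrable dtheta (\<lambda>\<theta>. ln (1 - (cmod (b \<theta>))\<^sup>2))"
  proof (rule integrableI_bounded)
    have "(\<integral>\<^sup>+\<theta>. ennreal (norm (ln (1 - (cmod (b \<theta>))\<^sup>2))) \<partial>dtheta) = (\<integral>\<^sup>+\<theta>. liminf (\<lambda>n. ?v n \<theta>) \<partial>dtheta)"
    proof (rule nn_integral_cong_AE, use lt lim_b_seq in eventually_elim)
      fix \<theta> assume b1: "cmod (b \<theta>) < 1" and l: "(\<lambda>n. sf (of_real (radial_seq n) * cis \<theta>)) \<longlonglongrightarrow> b \<theta>"
      have "1 - (cmod (b \<theta>))\<^sup>2 \<noteq> 0" using sq[OF b1] by simp
      then have "(\<lambda>n. ?v n \<theta>) \<longlonglongrightarrow> ennreal (- ln (1 - (cmod (b \<theta>))\<^sup>2))"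
        by (intro tendsto_ennrealI tendsto_intros l)
      then have "liminf (\<lambda>n. ?v n \<theta>) = ennreal (- ln (1 - (cmod (b \<theta>))\<^sup>2))"
        by (intro lim_imp_Liminf) auto
      moreover have "norm (ln (1 - (cmod (b \<theta>))\<^sup>2)) = - ln (1 - (cmod (b \<theta>))\<^sup>2)"
        using neg_ln_one_minus_nonneg[OF _ sq[OF b1]] by simp
      ultimately show "ennreal (norm (ln (1 - (cmod (b \<theta>))\<^sup>2))) = liminf (\<lambda>n. ?v n \<theta>)" by simp
    qed
    then show "(\<integral>\<^sup>+\<theta>. ennreal (norm (ln (1 - (cmod (b \<theta>))\<^sup>2))) \<partial>dtheta) < \<infinity>"
      using fin by (simp add: less_top)
  qed measurable
qed

end

section \<open>Boundary identities for the stripped pair\<close>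

locale stripped_boundary = stripped_pair +
  fixes b b1 :: "real \<Rightarrow> complex"
  assumes bd: "disk_self_map_boundary sf b" and bd0: "disk_self_map_boundary (\<lambda>z. z * sf z) (\<lambda>\<theta>. cis \<theta> * b \<theta>)"
    and bd': "disk_self_map_boundary one.sf b1" and bd1: "disk_self_map_boundary (\<lambda>z. z * one.sf z) (\<lambda>\<theta>. cis \<theta> * b1 \<theta>)"
begin

sublocale B: disk_self_map_boundary sf b by (rule bd)
sublocale B1: disk_self_map_boundary one.sf b1 by (rule bd')
sublocale G0: disk_self_map_boundary "\<lambda>z. z * sf z" "\<lambda>\<theta>. cis \<theta> * b \<theta>" by (rule bd0)
sublocale G1: disk_self_map_boundary "\<lambda>z. z * one.sf z" "\<lambda>\<theta>. cis \<theta> * b1 \<theta>" by (rule bd1)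
sublocale Ga: disk_self_map_boundary "\<lambda>z. cnj (\<alpha> 0) * sf z" "\<lambda>\<theta>. cnj (\<alpha> 0) * b \<theta>"
proof
  show "(\<lambda>\<theta>. cnj (\<alpha> 0) * b \<theta>) \<in> borel_measurable borel" by measurable
  show "AE \<theta> in dtheta. ((\<lambda>r. cnj (\<alpha> 0) * sf (complex_of_real r * cis \<theta>)) \<longlongrightarrow> cnj (\<alpha> 0) * b \<theta>) (at_left 1)"
    using B.lim_b by eventually_elim (intro tendsto_intros)
qed

definition delta_bd :: "real \<Rightarrow> complex" where
  "delta_bd \<theta> = (1 - cnj (\<alpha> 0) * b \<theta>) / \<rho> * ((1 - cis \<theta> * b1 \<theta>) / (1 - cis \<theta> * b \<theta>))"

lemma delta_boundary:
  "AE \<theta> in dtheta. ((\<lambda>r. \<delta> (of_real r * cis \<theta>)) \<longlongrightarrow> delta_bd \<theta>) (at_left 1) \<and> delta_bd \<theta> \<noteq> 0"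
  using G0.lim_b G1.lim_b Ga.lim_b G0.boundary_ne_1 G1.boundary_ne_1 Ga.boundary_ne_1
proof eventually_elim
  fix \<theta>
  assume l: "((\<lambda>r. complex_of_real r * cis \<theta> * sf (complex_of_real r * cis \<theta>)) \<longlongrightarrow> cis \<theta> * b \<theta>) (at_left 1)"
    "((\<lambda>r. complex_of_real r * cis \<theta> * one.sf (complex_of_real r * cis \<theta>)) \<longlongrightarrow> cis \<theta> * b1 \<theta>) (at_left 1)"
    "((\<lambda>r. cnj (\<alpha> 0) * sf (complex_of_real r * cis \<theta>)) \<longlongrightarrow> cnj (\<alpha> 0) * b \<theta>) (at_left 1)"
    and ne: "cis \<theta> * b \<theta> \<noteq> 1" "cis \<theta> * b1 \<theta> \<noteq> 1" "cnj (\<alpha> 0) * b \<theta> \<noteq> 1"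
  show "((\<lambda>r. \<delta> (of_real r * cis \<theta>)) \<longlongrightarrow> delta_bd \<theta>) (at_left 1) \<and> delta_bd \<theta> \<noteq> 0"
    unfolding relative_szego_eq delta_bd_def using ne rho_pos
    by (auto intro!: tendsto_mult tendsto_divide tendsto_diff tendsto_const l)
qed

text \<open>The Schur step passes to radial limits. Taking moduli removes the unimodular factor
  \<open>cis \<theta>\<close>, and \<open>mobius_defect\<close> converts the modulus of
  \<open>b \<theta> - \<alpha> 0\<close> into the stated form.\<close>

lemma schur_step_boundary:
  "AE \<theta> in dtheta. (cmod (1 - cnj (\<alpha> 0) * b \<theta>))\<^sup>2 * (1 - (cmod (b1 \<theta>))\<^sup>2) = \<rho>\<^sup>2 * (1 - (cmod (b \<theta>))\<^sup>2)"
  using B.lim_b G1.lim_b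
proof eventually_elim
  fix \<theta>
  assume l: "((\<lambda>r. sf (complex_of_real r * cis \<theta>)) \<longlongrightarrow> b \<theta>) (at_left 1)"
    "((\<lambda>r. complex_of_real r * cis \<theta> * one.sf (complex_of_real r * cis \<theta>)) \<longlongrightarrow> cis \<theta> * b1 \<theta>) (at_left 1)"
  have "((\<lambda>r. complex_of_real r * cis \<theta> * one.sf (complex_of_real r * cis \<theta>) * (1 - cnj (\<alpha> 0) * sf (complex_of_real r * cis \<theta>)))
      \<longlongrightarrow> cis \<theta> * b1 \<theta> * (1 - cnj (\<alpha> 0) * b \<theta>)) (at_left 1)"
    by (intro tendsto_mult tendsto_diff tendsto_const l)
  then have "((\<lambda>r. sf (complex_of_real r * cis \<theta>) - \<alpha> 0) \<longlongrightarrow> cis \<theta> * b1 \<theta> * (1 - cnj (\<alpha> 0) * b \<theta>)) (at_left 1)"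
  proof (rule Lim_transform_eventually)
    show "eventually (\<lambda>r. complex_of_real r * cis \<theta> * one.sf (complex_of_real r * cis \<theta>) * (1 - cnj (\<alpha> 0) * sf (complex_of_real r * cis \<theta>))
       = sf (complex_of_real r * cis \<theta>) - \<alpha> 0) (at_left 1)"
      using eventually_radial by eventually_elim (rule sf_step[symmetric], simp add: norm_mult)
  qed
  moreover have "((\<lambda>r. sf (complex_of_real r * cis \<theta>) - \<alpha> 0) \<longlongrightarrow> b \<theta> - \<alpha> 0) (at_left 1)"
    by (intro tendsto_diff tendsto_const l)
  ultimately have "cis \<theta> * b1 \<theta> * (1 - cnj (\<alpha> 0) * b \<theta>) = b \<theta> - \<alpha> 0"
    using tendsto_unique[OF trivial_limit_at_left_real] by blast
  then have "cmod (b \<theta> - \<alpha> 0) = cmod (b1 \<theta>) * cmod (1 - cnj (\<alpha> 0) * b \<theta>)"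
    by (metis mult_1 norm_cis norm_mult)
  then have "(cmod (b \<theta> - \<alpha> 0))\<^sup>2 = (cmod (b1 \<theta>))\<^sup>2 * (cmod (1 - cnj (\<alpha> 0) * b \<theta>))\<^sup>2"
    by (simp add: power_mult_distrib)
  moreover have "\<rho>\<^sup>2 = 1 - (cmod (\<alpha> 0))\<^sup>2"
    using cmod_verblunsky[of 0] by (simp add: \<rho>_def abs_square_le_1)
  ultimately show "(cmod (1 - cnj (\<alpha> 0) * b \<theta>))\<^sup>2 * (1 - (cmod (b1 \<theta>))\<^sup>2) = \<rho>\<^sup>2 * (1 - (cmod (b \<theta>))\<^sup>2)"
  proof -
    assume E: "(cmod (b \<theta> - \<alpha> 0))\<^sup>2 = (cmod (b1 \<theta>))\<^sup>2 * (cmod (1 - cnj (\<alpha> 0) * b \<theta>))\<^sup>2"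
      and R: "\<rho>\<^sup>2 = 1 - (cmod (\<alpha> 0))\<^sup>2"
    have "(cmod (1 - cnj (\<alpha> 0) * b \<theta>))\<^sup>2 * (1 - (cmod (b1 \<theta>))\<^sup>2)
       = (cmod (1 - cnj (\<alpha> 0) * b \<theta>))\<^sup>2 - (cmod (b \<theta> - \<alpha> 0))\<^sup>2"
      unfolding E by (simp add: right_diff_distrib)
    then show ?thesis unfolding mobius_defect R .
  qed
qed

text \<open>By the Schur step the numerators of the two weights are proportional, with factors
  nonzero almost everywhere, so the weights vanish together and the quotient has the value of the
  boundary function.\<close>

lemma weight_ratio:
  assumes "lebesgue_decomposition \<mu> w \<nu>" "lebesgue_decomposition \<mu>1 w1 \<nu>1"
  shows "AE \<theta> in dtheta. (w \<theta> \<noteq> 0 \<longleftrightarrow> w1 \<theta> \<noteq> 0) \<and> (w1 \<theta> \<noteq> 0 \<longrightarrow> w \<theta> / w1 \<theta> = (cmod (delta_bd \<theta>))\<^sup>2)"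
  using weight_boundary[OF assms(1) bd0] one.weight_boundary[OF assms(2) bd1] schur_step_boundary
    G0.boundary_ne_1 G1.boundary_ne_1 Ga.boundary_ne_1
proof eventually_elim
  fix \<theta>
  assume w: "w \<theta> = (1 - (cmod (b \<theta>))\<^sup>2) / (cmod (1 - cis \<theta> * b \<theta>))\<^sup>2"
    "w1 \<theta> = (1 - (cmod (b1 \<theta>))\<^sup>2) / (cmod (1 - cis \<theta> * b1 \<theta>))\<^sup>2"
    and st: "(cmod (1 - cnj (\<alpha> 0) * b \<theta>))\<^sup>2 * (1 - (cmod (b1 \<theta>))\<^sup>2) = \<rho>\<^sup>2 * (1 - (cmod (b \<theta>))\<^sup>2)"
    and ne: "cis \<theta> * b \<theta> \<noteq> 1" "cis \<theta> * b1 \<theta> \<noteq> 1" "cnj (\<alpha> 0) * b \<theta> \<noteq> 1"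
  define A P Q X Y where "A = (cmod (1 - cnj (\<alpha> 0) * b \<theta>))\<^sup>2" and "P = (cmod (1 - cis \<theta> * b \<theta>))\<^sup>2"
    and "Q = (cmod (1 - cis \<theta> * b1 \<theta>))\<^sup>2" and "X = 1 - (cmod (b \<theta>))\<^sup>2" and "Y = 1 - (cmod (b1 \<theta>))\<^sup>2"
  have nz: "A \<noteq> 0" "P \<noteq> 0" "Q \<noteq> 0" using ne by (auto simp: A_def P_def Q_def)
  have r: "\<rho> \<noteq> 0" using rho_pos by simp
  have AY: "A * Y = \<rho>\<^sup>2 * X" using st by (simp add: A_def X_def Y_def)
  have X: "X = A * Y / \<rho>\<^sup>2" using AY r by (simp add: field_simps)
  have dd: "(cmod (delta_bd \<theta>))\<^sup>2 = A / \<rho>\<^sup>2 * (Q / P)"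
    using rho_pos by (simp add: delta_bd_def A_def P_def Q_def norm_mult norm_divide power_mult_distrib power_divide)
  have w': "w \<theta> = X / P" "w1 \<theta> = Y / Q" using w by (simp_all add: X_def Y_def P_def Q_def)
  show "(w \<theta> \<noteq> 0 \<longleftrightarrow> w1 \<theta> \<noteq> 0) \<and> (w1 \<theta> \<noteq> 0 \<longrightarrow> w \<theta> / w1 \<theta> = (cmod (delta_bd \<theta>))\<^sup>2)"
    unfolding w' dd X using nz r by (auto simp: field_simps)
qed

text \<open>The logarithm of the ratio is the boundary value of twice the real part of
  \<open>log_delta\<close>; Fatou's lemma carries the uniform H^p bound to the circle.\<close>

lemma log_ratio_integrable:
  assumes dec: "lebesgue_decomposition \<mu> w \<nu>" "lebesgue_decomposition \<mu>1 w1 \<nu>1" and p: "p \<ge> 1"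
  shows "(\<integral>\<^sup>+\<theta>\<in>{\<theta>. w1 \<theta> \<noteq> 0}. ennreal (\<bar>ln (w \<theta> / w1 \<theta>)\<bar> powr p) \<partial>dtheta) < \<infinity>"
proof -
  have p0: "p > 0" using p by simp
  obtain C where C: "\<And>r. 0 < r \<Longrightarrow> r < 1 \<Longrightarrow> (\<integral>\<^sup>+\<theta>. ennreal (cmod (log_delta (of_real r * cis \<theta>)) powr p) \<partial>dtheta) \<le> ennreal C"
    using log_delta_hardy[OF p0] unfolding hardy_space_iff by blast
  let ?l = "\<lambda>n \<theta>. log_delta (of_real (radial_seq n) * cis \<theta>)"
  let ?u = "\<lambda>n \<theta>. ennreal (\<bar>2 * Re (?l n \<theta>)\<bar> powr p)"
  have ml: "?l n \<in> borel_measurable dtheta" for n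
    by (intro measurable_dtheta_cont dilate_continuous_sphere log_delta_holomorphic radial_seq)
  note [measurable] = ml
  have "(\<integral>\<^sup>+\<theta>\<in>{\<theta>. w1 \<theta> \<noteq> 0}. ennreal (\<bar>ln (w \<theta> / w1 \<theta>)\<bar> powr p) \<partial>dtheta) \<le> (\<integral>\<^sup>+\<theta>. liminf (\<lambda>n. ?u n \<theta>) \<partial>dtheta)"
  proof (rule nn_integral_mono_AE, use weight_ratio[OF dec] delta_boundary in eventually_elim)
    fix \<theta>
    assume r: "(w \<theta> \<noteq> 0 \<longleftrightarrow> w1 \<theta> \<noteq> 0) \<and> (w1 \<theta> \<noteq> 0 \<longrightarrow> w \<theta> / w1 \<theta> = (cmod (delta_bd \<theta>))\<^sup>2)"
      and l: "((\<lambda>r. \<delta> (of_real r * cis \<theta>)) \<longlongrightarrow> delta_bd \<theta>) (at_left 1) \<and> delta_bd \<theta> \<noteq> 0"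
    show "ennreal (\<bar>ln (w \<theta> / w1 \<theta>)\<bar> powr p) * indicator {\<theta>. w1 \<theta> \<noteq> 0} \<theta> \<le> liminf (\<lambda>n. ?u n \<theta>)"
    proof (cases "w1 \<theta> = 0")
      case False
      have "Re (?l n \<theta>) = ln (cmod (\<delta> (of_real (radial_seq n) * cis \<theta>)))" for n
        using exp_log_delta[OF G0.norm_lt[of n \<theta>]] by (metis ln_exp norm_exp_eq_Re)
      moreover have "(\<lambda>n. ln (cmod (\<delta> (of_real (radial_seq n) * cis \<theta>)))) \<longlonglongrightarrow> ln (cmod (delta_bd \<theta>))"
        using l radial_limit_seq[of "\<lambda>r. \<delta> (of_real r * cis \<theta>)" "delta_bd \<theta>"] by (intro tendsto_ln tendsto_norm) auto
      ultimately have "(\<lambda>n. Re (?l n \<theta>)) \<longlonglongrightarrow> ln (cmod (delta_bd \<theta>))" by simp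
      then have "(\<lambda>n. ?u n \<theta>) \<longlonglongrightarrow> ennreal (\<bar>2 * ln (cmod (delta_bd \<theta>))\<bar> powr p)"
        using p0 by (intro tendsto_ennrealI tendsto_powr' tendsto_rabs tendsto_mult tendsto_const) auto
      moreover have "ln (w \<theta> / w1 \<theta>) = 2 * ln (cmod (delta_bd \<theta>))"
        using r False l by (simp add: ln_realpow)
      ultimately have "liminf (\<lambda>n. ?u n \<theta>) = ennreal (\<bar>ln (w \<theta> / w1 \<theta>)\<bar> powr p)"
        by (intro lim_imp_Liminf) auto
      then show ?thesis by (simp add: indicator_def)
    qed simp
  qed
  also have "\<dots> \<le> liminf (\<lambda>n. \<integral>\<^sup>+\<theta>. ?u n \<theta> \<partial>dtheta)" by (rule nn_integral_liminf) measurable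
  also have "\<dots> \<le> liminf (\<lambda>n. ennreal (2 powr p) * ennreal C)"
  proof (intro Liminf_mono always_eventually allI)
    fix n
    have "(\<integral>\<^sup>+\<theta>. ?u n \<theta> \<partial>dtheta) \<le> (\<integral>\<^sup>+\<theta>. ennreal (2 powr p) * ennreal (cmod (?l n \<theta>) powr p) \<partial>dtheta)"
    proof (rule nn_integral_mono)
      fix \<theta>
      have "\<bar>2 * Re (?l n \<theta>)\<bar> powr p \<le> (2 * cmod (?l n \<theta>)) powr p"
        using abs_Re_le_cmod[of "?l n \<theta>"] p0 by (intro powr_mono2) auto
      also have "\<dots> = 2 powr p * cmod (?l n \<theta>) powr p" by (simp add: powr_mult)
      finally have "?u n \<theta> \<le> ennreal (2 powr p * cmod (?l n \<theta>) powr p)" by (rule ennreal_leI)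
      then show "?u n \<theta> \<le> ennreal (2 powr p) * ennreal (cmod (?l n \<theta>) powr p)" by (simp add: ennreal_mult)
    qed
    also have "\<dots> = ennreal (2 powr p) * (\<integral>\<^sup>+\<theta>. ennreal (cmod (?l n \<theta>) powr p) \<partial>dtheta)"
      by (rule nn_integral_cmult) measurable
    also have "\<dots> \<le> ennreal (2 powr p) * ennreal C" by (intro mult_left_mono C radial_seq) auto
    finally show "(\<integral>\<^sup>+\<theta>. ?u n \<theta> \<partial>dtheta) \<le> ennreal (2 powr p) * ennreal C" .
  qed
  also have "\<dots> = ennreal (2 powr p) * ennreal C" by (simp add: Liminf_const)
  also have "\<dots> < \<infinity>" by (simp add: ennreal_mult_less_top)
  finally show ?thesis .
qed

end

text \<open>The weight formula splits ln w into the logarithm of 1 - |b|^2, integrable by the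
  entropy bound, and a boundary logarithm of 1 - z f, integrable by the H^1 bound.\<close>

lemma (in nontrivial_circle) log_weight_integrable:
  assumes dec: "lebesgue_decomposition \<mu> w \<nu>" and summ: "summable (\<lambda>j. (cmod (\<alpha> j))\<^sup>2)"
    and bd: "disk_self_map_boundary sf b" and bd0: "disk_self_map_boundary (\<lambda>z. z * sf z) (\<lambda>\<theta>. cis \<theta> * b \<theta>)"
  shows "AE \<theta> in dtheta. w \<theta> > 0" "integrable dtheta (\<lambda>\<theta>. ln (w \<theta>))"
proof -
  interpret B: disk_self_map_boundary sf b by (rule bd)
  interpret G: disk_self_map_boundary "\<lambda>z. z * sf z" "\<lambda>\<theta>. cis \<theta> * b \<theta>" by (rule bd0)
  have w: "w \<in> borel_measurable borel"
    using dec measurable_cong_sets[OF sets_dtheta refl] unfolding lebesgue_decomposition_def by blast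
  note ent = boundary_entropy[OF summ bd]
  have both: "AE \<theta> in dtheta. w \<theta> > 0 \<and> ln (1 - (cmod (b \<theta>))\<^sup>2) - 2 * ln (cmod (1 - cis \<theta> * b \<theta>)) = ln (w \<theta>)"
    using weight_boundary[OF dec bd0] ent(1) G.boundary_ne_1
  proof eventually_elim
    fix \<theta> assume w: "w \<theta> = (1 - (cmod (b \<theta>))\<^sup>2) / (cmod (1 - cis \<theta> * b \<theta>))\<^sup>2"
      and b1: "cmod (b \<theta>) < 1" and ne: "cis \<theta> * b \<theta> \<noteq> 1"
    have pos: "1 - (cmod (b \<theta>))\<^sup>2 > 0" "cmod (1 - cis \<theta> * b \<theta>) > 0" using b1 ne by (auto simp: abs_square_less_1)
    then show "w \<theta> > 0 \<and> ln (1 - (cmod (b \<theta>))\<^sup>2) - 2 * ln (cmod (1 - cis \<theta> * b \<theta>)) = ln (w \<theta>)"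
      unfolding w by (simp add: ln_div ln_realpow)
  qed
  then show "AE \<theta> in dtheta. w \<theta> > 0" by eventually_elim simp
  have "integrable dtheta (\<lambda>\<theta>. ln (1 - (cmod (b \<theta>))\<^sup>2) - 2 * ln (cmod (1 - cis \<theta> * b \<theta>)))"
    by (intro Bochner_Integration.integrable_diff ent(2) integrable_mult_right G.integrable_log_boundary)
  moreover have "AE \<theta> in dtheta. ln (1 - (cmod (b \<theta>))\<^sup>2) - 2 * ln (cmod (1 - cis \<theta> * b \<theta>)) = ln (w \<theta>)"
    using both by eventually_elim simp
  ultimately show "integrable dtheta (\<lambda>\<theta>. ln (w \<theta>))"
    using w by (subst integrable_cong_AE[symmetric]) auto
qed

context stripped_boundary
begin

text \<open>Both log weights are integrable, so the exponents of the Szego functions may be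
  subtracted. The difference splits into boundary logarithms of three factors and a constant, and
  \<open>schwarz_log\<close> recovers each factor up to an imaginary constant.\<close>

lemma delta_szego:
  assumes dec: "lebesgue_decomposition \<mu> w \<nu>" "lebesgue_decomposition \<mu>1 w1 \<nu>1"
    and summ: "summable (\<lambda>j. (cmod (\<alpha> j))\<^sup>2)" and z: "cmod z < 1"
  shows "\<delta> z = szego_fun w z / szego_fun w1 z"
proof -
  have summ1: "summable (\<lambda>j. (cmod (one.\<alpha> j))\<^sup>2)"
    unfolding shift using summ by (subst summable_Suc_iff[of "\<lambda>j. (cmod (\<alpha> j))\<^sup>2"])
  have wm: "w \<in> borel_measurable borel" "w1 \<in> borel_measurable borel"
    using dec measurable_cong_sets[OF sets_dtheta refl] unfolding lebesgue_decomposition_def by blast+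
  note W = log_weight_integrable[OF dec(1) summ bd bd0]
  note W1 = one.log_weight_integrable[OF dec(2) summ1 bd' bd1]
  let ?k = "\<lambda>\<theta>. herglotz z (cis \<theta>)"
  let ?a = "\<lambda>\<theta>. ln (cmod (1 - cnj (\<alpha> 0) * b \<theta>))" and ?c = "\<lambda>\<theta>. ln (cmod (1 - cis \<theta> * b1 \<theta>))"
    and ?e = "\<lambda>\<theta>. ln (cmod (1 - cis \<theta> * b \<theta>))"
  have mk: "?k \<in> borel_measurable dtheta" by (rule measurable_dtheta_cont[OF herglotz_continuous[OF z]])
  have lin: "(LINT \<theta>|dtheta. ?k \<theta> * complex_of_real (f \<theta> - g \<theta>))
      = (LINT \<theta>|dtheta. ?k \<theta> * complex_of_real (f \<theta>)) - (LINT \<theta>|dtheta. ?k \<theta> * complex_of_real (g \<theta>))"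
    if "integrable dtheta f" "integrable dtheta g" for f g :: "real \<Rightarrow> real"
    unfolding of_real_diff right_diff_distrib
    by (intro Bochner_Integration.integral_diff integrable_herglotz_mult z that)
  have linp: "(LINT \<theta>|dtheta. ?k \<theta> * complex_of_real (f \<theta> + g \<theta>))
      = (LINT \<theta>|dtheta. ?k \<theta> * complex_of_real (f \<theta>)) + (LINT \<theta>|dtheta. ?k \<theta> * complex_of_real (g \<theta>))"
    if "integrable dtheta f" "integrable dtheta g" for f g :: "real \<Rightarrow> real"
    unfolding of_real_add distrib_left
    by (intro Bochner_Integration.integral_add integrable_herglotz_mult z that)
  have ia: "integrable dtheta ?a" "integrable dtheta ?c" "integrable dtheta ?e"
    by (rule Ga.integrable_log_boundary G1.integrable_log_boundary G0.integrable_log_boundary)+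
  have h1: "(LINT \<theta>|dtheta. ?k \<theta> * complex_of_real (ln \<rho>)) = complex_of_real (ln \<rho>)"
    using schwarz_formula[of "\<lambda>_. complex_of_real (ln \<rho>)" z] z by simp
  \<comment> \<open>The imaginary constants vanish: z f and z f_1 are 0 at the origin, and f(0) =
    alpha_0 makes the remaining factor there the positive number
    \<open>\<rho> * \<rho>\<close>.\<close>
  have Im0: "Im (ga.log1m 0) = 0" "Im (g0.log1m 0) = 0" "Im (g1.log1m 0) = 0"
  proof -
    have "sf 0 = \<alpha> 0" using sf_step[of 0] by simp
    then have "1 - cnj (\<alpha> 0) * sf 0 = complex_of_real (\<rho> * \<rho>)"
      using rho_sq by (simp add: mult.commute)
    then have "ga.log1m 0 = complex_of_real (ln (\<rho> * \<rho>))"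
      unfolding ga.log1m_def using rho_pos by (simp only: Ln_of_real mult_pos_pos)
    then show "Im (ga.log1m 0) = 0" by simp
    show "Im (g0.log1m 0) = 0" "Im (g1.log1m 0) = 0" by (simp_all add: g0.log1m_def g1.log1m_def)
  qed
  have "(LINT \<theta>|dtheta. ?k \<theta> * complex_of_real (ln (w \<theta>) - ln (w1 \<theta>)))
     = (LINT \<theta>|dtheta. 2 * (?k \<theta> * complex_of_real (?a \<theta> + ?c \<theta> - ?e \<theta> - ln \<rho>)))"
  proof (rule integral_cong_AE)
    show "AE \<theta> in dtheta. ?k \<theta> * complex_of_real (ln (w \<theta>) - ln (w1 \<theta>))
        = 2 * (?k \<theta> * complex_of_real (?a \<theta> + ?c \<theta> - ?e \<theta> - ln \<rho>))"
      using weight_ratio[OF dec] W(1) W1(1) G0.boundary_ne_1 G1.boundary_ne_1 Ga.boundary_ne_1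
    proof eventually_elim
      fix \<theta>
      assume r: "(w \<theta> \<noteq> 0 \<longleftrightarrow> w1 \<theta> \<noteq> 0) \<and> (w1 \<theta> \<noteq> 0 \<longrightarrow> w \<theta> / w1 \<theta> = (cmod (delta_bd \<theta>))\<^sup>2)"
        and pos: "w \<theta> > 0" "w1 \<theta> > 0"
        and ne: "cis \<theta> * b \<theta> \<noteq> 1" "cis \<theta> * b1 \<theta> \<noteq> 1" "cnj (\<alpha> 0) * b \<theta> \<noteq> 1"
      have "ln (w \<theta>) - ln (w1 \<theta>) = ln (w \<theta> / w1 \<theta>)" using pos by (simp add: ln_div)
      also have "w \<theta> / w1 \<theta> = (cmod (delta_bd \<theta>))\<^sup>2" using r pos by simp
      also have "ln ((cmod (delta_bd \<theta>))\<^sup>2) = 2 * ln (cmod (delta_bd \<theta>))"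
        by (simp add: ln_realpow)
      also have "cmod (delta_bd \<theta>) = cmod (1 - cnj (\<alpha> 0) * b \<theta>) / \<rho> * (cmod (1 - cis \<theta> * b1 \<theta>) / cmod (1 - cis \<theta> * b \<theta>))"
        using rho_pos by (simp add: delta_bd_def norm_mult norm_divide)
      also have "ln \<dots> = ?a \<theta> + ?c \<theta> - ?e \<theta> - ln \<rho>"
        using ne rho_pos by (simp add: ln_mult ln_div)
      finally have "ln (w \<theta>) - ln (w1 \<theta>) = 2 * (?a \<theta> + ?c \<theta> - ?e \<theta> - ln \<rho>)" .
      then show "?k \<theta> * complex_of_real (ln (w \<theta>) - ln (w1 \<theta>)) = 2 * (?k \<theta> * complex_of_real (?a \<theta> + ?c \<theta> - ?e \<theta> - ln \<rho>))"
        by (simp only: of_real_mult of_real_numeral mult.left_commute)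
    qed
    show "(\<lambda>\<theta>. ?k \<theta> * complex_of_real (ln (w \<theta>) - ln (w1 \<theta>))) \<in> borel_measurable dtheta" using mk wm by measurable
    show "(\<lambda>\<theta>. 2 * (?k \<theta> * complex_of_real (?a \<theta> + ?c \<theta> - ?e \<theta> - ln \<rho>))) \<in> borel_measurable dtheta"
      using mk by measurable
  qed
  also have "\<dots> = 2 * (LINT \<theta>|dtheta. ?k \<theta> * complex_of_real (?a \<theta> + ?c \<theta> - ?e \<theta> - ln \<rho>))"
    by (rule integral_mult_right_zero)
  also have "(LINT \<theta>|dtheta. ?k \<theta> * complex_of_real (?a \<theta> + ?c \<theta> - ?e \<theta> - ln \<rho>)) = ga.log1m z + g1.log1m z - g0.log1m z - complex_of_real (ln \<rho>)"
    using ia Ga.schwarz_log[OF z] G1.schwarz_log[OF z] G0.schwarz_log[OF z] Im0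
      lin[of "\<lambda>\<theta>. ?a \<theta> + ?c \<theta> - ?e \<theta>" "\<lambda>_. ln \<rho>"] lin[of "\<lambda>\<theta>. ?a \<theta> + ?c \<theta>" ?e] linp[of ?a ?c] h1
    by simp
  also have "\<dots> = log_delta z" by (simp add: log_delta_def)
  finally have I: "(LINT \<theta>|dtheta. ?k \<theta> * complex_of_real (ln (w \<theta>) - ln (w1 \<theta>))) = 2 * log_delta z" .
  have "szego_fun w z / szego_fun w1 z
     = exp ((LINT \<theta>|dtheta. ?k \<theta> * complex_of_real (ln (w \<theta>) - ln (w1 \<theta>))) / 2)"
    unfolding szego_fun_dtheta[OF z wm(1)] szego_fun_dtheta[OF z wm(2)] lin[OF W(2) W1(2)]
    by (simp add: exp_diff diff_divide_distrib)
  also have "\<dots> = \<delta> z" unfolding I using exp_log_delta[OF z] by simp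
  finally show ?thesis by simp
qed

end

text \<open>Existence of a branch keeps the clause about all branches from being vacuous. The
  implications between nonvanishing of the two weights keep the default values of \<open>ln\<close>
  and of division at 0 out of the integral, up to a null set. Truncation of \<open>n - 1\<close>
  concerns n = 0 only.\<close>

theorem theorem2p2:
  fixes \<mu> \<mu>\<^sub>s \<mu>\<^sub>1 \<mu>\<^sub>1\<^sub>s :: "complex measure" and w w\<^sub>1 :: "real \<Rightarrow> real"
  assumes "nontrivial_circle_prob \<mu>"
    and "lebesgue_decomposition \<mu> w \<mu>\<^sub>s"
    and "nontrivial_circle_prob \<mu>\<^sub>1"
    and "lebesgue_decomposition \<mu>\<^sub>1 w\<^sub>1 \<mu>\<^sub>1\<^sub>s"
    and "\<And>j. verblunsky \<mu>\<^sub>1 j = verblunsky \<mu> (Suc j)"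
  shows "let \<delta> = relative_szego \<mu> \<mu>\<^sub>1 in
     (\<delta> holomorphic_on ball 0 1 \<and> (\<forall>z\<in>ball 0 1. \<delta> z \<noteq> 0))
   \<and> ((\<exists>L. holomorphic_log_branch \<delta> L) \<and>
      (\<forall>L. holomorphic_log_branch \<delta> L \<longrightarrow> L \<in> (\<Inter>p\<in>{1..}. hardy_space p)))
   \<and> ((AE \<theta> in dtheta. w \<theta> \<noteq> 0 \<longrightarrow>
          w\<^sub>1 \<theta> \<noteq> 0 \<and>
          (\<exists>b. ((\<lambda>r. \<delta> (of_real r * cis \<theta>)) \<longlongrightarrow> b) (at_left (1::real)) \<and>
               w \<theta> / w\<^sub>1 \<theta> = (cmod b)\<^sup>2)) \<and>
      (AE \<theta> in dtheta. w\<^sub>1 \<theta> \<noteq> 0 \<longrightarrow> w \<theta> \<noteq> 0) \<and>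
      (\<forall>p::real. p \<ge> 1 \<longrightarrow>
          (\<integral>\<^sup>+\<theta>\<in>{\<theta>. w\<^sub>1 \<theta> \<noteq> 0}. ennreal (\<bar>ln (w \<theta> / w\<^sub>1 \<theta>)\<bar> powr p) \<partial>dtheta) < \<infinity>))
   \<and> (summable (\<lambda>j. (cmod (verblunsky \<mu> j))\<^sup>2) \<longrightarrow>
        (\<forall>z\<in>ball 0 1. \<delta> z = szego_fun w z / szego_fun w\<^sub>1 z))
   \<and> (\<forall>z\<in>ball 0 1.
        (\<lambda>n. poly (reversed_poly (orthonormal_opuc \<mu>\<^sub>1 (n - 1))) z /
             poly (reversed_poly (orthonormal_opuc \<mu> n)) z) \<longlonglongrightarrow> \<delta> z)"
proof -
  interpret stripped_pair \<mu> \<mu>\<^sub>1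
    using assms(1,3,5) by (intro stripped_pair.intro nontrivial_circle.intro stripped_pair_axioms.intro)
  \<comment> \<open>The boundary functions are chosen once and fixed as locale parameters, so that
    all boundary clauses refer to the same pair.\<close>
  obtain b where b: "disk_self_map_boundary sf b" "disk_self_map_boundary (\<lambda>z. z * sf z) (\<lambda>\<theta>. cis \<theta> * b \<theta>)"
    using schur_boundary by blast
  obtain b1 where b1: "disk_self_map_boundary one.sf b1" "disk_self_map_boundary (\<lambda>z. z * one.sf z) (\<lambda>\<theta>. cis \<theta> * b1 \<theta>)"
    using one.schur_boundary by blast
  interpret stripped_boundary \<mu> \<mu>\<^sub>1 b b1
    using b b1 by (intro stripped_boundary.intro stripped_pair_axioms stripped_boundary_axioms.intro)
  note dec = assms(2,4)
  have "holomorphic_log_branch \<delta> log_delta"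
    using log_delta_holomorphic exp_log_delta by (simp add: holomorphic_log_branch_def)
  moreover have "AE \<theta> in dtheta. w \<theta> \<noteq> 0 \<longrightarrow> w\<^sub>1 \<theta> \<noteq> 0 \<and>
      (\<exists>b. ((\<lambda>r. \<delta> (of_real r * cis \<theta>)) \<longlongrightarrow> b) (at_left (1::real)) \<and> w \<theta> / w\<^sub>1 \<theta> = (cmod b)\<^sup>2)"
    using weight_ratio[OF dec] delta_boundary by eventually_elim blast
  moreover have "AE \<theta> in dtheta. w\<^sub>1 \<theta> \<noteq> 0 \<longrightarrow> w \<theta> \<noteq> 0"
    using weight_ratio[OF dec] by eventually_elim blast
  moreover have "L \<in> (\<Inter>p\<in>{1..}. hardy_space p)" if "holomorphic_log_branch \<delta> L" for L
    using log_branch_hardy[OF that] by force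
  ultimately show ?thesis
    unfolding Let_def
    using relative_szego_holomorphic relative_szego_nonzero log_ratio_integrable[OF dec]
      delta_szego[OF dec] ratio_tendsto by (intro conjI) auto
qed

end
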